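(* In the online bipartite matching problem with replacements (servers $S$ given in advance; clients arriving one at a time with all their incident edges), there is an implementation of the SAP protocol whose total running time over the whole sequence of insertions is $O(m\sqrt{n}\sqrt{\log n})$, where $n$ is the total number of clients and $m$ is the total number of edges in the final graph.
   Context: The SAP protocol: when a client $c$ arrives, if there is an augmenting path (with respect to the current matching) from $c$ to an unmatched server, augment along a shortest such path (ties broken arbitrarily); otherwise do nothing. An augmenting path is a path alternating between unmatched and matched edges, starting and ending at unmatched vertices; augmenting flips the matched status of its edges.
   Formalization: The time bound is proved for n ≥ 2 and n ≤ m (as when every client has an edge); without this it fails, since n clients with no edges cost at least n steps while the bound is 0, and log n = 0 for n = 1. That the program follows SAP is proved for all instances. *)

theory Defs
  imports Complex_Main
begin

section \<open>Augmenting paths and the SAP protocol\<close>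

text \<open>Undirected edges are two-element sets; graphs and matchings are sets of edges.\<close>

definition is_path :: "'v set set \<Rightarrow> 'v list \<Rightarrow> bool" where
  "is_path E p \<longleftrightarrow>
     p \<noteq> [] \<and> distinct p \<and> (\<forall>k. Suc k < length p \<longrightarrow> {p ! k, p ! Suc k} \<in> E)"

definition path_edges :: "'v list \<Rightarrow> 'v set set" where
  "path_edges p = {{p ! k, p ! Suc k} | k. Suc k < length p}"

definition unmatched :: "'v set set \<Rightarrow> 'v \<Rightarrow> bool" where
  "unmatched M v \<longleftrightarrow> v \<notin> \<Union>M"

definition alternating :: "'v set set \<Rightarrow> 'v list \<Rightarrow> bool" where
  "alternating M p \<longleftrightarrow>
     (\<forall>k. Suc (Suc k) < length p \<longrightarrow>
        ({p ! k, p ! Suc k} \<in> M \<longleftrightarrow> {p ! Suc k, p ! Suc (Suc k)} \<notin> M))"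

definition augmenting_path :: "'v set set \<Rightarrow> 'v set set \<Rightarrow> 'v list \<Rightarrow> bool" where
  "augmenting_path E M p \<longleftrightarrow>
     is_path E p \<and> 2 \<le> length p \<and> alternating M p \<and> unmatched M (hd p) \<and> unmatched M (last p)"

definition augment :: "'v set set \<Rightarrow> 'v list \<Rightarrow> 'v set set" where
  "augment M p = sym_diff M (path_edges p)"

datatype vertex = Client nat | Server nat

definition augmenting_from ::
  "vertex set set \<Rightarrow> vertex set set \<Rightarrow> nat \<Rightarrow> vertex list \<Rightarrow> bool" where
  "augmenting_from E M c p \<longleftrightarrow>
     augmenting_path E M p \<and> hd p = Client c \<and> (\<exists>v. last p = Server v)"

text \<open>
  \<open>sap_step E M c M'\<close>: on arrival of client \<open>c\<close>, where \<open>E\<close> already contains the edges of \<open>c\<close>, the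
  protocol may replace the matching \<open>M\<close> by \<open>M'\<close>. It is a relation because ties between shortest
  paths are broken arbitrarily.
\<close>

definition sap_step ::
  "vertex set set \<Rightarrow> vertex set set \<Rightarrow> nat \<Rightarrow> vertex set set \<Rightarrow> bool" where
  "sap_step E M c M' \<longleftrightarrow>
     (if \<exists>p. augmenting_from E M c p
      then \<exists>p. is_arg_min length (augmenting_from E M c) p \<and> M' = augment M p
      else M' = M)"

section \<open>Online instances\<close>

text \<open>
  The servers are \<open>0, \<dots>, s - 1\<close>, and the clients are numbered \<open>0, 1, \<dots>\<close> in order of arrival;
  \<open>Ns ! c\<close> lists the neighbours of client \<open>c\<close>, in arbitrary order.
\<close>

definition online_instance :: "nat \<Rightarrow> nat list list \<Rightarrow> bool" where
  "online_instance s Ns \<longleftrightarrow> (\<forall>N \<in> set Ns. distinct N \<and> set N \<subseteq> {..<s})"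

definition graph_of :: "nat list list \<Rightarrow> vertex set set" where
  "graph_of Ns = {{Client c, Server v} | c v. c < length Ns \<and> v \<in> set (Ns ! c)}"

section \<open>A word RAM\<close>

text \<open>
  Programs of a while language over finitely many registers and finitely many word-addressed arrays,
  with unit cost for each arithmetic operation, comparison, memory access and control step. With
  words of \<open>w\<close> bits every computed value has to be below \<open>2 ^ w\<close>: an execution that overflows is
  stuck.
\<close>

datatype binop = Add | Sub | Mul | Div | Mod

fun binop_val :: "binop \<Rightarrow> nat \<Rightarrow> nat \<Rightarrow> nat" where
  "binop_val Add x y = x + y"
| "binop_val Sub x y = x - y"
| "binop_val Mul x y = x * y"
| "binop_val Div x y = x div y"
| "binop_val Mod x y = x mod y"

datatype aexp =
    Const nat
  | Reg string
  | Load string aexp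
  | BinOp binop aexp aexp

datatype bexp =
    Less aexp aexp
  | Equal aexp aexp
  | Neg bexp
  | Conj bexp bexp

datatype com =
    Skip
  | Assign string aexp
  | Store string aexp aexp
  | Seq com com
  | Cond bexp com com
  | While bexp com

record state =
  regs :: "string \<Rightarrow> nat"
  arrs :: "string \<Rightarrow> nat \<Rightarrow> nat"

fun aval :: "aexp \<Rightarrow> state \<Rightarrow> nat" where
  "aval (Const k) \<sigma> = k"
| "aval (Reg x) \<sigma> = regs \<sigma> x"
| "aval (Load a e) \<sigma> = arrs \<sigma> a (aval e \<sigma>)"
| "aval (BinOp f e e') \<sigma> = binop_val f (aval e \<sigma>) (aval e' \<sigma>)"

fun acost :: "aexp \<Rightarrow> nat" where
  "acost (Const k) = 1"
| "acost (Reg x) = 1"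
| "acost (Load a e) = 1 + acost e"
| "acost (BinOp f e e') = 1 + acost e + acost e'"

fun afits :: "nat \<Rightarrow> aexp \<Rightarrow> state \<Rightarrow> bool" where
  "afits w (Const k) \<sigma> \<longleftrightarrow> k < 2 ^ w"
| "afits w (Reg x) \<sigma> \<longleftrightarrow> regs \<sigma> x < 2 ^ w"
| "afits w (Load a e) \<sigma> \<longleftrightarrow> afits w e \<sigma> \<and> aval (Load a e) \<sigma> < 2 ^ w"
| "afits w (BinOp f e e') \<sigma> \<longleftrightarrow> afits w e \<sigma> \<and> afits w e' \<sigma> \<and> aval (BinOp f e e') \<sigma> < 2 ^ w"

fun bval :: "bexp \<Rightarrow> state \<Rightarrow> bool" where
  "bval (Less e e') \<sigma> \<longleftrightarrow> aval e \<sigma> < aval e' \<sigma>"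
| "bval (Equal e e') \<sigma> \<longleftrightarrow> aval e \<sigma> = aval e' \<sigma>"
| "bval (Neg b) \<sigma> \<longleftrightarrow> \<not> bval b \<sigma>"
| "bval (Conj b b') \<sigma> \<longleftrightarrow> bval b \<sigma> \<and> bval b' \<sigma>"

fun bcost :: "bexp \<Rightarrow> nat" where
  "bcost (Less e e') = 1 + acost e + acost e'"
| "bcost (Equal e e') = 1 + acost e + acost e'"
| "bcost (Neg b) = 1 + bcost b"
| "bcost (Conj b b') = 1 + bcost b + bcost b'"

fun bfits :: "nat \<Rightarrow> bexp \<Rightarrow> state \<Rightarrow> bool" where
  "bfits w (Less e e') \<sigma> \<longleftrightarrow> afits w e \<sigma> \<and> afits w e' \<sigma>"
| "bfits w (Equal e e') \<sigma> \<longleftrightarrow> afits w e \<sigma> \<and> afits w e' \<sigma>"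
| "bfits w (Neg b) \<sigma> \<longleftrightarrow> bfits w b \<sigma>"
| "bfits w (Conj b b') \<sigma> \<longleftrightarrow> bfits w b \<sigma> \<and> bfits w b' \<sigma>"

text \<open>\<open>exec w P \<sigma> t \<sigma>'\<close>: with \<open>w\<close>-bit words, \<open>P\<close> takes \<open>\<sigma>\<close> to \<open>\<sigma>'\<close> in time \<open>t\<close>.\<close>

inductive exec :: "nat \<Rightarrow> com \<Rightarrow> state \<Rightarrow> nat \<Rightarrow> state \<Rightarrow> bool" for w :: nat where
  Skip: "exec w Skip \<sigma> 1 \<sigma>"
| Assign: "afits w e \<sigma> \<Longrightarrow>
    exec w (Assign x e) \<sigma> (1 + acost e) (\<sigma>\<lparr>regs := (regs \<sigma>)(x := aval e \<sigma>)\<rparr>)"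
| Store: "afits w i \<sigma> \<Longrightarrow> afits w e \<sigma> \<Longrightarrow>
    exec w (Store a i e) \<sigma> (1 + acost i + acost e)
      (\<sigma>\<lparr>arrs := (arrs \<sigma>)(a := (arrs \<sigma> a)(aval i \<sigma> := aval e \<sigma>))\<rparr>)"
| Seq: "exec w P \<sigma> t \<sigma>' \<Longrightarrow> exec w Q \<sigma>' t' \<sigma>'' \<Longrightarrow> exec w (Seq P Q) \<sigma> (t + t') \<sigma>''"
| CondTrue: "bfits w b \<sigma> \<Longrightarrow> bval b \<sigma> \<Longrightarrow> exec w P \<sigma> t \<sigma>' \<Longrightarrow>
    exec w (Cond b P Q) \<sigma> (1 + bcost b + t) \<sigma>'"
| CondFalse: "bfits w b \<sigma> \<Longrightarrow> \<not> bval b \<sigma> \<Longrightarrow> exec w Q \<sigma> t \<sigma>' \<Longrightarrow>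
    exec w (Cond b P Q) \<sigma> (1 + bcost b + t) \<sigma>'"
| WhileFalse: "bfits w b \<sigma> \<Longrightarrow> \<not> bval b \<sigma> \<Longrightarrow> exec w (While b P) \<sigma> (1 + bcost b) \<sigma>"
| WhileTrue: "bfits w b \<sigma> \<Longrightarrow> bval b \<sigma> \<Longrightarrow> exec w P \<sigma> t \<sigma>' \<Longrightarrow> exec w (While b P) \<sigma>' t' \<sigma>'' \<Longrightarrow>
    exec w (While b P) \<sigma> (1 + bcost b + t + t') \<sigma>''"

inductive_cases exec_SkipE: "exec w Skip \<sigma> t \<sigma>'"
inductive_cases exec_AssignE: "exec w (Assign x e) \<sigma> t \<sigma>'"
inductive_cases exec_StoreE: "exec w (Store a i e) \<sigma> t \<sigma>'"
inductive_cases exec_SeqE: "exec w (Seq P Q) \<sigma> t \<sigma>'"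
inductive_cases exec_CondE: "exec w (Cond b P Q) \<sigma> t \<sigma>'"
inductive_cases exec_WhileE: "exec w (While b P) \<sigma> t \<sigma>'"

lemma exec_deterministic:
  "exec w P \<sigma> t \<sigma>' \<Longrightarrow> exec w P \<sigma> u \<sigma>'' \<Longrightarrow> u = t \<and> \<sigma>'' = \<sigma>'"
proof (induction arbitrary: u \<sigma>'' rule: exec.induct)
  case (Skip \<sigma>)
  then show ?case by (rule exec_SkipE) simp
next
  case (Assign e \<sigma> x)
  from Assign.prems show ?case by (rule exec_AssignE) simp
next
  case (Store i \<sigma> e a)
  from Store.prems show ?case by (rule exec_StoreE) simp
next
  case (Seq P \<sigma> t \<sigma>' Q t' \<rho>)
  from Seq.prems show ?case
  proof (rule exec_SeqE)
    fix t1 \<sigma>1 t2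
    assume *: "u = t1 + t2" "exec w P \<sigma> t1 \<sigma>1" "exec w Q \<sigma>1 t2 \<sigma>''"
    from Seq.IH(1)[OF *(2)] *(3) have "exec w Q \<sigma>' t2 \<sigma>''" by simp
    from Seq.IH(2)[OF this] Seq.IH(1)[OF *(2)] *(1) show ?thesis by simp
  qed
next
  case (CondTrue b \<sigma> P t \<sigma>' Q)
  from CondTrue.prems show ?case
    by (rule exec_CondE) (use CondTrue.hyps in \<open>auto dest: CondTrue.IH\<close>)
next
  case (CondFalse b \<sigma> Q t \<sigma>' P)
  from CondFalse.prems show ?case
    by (rule exec_CondE) (use CondFalse.hyps in \<open>auto dest: CondFalse.IH\<close>)
next
  case (WhileFalse b \<sigma> P)
  from WhileFalse.prems show ?case
    by (rule exec_WhileE) (use WhileFalse.hyps in simp_all)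
next
  case (WhileTrue b \<sigma> P t \<sigma>' t' \<rho>)
  from WhileTrue.prems show ?case
  proof cases
    case WhileFalse
    with WhileTrue.hyps show ?thesis by simp
  next
    case step: (WhileTrue t1 \<sigma>1 t2)
    from WhileTrue.IH(1)[OF step(4)] step(5) have "exec w (While b P) \<sigma>' t2 \<sigma>''" by simp
    from WhileTrue.IH(2)[OF this] WhileTrue.IH(1)[OF step(4)] step(1) show ?thesis by simp
  qed
qed

section \<open>Implementations of SAP\<close>

text \<open>
  One program handles every arrival. Initially the memory is zero, apart from the number of servers;
  on an arrival the environment writes the degree and the neighbours of the new client. The number
  of clients and the later arrivals are unknown to the program.
\<close>

definition initial_state :: "nat \<Rightarrow> state" where
  "initial_state s = \<lparr>regs = (\<lambda>_. 0)(''servers'' := s), arrs = (\<lambda>_ _. 0)\<rparr>"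

definition arrival :: "nat list \<Rightarrow> state \<Rightarrow> state" where
  "arrival N \<sigma> =
     \<sigma>\<lparr>regs := (regs \<sigma>)(''degree'' := length N),
       arrs := (arrs \<sigma>)(''neighbours'' :=
         (\<lambda>k. if k < length N then N ! k else arrs \<sigma> ''neighbours'' k))\<rparr>"

text \<open>
  \<open>\<sigma> i\<close> is the memory after the first \<open>i\<close> insertions and \<open>\<tau> i\<close> is the time spent on inserting
  client \<open>i\<close>.
\<close>

definition online_run ::
  "nat \<Rightarrow> com \<Rightarrow> nat \<Rightarrow> nat list list \<Rightarrow> (nat \<Rightarrow> state) \<Rightarrow> (nat \<Rightarrow> nat) \<Rightarrow> bool" where
  "online_run w P s Ns \<sigma> \<tau> \<longleftrightarrow>
     \<sigma> 0 = initial_state s \<and>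
     (\<forall>i < length Ns. exec w P (arrival (Ns ! i) (\<sigma> i)) (\<tau> i) (\<sigma> (Suc i)))"

text \<open>
  The current matching is kept explicitly in an array: the entry of a client is \<open>0\<close> if the client is
  unmatched, and \<open>Suc v\<close> if it is matched to server \<open>v\<close>.
\<close>

definition matching_of :: "nat \<Rightarrow> state \<Rightarrow> vertex set set" where
  "matching_of i \<sigma> = {{Client c, Server v} | c v. c < i \<and> arrs \<sigma> ''match'' c = Suc v}"

definition follows_sap :: "nat list list \<Rightarrow> (nat \<Rightarrow> state) \<Rightarrow> bool" where
  "follows_sap Ns \<sigma> \<longleftrightarrow>
     (\<forall>i < length Ns.
        sap_step (graph_of (take (Suc i) Ns))
          (matching_of i (\<sigma> i)) i (matching_of (Suc i) (\<sigma> (Suc i))))"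

end

theory Submission
  imports Defs
begin

text \<open>
  The distance of a client is the number of matched clients on a shortest alternating walk to a free
  server. Augmenting along shortest paths never decreases a distance, so the program keeps a lower
  bound for it, the label of the client. A depth-first search from the new client only enters clients
  with smaller label; a client whose neighbours are exhausted has its label increased. A path found in
  this way has strictly decreasing labels and is therefore shortest. With a current arc for every
  client, each label value costs at most one scan of the adjacency list, so that the searches cost
  \<open>O(m K)\<close> in total if labels are raised only up to \<open>K\<close>. When the label of the new client exceeds the
  number \<open>B\<close> of successful breadth-first searches made so far, a breadth-first search is made instead.
  If it fails, the clients it reached never reach a free server again and are given the label \<open>s\<close>
  (distances are below \<open>s\<close>); if it succeeds, \<open>B\<close> is increased. The total time is \<open>O(m (B + 1))\<close>.

  It remains to bound \<open>B\<close>. For a set \<open>T\<close> of matched clients let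
  \<open>g T = card (N(T)) - (1 + \<epsilon>) * card T\<close>. If the new client has distance at least \<open>h\<close> and
  \<open>(1 + \<epsilon>) ^ h \<ge> n\<close>, then adding to \<open>T\<close> one of the first \<open>h\<close> layers of the breadth-first search
  decreases \<open>g\<close> by at least one: otherwise the parts of the layers outside \<open>T\<close> grow by a factor
  \<open>1 + \<epsilon>\<close> each time and exceed \<open>n\<close>. Since matched clients satisfy Hall's condition, \<open>g T \<ge> - \<epsilon> n\<close>, so
  at most \<open>\<epsilon> n\<close> paths have distance at least \<open>h\<close>. As the last \<open>B / 2\<close> breadth-first searches found
  paths of distance at least \<open>B / 2\<close>, choosing \<open>\<epsilon>\<close> proportional to \<open>ln n / B\<close> gives
  \<open>B = O(sqrt (n ln n))\<close>.
\<close>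

subsection \<open>Alternating walks and shortest augmentations\<close>

text \<open>The number of clients is unknown while the program runs, so a threshold of order
  \<open>sqrt (n ln n)\<close> between the two searches cannot be built into it. The counter
  \<open>B\<close> is a threshold that adjusts itself: it grows only when a whole breadth-first
  search has produced a path of distance above \<open>B\<close>, which keeps the total costs of both
  searches of the same order. The same ignorance shapes the analysis. The potential is cut off at a
  number \<open>K\<close> above the final \<open>B\<close>, so the amortized bounds are proved for
  all such \<open>K\<close> at once, and determinism ensures that they concern one run. Likewise
  \<open>h\<close> and \<epsilon> are quantified inside the counting invariant, since they are
  chosen from the final \<open>B\<close>. The counting survives the constant change of the matching
  because \<open>g\<close> depends only on the graph, and the admissible sets \<open>T\<close> only
  on which clients are matched; matched clients stay matched. A path from a breadth-first search has
  no reason to have decreasing labels. Raising the labels on every flipped path to the exact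
  distances lets both searches share one invariant for the current arcs.\<close>

text \<open>
  \<open>A u\<close> lists the neighbours of client \<open>u\<close>. The arrays \<open>ma\<close> and \<open>me\<close> store the partners of clients and
  of servers increased by one, and \<open>0\<close> for an unmatched vertex.
\<close>

primrec free_walk :: "(nat \<Rightarrow> nat list) \<Rightarrow> (nat \<Rightarrow> nat) \<Rightarrow> nat \<Rightarrow> nat \<Rightarrow> bool" where
  "free_walk A me 0 u \<longleftrightarrow> (\<exists>v \<in> set (A u). me v = 0)"
| "free_walk A me (Suc k) u \<longleftrightarrow> (\<exists>v \<in> set (A u). \<exists>x. me v = Suc x \<and> free_walk A me k x)"

definition matching_arrays ::
  "(nat \<Rightarrow> nat list) \<Rightarrow> nat \<Rightarrow> (nat \<Rightarrow> nat) \<Rightarrow> (nat \<Rightarrow> nat) \<Rightarrow> bool" where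
  "matching_arrays A N ma me \<longleftrightarrow>
     (\<forall>u v. ma u = Suc v \<longleftrightarrow> me v = Suc u) \<and> (\<forall>u v. ma u = Suc v \<longrightarrow> u < N \<and> v \<in> set (A u))"

lemma matching_arrays_mate:
  assumes "matching_arrays A N ma me" and "me v = Suc u"
  shows "ma u = Suc v" and "u < N" and "v \<in> set (A u)"
  using assms unfolding matching_arrays_def by blast+

lemma matching_arrays_match:
  assumes "matching_arrays A N ma me" and "ma u = Suc v"
  shows "me v = Suc u" and "u < N" and "v \<in> set (A u)"
  using assms unfolding matching_arrays_def by blast+

text \<open>Tails of a minimal walk are minimal, so it passes one server of every level from
  \<open>0\<close> to its length. The level of a server is \<open>0\<close> if it is free and
  \<open>Suc l\<close> if its partner has distance exactly \<open>l\<close>. Levels exclude each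
  other, which turns the number of servers into a bound on the length.\<close>

lemma free_walk_minimal_levels:
  assumes "matching_arrays A N ma me" and "\<And>u. u < N \<Longrightarrow> set (A u) \<subseteq> {..<s}"
    and "x < N" and "free_walk A me j x" and "\<forall>i<j. \<not> free_walk A me i x"
    and "i \<le> j"
  shows "\<exists>v<s. (case i of 0 \<Rightarrow> me v = 0
    | Suc l \<Rightarrow> \<exists>y. me v = Suc y \<and> free_walk A me l y \<and> (\<forall>i<l. \<not> free_walk A me i y))"
  using assms(3-6)
proof (induction j arbitrary: x i)
  case 0
  then show ?case using assms(2)[OF 0(1)] by auto
next
  case (Suc j)
  then obtain v y where v: "v \<in> set (A x)" "me v = Suc y" "free_walk A me j y" by auto
  have y: "y < N" using assms(1) v(2) unfolding matching_arrays_def by blast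
  have min: "\<forall>i<j. \<not> free_walk A me i y"
  proof (intro allI impI notI)
    fix i assume "i < j" "free_walk A me i y"
    then have "free_walk A me (Suc i) x" using v by auto
    with Suc.prems(3) \<open>i < j\<close> show False by (metis Suc_less_eq)
  qed
  show ?case
  proof (cases "i \<le> j")
    case True
    then show ?thesis using Suc.IH[OF y v(3) min] by blast
  next
    case False
    then have "i = Suc j" using Suc.prems by simp
    then show ?thesis using v min assms(2)[OF Suc.prems(1)] by auto
  qed
qed

text \<open>This gives the label \<open>s\<close> the meaning "unreachable": a distance of at least
  \<open>s\<close> excludes every walk.\<close>

lemma free_walk_short:
  assumes m: "matching_arrays A N ma me" and s: "\<And>u. u < N \<Longrightarrow> set (A u) \<subseteq> {..<s}"
    and x: "x < N" and fw: "free_walk A me k x"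
  shows "\<exists>j<s. free_walk A me j x"
proof -
  define j where "j = (LEAST j. free_walk A me j x)"
  have j: "free_walk A me j x" unfolding j_def using fw by (rule LeastI)
  have min: "\<forall>i<j. \<not> free_walk A me i x" unfolding j_def using not_less_Least by blast
  define lev where "lev i v \<longleftrightarrow> (case i of 0 \<Rightarrow> me v = 0
    | Suc l \<Rightarrow> \<exists>y. me v = Suc y \<and> free_walk A me l y \<and> (\<forall>i<l. \<not> free_walk A me i y))" for i v
  have "\<forall>i\<in>{..j}. \<exists>v. v < s \<and> lev i v"
    using free_walk_minimal_levels[OF m s x j min] unfolding lev_def by auto
  then obtain f where f: "\<And>i. i \<le> j \<Longrightarrow> f i < s \<and> lev i (f i)" by (metis atMost_iff)
  have uniq: "i = i'" if "lev i v" "lev i' v" for i i' v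
    using that unfolding lev_def by (auto split: nat.splits) (metis linorder_neqE_nat)
  have "inj_on f {..j}" by (rule inj_onI) (metis f uniq atMost_iff)
  then have "card {..j} \<le> card {..<s}" by (rule card_inj_on_le) (use f in auto)
  then show ?thesis using j by (intro exI[of _ j]) auto
qed

section \<open>Parent pointers and shortest augmenting paths\<close>

primrec par_chain ::
  "(nat \<Rightarrow> nat list) \<Rightarrow> (nat \<Rightarrow> nat) \<Rightarrow> (nat \<Rightarrow> nat) \<Rightarrow> nat \<Rightarrow> nat \<Rightarrow> nat \<Rightarrow> bool" where
  "par_chain A ma par c 0 u \<longleftrightarrow> u = c"
| "par_chain A ma par c (Suc k) u \<longleftrightarrow>
     (\<exists>v \<in> set (A (par u)). ma u = Suc v) \<and> par_chain A ma par c k (par u)"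

lemma par_chain_funpow:
  assumes "par_chain A ma par c k u"
  shows "(par ^^ k) u = c"
    and "j < k \<Longrightarrow> \<exists>v \<in> set (A ((par ^^ Suc j) u)). ma ((par ^^ j) u) = Suc v"
proof -
  show "(par ^^ k) u = c" using assms
    by (induction k arbitrary: u) (auto simp: funpow_swap1)
  show "j < k \<Longrightarrow> \<exists>v \<in> set (A ((par ^^ Suc j) u)). ma ((par ^^ j) u) = Suc v" using assms
  proof (induction k arbitrary: u j)
    case (Suc k)
    show ?case
    proof (cases j)
      case 0
      then show ?thesis using Suc.prems by simp
    next
      case (Suc i)
      then have "i < k" using Suc.prems by simp
      from Suc.IH[OF this, of "par u"] Suc.prems show ?thesis
        by (simp add: Suc funpow_swap1)
    qed
  qed simp
qed

text \<open>The path is indexed from its free server \<open>pv 0\<close> backwards to the new client \<open>pu k\<close>, so that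
  \<open>j\<close> is the distance of \<open>pu j\<close>.\<close>

definition shortest_aug ::
  "(nat \<Rightarrow> nat list) \<Rightarrow> (nat \<Rightarrow> nat) \<Rightarrow> (nat \<Rightarrow> nat) \<Rightarrow> nat \<Rightarrow> nat \<Rightarrow> (nat \<Rightarrow> nat) \<Rightarrow> (nat \<Rightarrow> nat) \<Rightarrow> bool" where
  "shortest_aug A ma me c k pu pv \<longleftrightarrow>
     pu k = c \<and> ma c = 0 \<and> me (pv 0) = 0 \<and>
     (\<forall>j\<le>k. pv j \<in> set (A (pu j))) \<and> (\<forall>j<k. ma (pu j) = Suc (pv (Suc j))) \<and>
     (\<forall>j. free_walk A me j c \<longrightarrow> k \<le> j)"

lemma par_chain_shortest_aug:
  assumes "par_chain A ma par c k u" and "ma c = 0" and "v \<in> set (A u)" and "me v = 0"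
    and "\<forall>j. free_walk A me j c \<longrightarrow> k \<le> j"
  shows "shortest_aug A ma me c k (\<lambda>j. (par ^^ j) u)
    (\<lambda>j. case j of 0 \<Rightarrow> v | Suc i \<Rightarrow> ma ((par ^^ i) u) - 1)"
proof -
  define pv where "pv j = (case j of 0 \<Rightarrow> v | Suc i \<Rightarrow> ma ((par ^^ i) u) - 1)" for j
  have match: "ma ((par ^^ j) u) = Suc (pv (Suc j)) \<and> pv (Suc j) \<in> set (A ((par ^^ Suc j) u))"
    if "j < k" for j
    using par_chain_funpow(2)[OF assms(1) that] by (auto simp: pv_def)
  have "pv j \<in> set (A ((par ^^ j) u))" if "j \<le> k" for j
  proof (cases j)
    case 0
    then show ?thesis using assms(3) by (simp add: pv_def)
  next
    case (Suc i)
    then show ?thesis using match[of i] that by simp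
  qed
  moreover have "pv 0 = v" by (simp add: pv_def)
  ultimately have "shortest_aug A ma me c k (\<lambda>j. (par ^^ j) u) pv"
    using assms match par_chain_funpow(1)[OF assms(1)] unfolding shortest_aug_def by blast
  then show ?thesis unfolding pv_def .
qed

context
  fixes A N ma me c k pu pv
  assumes m: "matching_arrays A N ma me" and aug: "shortest_aug A ma me c k pu pv"
begin

lemma shortest_aug_mate: "j < k \<Longrightarrow> me (pv (Suc j)) = Suc (pu j)"
  using m aug unfolding matching_arrays_def shortest_aug_def by blast

text \<open>The segment from \<open>c\<close> to \<open>pu j\<close> can be continued by any walk
  from \<open>pu j\<close>. Minimality of \<open>k\<close> thus makes \<open>j\<close> the exact
  distance of \<open>pu j\<close>, and distinctness of the clients on the path follows from their
  distances.\<close>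

lemma shortest_aug_extend: "j + d = k \<Longrightarrow> free_walk A me i (pu j) \<Longrightarrow> free_walk A me (d + i) c"
proof (induction d arbitrary: i j)
  case 0
  then show ?case using aug by (simp add: shortest_aug_def)
next
  case (Suc d)
  then have "j < k" by simp
  then have "pv (Suc j) \<in> set (A (pu (Suc j)))" using aug by (simp add: shortest_aug_def)
  then have "free_walk A me (Suc i) (pu (Suc j))"
    using shortest_aug_mate[OF \<open>j < k\<close>] Suc.prems(2) by auto
  from Suc.IH[OF _ this] Suc.prems(1) show ?case by simp
qed

lemma shortest_aug_dist: "j \<le> k \<Longrightarrow> free_walk A me i (pu j) \<Longrightarrow> j \<le> i"
  using shortest_aug_extend[of j "k - j" i] aug unfolding shortest_aug_def by fastforce

lemma shortest_aug_walk: "j \<le> k \<Longrightarrow> free_walk A me j (pu j)"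
proof (induction j)
  case 0
  then show ?case using aug by (auto simp: shortest_aug_def)
next
  case (Suc j)
  then show ?case using shortest_aug_mate[of j] aug unfolding shortest_aug_def
    by (auto intro!: bexI[of _ "pv (Suc j)"])
qed

lemma shortest_aug_inj: "i \<le> k \<Longrightarrow> j \<le> k \<Longrightarrow> pu i = pu j \<longleftrightarrow> i = j"
  using shortest_aug_dist shortest_aug_walk by (metis le_antisym)

text \<open>\<open>pv 0\<close> is free and \<open>pv (Suc i)\<close> has partner
  \<open>pu i\<close>, so the distinct clients separate the servers.\<close>

lemma shortest_aug_inj_server: "i \<le> k \<Longrightarrow> j \<le> k \<Longrightarrow> pv i = pv j \<longleftrightarrow> i = j"
proof (induction i arbitrary: j)
  case 0
  then show ?case using shortest_aug_mate aug unfolding shortest_aug_def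
    by (cases j) (auto dest: Suc_le_lessD)
next
  case (Suc i)
  show ?case
  proof (cases j)
    case 0
    then show ?thesis using Suc.prems shortest_aug_mate[of i] aug unfolding shortest_aug_def by auto
  next
    case (Suc j')
    then show ?thesis using Suc.prems \<open>Suc i \<le> k\<close> shortest_aug_mate[of i] shortest_aug_mate[of j']
        shortest_aug_inj[of i j'] by auto
  qed
qed

lemma shortest_aug_client: "c < N \<Longrightarrow> j \<le> k \<Longrightarrow> pu j < N"
  using m aug unfolding matching_arrays_def shortest_aug_def by (metis le_neq_implies_less)

end

text \<open>The state after \<open>i\<close> rounds of flipping, counted from the free server. The
  label of \<open>pu j\<close> becomes its distance before the flip, and a changed label restarts
  the current arc.\<close>

definition flipped ::
  "(nat \<Rightarrow> nat) \<Rightarrow> (nat \<Rightarrow> nat) \<Rightarrow> nat \<Rightarrow> (nat \<Rightarrow> nat) \<Rightarrow> (nat \<Rightarrow> nat) \<Rightarrow> (nat \<Rightarrow> nat) \<Rightarrow> (nat \<Rightarrow> nat) \<Rightarrow>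
    (nat \<Rightarrow> nat) \<Rightarrow> (nat \<Rightarrow> nat) \<Rightarrow> (nat \<Rightarrow> nat) \<Rightarrow> (nat \<Rightarrow> nat) \<Rightarrow> bool" where
  "flipped pu pv i ma me lab cur ma' me' lab' cur' \<longleftrightarrow>
     (\<forall>j<i. ma' (pu j) = Suc (pv j) \<and> me' (pv j) = Suc (pu j) \<and> lab' (pu j) = j) \<and>
     (\<forall>u. (\<forall>j<i. u \<noteq> pu j) \<longrightarrow> ma' u = ma u \<and> lab' u = lab u) \<and>
     (\<forall>v. (\<forall>j<i. v \<noteq> pv j) \<longrightarrow> me' v = me v) \<and>
     (\<forall>u. cur' u = (if lab' u = lab u then cur u else 0))"

lemma flipped_0: "flipped pu pv 0 ma me lab cur ma me lab cur"
  by (simp add: flipped_def)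

lemma flipped_Suc:
  assumes "flipped pu pv i ma me lab cur ma' me' lab' cur'"
    and "\<And>j. j < i \<Longrightarrow> pu j \<noteq> pu i" and "\<And>j. j < i \<Longrightarrow> pv j \<noteq> pv i" and "lab (pu i) \<le> i"
  shows "flipped pu pv (Suc i) ma me lab cur (ma'(pu i := Suc (pv i))) (me'(pv i := Suc (pu i)))
    (if lab' (pu i) < i then lab'(pu i := i) else lab')
    (if lab' (pu i) < i then cur'(pu i := 0) else cur')"
proof -
  have *: "lab' (pu i) = lab (pu i)" using assms(1,2) unfolding flipped_def by metis
  show ?thesis
    using assms * unfolding flipped_def by (auto simp: less_Suc_eq)
qed

text \<open>A client without a walk may carry any label, so labels are only lower bounds. The arc
  position \<open>cur u\<close> certifies that no skipped neighbour is free or matched to a client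
  of smaller label; raising labels of other clients preserves this, and only a relabelling of
  \<open>u\<close> itself endangers it. Clients yet to arrive have label \<open>0\<close>, the
  initial content of the memory.\<close>

definition sap_inv ::
  "(nat \<Rightarrow> nat list) \<Rightarrow> nat \<Rightarrow> (nat \<Rightarrow> nat) \<Rightarrow> (nat \<Rightarrow> nat) \<Rightarrow> (nat \<Rightarrow> nat) \<Rightarrow> (nat \<Rightarrow> nat) \<Rightarrow> bool" where
  "sap_inv A N ma me lab cur \<longleftrightarrow>
     matching_arrays A N ma me \<and> (\<forall>u\<ge>N. lab u = 0 \<and> cur u = 0) \<and>
     (\<forall>u j. free_walk A me j u \<longrightarrow> lab u \<le> j) \<and>
     (\<forall>u. cur u \<le> length (A u) \<and> (\<forall>p<cur u. \<exists>x. me (A u ! p) = Suc x \<and> lab u \<le> lab x))"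

lemma sap_inv_Suc: "sap_inv A N ma me lab cur \<Longrightarrow> sap_inv A (Suc N) ma me lab cur"
  unfolding sap_inv_def matching_arrays_def by (auto intro: less_SucI)

lemma flipped_matching_arrays:
  assumes m: "matching_arrays A N ma me" and aug: "shortest_aug A ma me c k pu pv" and c: "c < N"
    and fl: "flipped pu pv (Suc k) ma me lab cur ma' me' lab' cur'"
  shows "matching_arrays A N ma' me'"
proof -
  have on: "ma' (pu j) = Suc (pv j)" "me' (pv j) = Suc (pu j)" if "j \<le> k" for j
    using fl that unfolding flipped_def by auto
  have offu: "ma' u = ma u" if "\<And>j. j \<le> k \<Longrightarrow> u \<noteq> pu j" for u
    using fl that unfolding flipped_def less_Suc_eq_le by blast
  have offv: "me' v = me v" if "\<And>j. j \<le> k \<Longrightarrow> v \<noteq> pv j" for v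
    using fl that unfolding flipped_def less_Suc_eq_le by blast
  have mm: "ma u = Suc v \<longleftrightarrow> me v = Suc u" for u v using m unfolding matching_arrays_def by blast
  have mate: "j < k \<Longrightarrow> me (pv (Suc j)) = Suc (pu j)" for j by (rule shortest_aug_mate[OF m aug])
  have match: "j < k \<Longrightarrow> ma (pu j) = Suc (pv (Suc j))" for j
    using aug unfolding shortest_aug_def by blast
  have "ma' u = Suc v \<longleftrightarrow> me' v = Suc u" for u v
  proof
    assume a: "ma' u = Suc v"
    show "me' v = Suc u"
    proof (cases "\<exists>j\<le>k. u = pu j")
      case True
      then show ?thesis using a on by auto
    next
      case False
      then have mv: "me v = Suc u" using a offu mm by metis
      have "v \<noteq> pv j" if "j \<le> k" for j
        using that mv False mate aug unfolding shortest_aug_def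
        by (cases j) (auto dest: Suc_le_lessD Suc_leD)
      then show ?thesis using mv offv by metis
    qed
  next
    assume a: "me' v = Suc u"
    show "ma' u = Suc v"
    proof (cases "\<exists>j\<le>k. v = pv j")
      case True
      then show ?thesis using a on by auto
    next
      case False
      then have mv: "ma u = Suc v" using a offv mm by metis
      have "u \<noteq> pu j" if "j \<le> k" for j
        using that mv False match aug unfolding shortest_aug_def
        by (metis le_neq_implies_less Suc_inject Suc_leI nat.distinct(1))
      then show ?thesis using mv offu by metis
    qed
  qed
  moreover have "u < N \<and> v \<in> set (A u)" if "ma' u = Suc v" for u v
  proof (cases "\<exists>j\<le>k. u = pu j")
    case True
    then show ?thesis using that on shortest_aug_client[OF m aug c] aug
      unfolding shortest_aug_def by auto
  next
    case False
    then show ?thesis using that offu m unfolding matching_arrays_def by metis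
  qed
  ultimately show ?thesis unfolding matching_arrays_def by blast
qed

text \<open>A new walk differs from an old one where it uses a server \<open>pv l\<close> whose
  partner has become \<open>pu l\<close>. The rest of the new walk then has length at least
  \<open>l\<close>, whereas before the flip the same server was free or led to
  \<open>pu (l - 1)\<close>, only \<open>l - 1\<close> steps away from a free server.\<close>

lemma flipped_free_walk:
  assumes m: "matching_arrays A N ma me" and aug: "shortest_aug A ma me c k pu pv"
    and fl: "flipped pu pv (Suc k) ma me lab cur ma' me' lab' cur'"
  shows "free_walk A me' j u \<Longrightarrow> \<exists>i\<le>j. free_walk A me i u"
proof (induction j arbitrary: u)
  case 0
  have "me v = 0" if "me' v = 0" for v
    using that fl unfolding flipped_def by (metis nat.distinct(1))
  then show ?case using 0 by auto
next
  case (Suc j)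
  then obtain v x where v: "v \<in> set (A u)" "me' v = Suc x" "free_walk A me' j x" by auto
  from Suc.IH[OF v(3)] obtain i where i: "i \<le> j" "free_walk A me i x" by blast
  show ?case
  proof (cases "\<exists>l\<le>k. v = pv l")
    case False
    then have "me v = Suc x" using v(2) fl unfolding flipped_def less_Suc_eq_le by metis
    then have "free_walk A me (Suc i) u" using v(1) i(2) by auto
    then show ?thesis using i(1) by (metis Suc_le_mono)
  next
    case True
    then obtain l where l: "l \<le> k" "v = pv l" by blast
    then have x: "x = pu l" using v(2) fl unfolding flipped_def less_Suc_eq_le by auto
    have li: "l \<le> i" using shortest_aug_dist[OF m aug l(1)] i(2) x by blast
    show ?thesis
    proof (cases l)
      case 0
      then have "free_walk A me 0 u" using l v(1) aug unfolding shortest_aug_def by auto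
      then show ?thesis by blast
    next
      case (Suc l')
      then have "me v = Suc (pu l')" "free_walk A me l' (pu l')"
        using l shortest_aug_mate[OF m aug, of l'] shortest_aug_walk[OF m aug, of l'] by auto
      then have "free_walk A me (Suc l') u" using v(1) by auto
      then show ?thesis using Suc li i(1) by (intro exI[of _ "Suc l'"]) auto
    qed
  qed
qed

lemma flipped_lab_mono:
  assumes inv: "sap_inv A N ma me lab cur" and aug: "shortest_aug A ma me c k pu pv"
    and fl: "flipped pu pv (Suc k) ma me lab cur ma' me' lab' cur'"
  shows "lab u \<le> lab' u"
proof (cases "\<exists>j\<le>k. u = pu j")
  case True
  then obtain j where j: "j \<le> k" "u = pu j" by blast
  have "lab u \<le> j" using shortest_aug_walk[OF _ aug j(1)] inv j(2) unfolding sap_inv_def by blast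
  then show ?thesis using fl j unfolding flipped_def less_Suc_eq_le by auto
next
  case False
  then show ?thesis using fl unfolding flipped_def less_Suc_eq_le by auto
qed

text \<open>The delicate part is the current arc. If a skipped server \<open>pv (Suc l)\<close>
  changes its partner from \<open>pu l\<close> to \<open>pu (Suc l)\<close>, the new partner has
  label \<open>Suc l\<close> and the old one \<open>l\<close>, so the arc remains useless. Setting
  the labels to the exact distances secures this even if the labels did not decrease along the path.
  The server \<open>pv 0\<close> was free and hence not skipped.\<close>

lemma flipped_sap_inv:
  assumes inv: "sap_inv A N ma me lab cur" and aug: "shortest_aug A ma me c k pu pv" and c: "c < N"
    and fl: "flipped pu pv (Suc k) ma me lab cur ma' me' lab' cur'"
  shows "sap_inv A N ma' me' lab' cur'"
proof -
  have m: "matching_arrays A N ma me" using inv unfolding sap_inv_def by blast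
  have m': "matching_arrays A N ma' me'" by (rule flipped_matching_arrays[OF m aug c fl])
  have cur: "cur' u = (if lab' u = lab u then cur u else 0)" for u
    using fl unfolding flipped_def by blast
  have "lab' u = 0 \<and> cur' u = 0" if "u \<ge> N" for u
  proof -
    have "\<And>j. j \<le> k \<Longrightarrow> u \<noteq> pu j" using shortest_aug_client[OF m aug c] that by fastforce
    then have "lab' u = lab u" using fl unfolding flipped_def less_Suc_eq_le by auto
    then show ?thesis using inv cur that unfolding sap_inv_def by auto
  qed
  moreover have "lab' u \<le> j" if w: "free_walk A me' j u" for u j
  proof -
    obtain i where i: "i \<le> j" "free_walk A me i u" using flipped_free_walk[OF m aug fl w] by blast
    show ?thesis
    proof (cases "\<exists>l\<le>k. u = pu l")
      case True
      then obtain l where l: "l \<le> k" "u = pu l" by blast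
      then have "lab' u = l" using fl unfolding flipped_def less_Suc_eq_le by auto
      then show ?thesis using shortest_aug_dist[OF m aug l(1)] i l(2) by fastforce
    next
      case False
      then have "lab' u = lab u" using fl unfolding flipped_def less_Suc_eq_le by auto
      then show ?thesis using inv i unfolding sap_inv_def by fastforce
    qed
  qed
  moreover have "cur' u \<le> length (A u)" for u using inv cur unfolding sap_inv_def by auto
  moreover have "\<exists>x. me' (A u ! p) = Suc x \<and> lab' u \<le> lab' x" if p: "p < cur' u" for u p
  proof -
    have eq: "lab' u = lab u" "p < cur u" using p cur by (auto split: if_splits)
    obtain x where x: "me (A u ! p) = Suc x" "lab u \<le> lab x"
      using inv eq(2) unfolding sap_inv_def by blast
    show ?thesis
    proof (cases "\<exists>l\<le>k. A u ! p = pv l")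
      case False
      then have "me' (A u ! p) = Suc x" using x fl unfolding flipped_def less_Suc_eq_le by auto
      then show ?thesis using x(2) eq flipped_lab_mono[OF inv aug fl, of x] by auto
    next
      case True
      then obtain l where l: "l \<le> k" "A u ! p = pv l" by blast
      with x aug have "l \<noteq> 0" unfolding shortest_aug_def by (metis nat.distinct(1))
      then obtain l' where l': "l = Suc l'" by (cases l) auto
      then have "x = pu l'" using x(1) shortest_aug_mate[OF m aug, of l'] l by auto
      then have "lab' x = l'" using fl l l' unfolding flipped_def less_Suc_eq_le by auto
      moreover have "me' (A u ! p) = Suc (pu l)" "lab' (pu l) = l"
        using fl l unfolding flipped_def less_Suc_eq_le by auto
      ultimately show ?thesis using x(2) eq flipped_lab_mono[OF inv aug fl, of x] l' by auto
    qed
  qed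
  ultimately show ?thesis using m' unfolding sap_inv_def by blast
qed

subsection \<open>Counting long augmenting paths\<close>

definition neighbourhood :: "(nat \<Rightarrow> nat list) \<Rightarrow> nat set \<Rightarrow> nat set" where
  "neighbourhood A X = (\<Union>u\<in>X. set (A u))"

lemma finite_neighbourhood: "finite X \<Longrightarrow> finite (neighbourhood A X)"
  by (simp add: neighbourhood_def)

text \<open>The layers are cumulative: all clients at most \<open>i\<close> alternating steps from
  \<open>c\<close>, with \<open>c\<close> itself. The partners of all neighbours of a layer
  therefore lie in the next one.\<close>

primrec layers :: "(nat \<Rightarrow> nat list) \<Rightarrow> (nat \<Rightarrow> nat) \<Rightarrow> nat \<Rightarrow> nat \<Rightarrow> nat set" where
  "layers A me c 0 = {c}"
| "layers A me c (Suc i) =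
     layers A me c i \<union> {x. \<exists>v\<in>neighbourhood A (layers A me c i). me v = Suc x}"

lemma layers_free_walk:
  "u \<in> layers A me c i \<Longrightarrow> free_walk A me j u \<Longrightarrow> \<exists>l\<le>i + j. free_walk A me l c"
proof (induction i arbitrary: u j)
  case (Suc i)
  show ?case
  proof (cases "u \<in> layers A me c i")
    case True
    from Suc.IH[OF this Suc.prems(2)] show ?thesis by (metis add_Suc le_SucI)
  next
    case False
    then obtain v y where v: "y \<in> layers A me c i" "v \<in> set (A y)" "me v = Suc u"
      using Suc.prems(1) by (auto simp: neighbourhood_def)
    then have "free_walk A me (Suc j) y" using Suc.prems(2) by auto
    from Suc.IH[OF v(1) this] show ?thesis by simp
  qed
qed auto

lemma layers_clients:
  assumes "matching_arrays A N ma me"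
  shows "layers A me c i \<subseteq> insert c {u. ma u \<noteq> 0}"
proof (induction i)
  case (Suc i)
  have "ma x \<noteq> 0" if "me v = Suc x" for v x using matching_arrays_mate(1)[OF assms that] by simp
  then show ?case using Suc by auto
qed simp

lemma centre_in_layers: "c \<in> layers A me c i"
  by (induction i) auto

lemma matched_subset: "matching_arrays A N ma me \<Longrightarrow> {u. ma u \<noteq> 0} \<subseteq> {..<N}"
proof
  fix u assume "matching_arrays A N ma me" "u \<in> {u. ma u \<noteq> 0}"
  then show "u \<in> {..<N}" by (cases "ma u") (auto dest: matching_arrays_match)
qed

text \<open>Relative to \<open>T\<close> the layers grow by a factor \<open>1 + \<epsilon>\<close> until one of them pays for the decrease,
  and \<open>h\<close> layers cannot all grow.\<close>

lemma long_path_improves: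
  fixes \<epsilon> :: real
  assumes m: "matching_arrays A N ma me" and c: "ma c = 0" "c < N" and N: "N \<le> n"
    and far: "\<And>j. free_walk A me j c \<Longrightarrow> h \<le> j"
    and h: "h \<ge> 1" and eps: "\<epsilon> > 0" "(1 + \<epsilon>) ^ h \<ge> real n"
    and T: "T \<subseteq> {u. ma u \<noteq> 0}"
  shows "\<exists>T' \<subseteq> insert c {u. ma u \<noteq> 0}.
    real (card (neighbourhood A T')) - (1 + \<epsilon>) * real (card T') \<le>
    real (card (neighbourhood A T)) - (1 + \<epsilon>) * real (card T) - 1"
proof -
  let ?R = "layers A me c"
  let ?NB = "neighbourhood A"
  have finM: "finite (insert c {u. ma u \<noteq> 0})"
    using finite_subset[OF matched_subset[OF m]] by simp
  have finR: "finite (?R i)" for i by (rule finite_subset[OF layers_clients[OF m] finM])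
  have finT: "finite T" using T finM by (auto intro: finite_subset)
  define k where "k i = card (?R i - T)" for i
  define q where "q i = card (?NB (?R i) - ?NB T)" for i
  have cT: "c \<notin> T" using T c by auto
  \<comment> \<open>Below \<open>h\<close> no free server is adjacent to a layer, so the servers of
    \<open>?NB (?R i)\<close> outside \<open>?NB T\<close> have distinct partners in the next layer.
    A partner in \<open>T\<close> would put its server into \<open>?NB T\<close>, and
    \<open>c\<close> is unmatched; \<open>c\<close> is thus the additional element.\<close>
  have step: "q i + 1 \<le> k (Suc i)" if i: "i < h" for i
  proof -
    have mt: "\<exists>x. me v = Suc x" if v: "v \<in> ?NB (?R i)" for v
    proof (rule ccontr)
      assume "\<nexists>x. me v = Suc x"
      then have "me v = 0" by (cases "me v") auto
      then obtain u where "u \<in> ?R i" "free_walk A me 0 u" using v by (auto simp: neighbourhood_def)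
      from layers_free_walk[OF this] obtain l where "l \<le> i" "free_walk A me l c" by auto
      then show False using far[of l] i by simp
    qed
    have mm: "ma x = Suc v" "v \<in> set (A x)" if "me v = Suc x" for x v
      using matching_arrays_mate[OF m that] by auto
    have "inj_on (\<lambda>v. me v - 1) (?NB (?R i) - ?NB T)"
    proof (rule inj_onI)
      fix v v' assume a: "v \<in> ?NB (?R i) - ?NB T" "v' \<in> ?NB (?R i) - ?NB T" "me v - 1 = me v' - 1"
      then obtain x x' where x: "me v = Suc x" "me v' = Suc x'" using mt by blast
      then have "me v = me v'" using a(3) by simp
      then show "v = v'" using mm(1)[OF x(1)] mm(1)[of v' x] x by simp
    qed
    moreover have "(\<lambda>v. me v - 1) ` (?NB (?R i) - ?NB T) \<subseteq> ?R (Suc i) - T - {c}"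
    proof
      fix x assume "x \<in> (\<lambda>v. me v - 1) ` (?NB (?R i) - ?NB T)"
      then obtain v where v: "v \<in> ?NB (?R i)" "v \<notin> ?NB T" "me v = Suc x" using mt by fastforce
      have "x \<notin> T" using v(2) mm(2)[OF v(3)] by (auto simp: neighbourhood_def)
      moreover have "x \<noteq> c" using mm(1)[OF v(3)] c by auto
      ultimately show "x \<in> ?R (Suc i) - T - {c}" using v by auto
    qed
    ultimately have "q i \<le> card (?R (Suc i) - T - {c})" unfolding q_def
      using finR[of "Suc i"] by (intro card_inj_on_le) (blast intro: finite_Diff)+
    also have "\<dots> = k (Suc i) - 1" unfolding k_def
      using finR[of "Suc i"] centre_in_layers[of c A me "Suc i"] cT by (subst card_Diff_singleton) auto
    finally have "q i \<le> k (Suc i) - 1" .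
    moreover have "k (Suc i) > 0" unfolding k_def card_gt_0_iff
      using finR[of "Suc i"] centre_in_layers[of c A me "Suc i"] cT by blast
    ultimately show ?thesis by linarith
  qed
  \<comment> \<open>If no layer pays, the negated inequality and \<open>step\<close> give
    \<open>k (Suc i) > (1 + \<epsilon>) * k i\<close>, starting from \<open>k 0 = 1\<close>, and
    after \<open>h\<close> layers there are more than \<open>n\<close> clients.\<close>
  have "\<exists>i<h. real (q i) \<le> (1 + \<epsilon>) * real (k i) - 1"
  proof (rule ccontr)
    assume "\<not> ?thesis"
    then have big: "\<And>i. i < h \<Longrightarrow> real (q i) > (1 + \<epsilon>) * real (k i) - 1" by force
    have "i < h \<longrightarrow> real (k (Suc i)) > (1 + \<epsilon>) ^ Suc i" for i
    proof (induction i)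
      case 0
      have "k 0 = 1" using cT by (simp add: k_def insert_Diff_if)
      then show ?case using step[of 0] big[of 0] by auto
    next
      case (Suc i)
      show ?case
      proof
        assume i: "Suc i < h"
        have "(1 + \<epsilon>) ^ Suc (Suc i) = (1 + \<epsilon>) * (1 + \<epsilon>) ^ Suc i" by simp
        also have "\<dots> < (1 + \<epsilon>) * real (k (Suc i))" using Suc i eps by (intro mult_strict_left_mono) auto
        also have "\<dots> < real (q (Suc i)) + 1" using big[OF i] by simp
        also have "\<dots> \<le> real (k (Suc (Suc i)))" using step[OF i] by simp
        finally show "(1 + \<epsilon>) ^ Suc (Suc i) < real (k (Suc (Suc i)))" .
      qed
    qed
    from this[of "h - 1"] h have "real (k h) > real n" using eps by simp
    moreover have "k h \<le> card {..<N}" unfolding k_def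
      using layers_clients[OF m, of c h] matched_subset[OF m] c by (intro card_mono) auto
    ultimately show False using N by simp
  qed
  then obtain i where i: "i < h" "real (q i) \<le> (1 + \<epsilon>) * real (k i) - 1" by blast
  \<comment> \<open>Both cardinalities split into the part of \<open>T\<close> and what the layer
    adds, so \<open>g\<close> changes by \<open>q i - (1 + \<epsilon>) * k i\<close>, which is at
    most \<open>-1\<close>.\<close>
  have "card (T \<union> ?R i) = card T + k i"
    using finT finR[of i] card_Un_disjoint[of T "?R i - T"] unfolding k_def by simp
  moreover have "card (?NB (T \<union> ?R i)) = card (?NB T) + q i"
  proof -
    have "?NB (T \<union> ?R i) = ?NB T \<union> (?NB (?R i) - ?NB T)" by (auto simp: neighbourhood_def)
    then show ?thesis unfolding q_def
      using finite_neighbourhood[OF finT] finite_neighbourhood[OF finR[of i]]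
        card_Un_disjoint[of "?NB T" "?NB (?R i) - ?NB T"] by simp
  qed
  ultimately show ?thesis
    using i(2) T layers_clients[OF m, of c i]
    by (intro exI[of _ "T \<union> ?R i"]) (auto simp: algebra_simps)
qed

text \<open>\<open>B\<close> counts the breadth-first searches that found a path; the \<open>b\<close>-th of them found one of distance at
  least \<open>b\<close>.\<close>

definition hall_inv :: "(nat \<Rightarrow> nat list) \<Rightarrow> nat \<Rightarrow> (nat \<Rightarrow> nat) \<Rightarrow> nat \<Rightarrow> bool" where
  "hall_inv A n ma B \<longleftrightarrow> (\<forall>h \<epsilon>. h \<ge> 1 \<longrightarrow> (\<epsilon> :: real) > 0 \<longrightarrow> (1 + \<epsilon>) ^ h \<ge> real n \<longrightarrow>
     (\<exists>T \<subseteq> {u. ma u \<noteq> 0}.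
        real (card (neighbourhood A T)) - (1 + \<epsilon>) * real (card T) \<le> real h - 1 - real B))"

lemma hall_inv_0: "hall_inv A n ma 0"
  unfolding hall_inv_def by (auto intro!: exI[of _ "{}"] simp: neighbourhood_def)

text \<open>The matching enters only as the range of \<open>T\<close>, so a witness stays valid when
  more clients are matched.\<close>

lemma hall_inv_mono: "hall_inv A n ma B \<Longrightarrow> {u. ma u \<noteq> 0} \<subseteq> {u. ma' u \<noteq> 0} \<Longrightarrow> hall_inv A n ma' B"
  unfolding hall_inv_def by (meson subset_trans)

text \<open>While \<open>Suc B < h\<close> the empty set meets the bound; the term
  \<open>h - 1\<close> of the invariant is the allowance for these searches. From
  \<open>Suc B = h\<close> on the distance is at least \<open>h\<close>, and each search lowers the
  value by one.\<close>

lemma hall_inv_Suc: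
  assumes "hall_inv A n ma B" and m: "matching_arrays A N ma me" and c: "ma c = 0" "c < N"
    and N: "N \<le> n" and far: "\<And>j. free_walk A me j c \<Longrightarrow> Suc B \<le> j"
    and ma': "insert c {u. ma u \<noteq> 0} \<subseteq> {u. ma' u \<noteq> 0}"
  shows "hall_inv A n ma' (Suc B)"
  unfolding hall_inv_def
proof (intro allI impI)
  fix h and \<epsilon> :: real assume h: "h \<ge> 1" and eps: "\<epsilon> > 0" "(1 + \<epsilon>) ^ h \<ge> real n"
  show "\<exists>T \<subseteq> {u. ma' u \<noteq> 0}.
    real (card (neighbourhood A T)) - (1 + \<epsilon>) * real (card T) \<le> real h - 1 - real (Suc B)"
  proof (cases "Suc B \<ge> h")
    case True
    then have far': "\<And>j. free_walk A me j c \<Longrightarrow> h \<le> j" using far le_trans by blast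
    obtain T where T: "T \<subseteq> {u. ma u \<noteq> 0}"
      "real (card (neighbourhood A T)) - (1 + \<epsilon>) * real (card T) \<le> real h - 1 - real B"
      using assms(1) h eps unfolding hall_inv_def by blast
    obtain T' where T': "T' \<subseteq> insert c {u. ma u \<noteq> 0}"
      "real (card (neighbourhood A T')) - (1 + \<epsilon>) * real (card T') \<le>
       real (card (neighbourhood A T)) - (1 + \<epsilon>) * real (card T) - 1"
      using long_path_improves[OF m c N far' h eps T(1)] by blast
    show ?thesis using T(2) T' ma' by (intro exI[of _ T']) auto
  next
    case False
    then show ?thesis by (intro exI[of _ "{}"]) (auto simp: neighbourhood_def)
  qed
qed

lemma hall_inv_bound:
  assumes inv: "hall_inv A n ma B" and m: "matching_arrays A n ma me" and n: "n \<ge> 2"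
  shows "real B \<le> 8 * sqrt (real n * ln (real n))"
proof (cases "B = 0")
  case True
  then show ?thesis using n by simp
next
  case False
  \<comment> \<open>With \<open>h \<ge> B / 2\<close> and
    \<open>ln (1 + \<epsilon>) \<ge> \<epsilon> / 2\<close> the factor 4 gives
    \<open>h * ln (1 + \<epsilon>) \<ge> ln n\<close>, just enough for
    \<open>(1 + \<epsilon>) ^ h \<ge> n\<close>. Rounding \<open>h\<close> up preserves the first
    inequality and makes \<open>h\<close> positive.\<close>
  define \<epsilon> where "\<epsilon> = 4 * ln (real n) / real B"
  define h where "h = (B + 1) div 2"
  have ln: "ln (real n) > 0" using n by simp
  have eps: "\<epsilon> > 0" using ln False by (simp add: \<epsilon>_def)
  \<comment> \<open>The estimate of the logarithm requires \<epsilon> \<le> 1/2. For larger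
    \<epsilon> there is nothing to count, as \<open>B < 8 * ln n\<close> outright; this case is the
    source of 64, and so of the factor 8 in the bound.\<close>
  have Bsq: "(real B)\<^sup>2 \<le> 64 * (real n * ln (real n))"
  proof (cases "\<epsilon> \<le> 1 / 2")
    case False
    then have "real B \<le> 8 * ln (real n)" using \<open>B \<noteq> 0\<close> by (simp add: \<epsilon>_def field_simps)
    then have "(real B)\<^sup>2 \<le> (8 * ln (real n))\<^sup>2" by (intro power_mono) auto
    also have "\<dots> = 64 * (ln (real n) * ln (real n))" by (simp add: power2_eq_square)
    also have "\<dots> \<le> 64 * (real n * ln (real n))"
      using ln ln_le_minus_one[of "real n"] n by (intro mult_left_mono mult_right_mono) auto
    finally show ?thesis .
  next
    case True
    have h: "h \<ge> 1" "real h \<ge> real B / 2" "real h \<le> real B / 2 + 1/2" using False by (auto simp: h_def)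
    have "\<epsilon> / 2 \<le> \<epsilon> - \<epsilon>\<^sup>2"
      using mult_left_mono[OF True, of \<epsilon>] eps by (simp add: power2_eq_square)
    also have "\<dots> \<le> ln (1 + \<epsilon>)" using eps True by (intro ln_one_plus_pos_lower_bound) auto
    finally have "\<epsilon> / 2 \<le> ln (1 + \<epsilon>)" .
    moreover have "ln (real n) = (real B / 2) * (\<epsilon> / 2)" using False by (simp add: \<epsilon>_def)
    ultimately have "ln (real n) \<le> real h * ln (1 + \<epsilon>)"
      using mult_mono[OF h(2), of "\<epsilon> / 2" "ln (1 + \<epsilon>)"] eps by simp
    also have "\<dots> = ln ((1 + \<epsilon>) ^ h)" using eps by (simp add: ln_realpow)
    finally have "real n \<le> (1 + \<epsilon>) ^ h" using n eps by (subst (asm) ln_le_cancel_iff) auto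
    then obtain T where T: "T \<subseteq> {u. ma u \<noteq> 0}"
      "real (card (neighbourhood A T)) - (1 + \<epsilon>) * real (card T) \<le> real h - 1 - real B"
      using inv h(1) eps unfolding hall_inv_def by blast
    have Tn: "T \<subseteq> {..<n}" using T(1) matched_subset[OF m] by blast
    then have finT: "finite T" "card T \<le> n" using finite_subset card_mono[OF _ Tn] by auto
    have mm: "ma x = Suc (ma x - 1)" "me (ma x - 1) = Suc x" "ma x - 1 \<in> set (A x)" if "x \<in> T" for x
    proof -
      obtain v where "ma x = Suc v" using T(1) \<open>x \<in> T\<close> by (cases "ma x") auto
      then show "ma x = Suc (ma x - 1)" "me (ma x - 1) = Suc x" "ma x - 1 \<in> set (A x)"
        using matching_arrays_match[OF m, of x v] by auto
    qed
    \<comment> \<open>The matching embeds \<open>T\<close> into its neighbourhood, so its value is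
      at least \<open>- \<epsilon> * card T\<close>. Against the upper bound
      \<open>h - 1 - B\<close> this yields \<open>B / 2 \<le> \<epsilon> * n\<close>.\<close>
    have "card T \<le> card (neighbourhood A T)"
    proof (rule card_inj_on_le)
      show "inj_on (\<lambda>x. ma x - 1) T" by (rule inj_onI) (metis mm(2) Suc_inject)
      show "(\<lambda>x. ma x - 1) ` T \<subseteq> neighbourhood A T" using mm(3) by (auto simp: neighbourhood_def)
    qed (rule finite_neighbourhood[OF finT(1)])
    then have "- \<epsilon> * real (card T) \<le> real h - 1 - real B" using T(2) by (simp add: algebra_simps)
    moreover have "\<epsilon> * real (card T) \<le> \<epsilon> * real n" using finT eps by simp
    ultimately have "real B / 2 \<le> \<epsilon> * real n" using h(3) by simp
    then have "real B * real B \<le> 8 * (real n * ln (real n))"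
      using False by (simp add: \<epsilon>_def field_simps)
    also have "\<dots> \<le> 64 * (real n * ln (real n))" using ln by simp
    finally show ?thesis by (simp add: power2_eq_square)
  qed
  have "real B = sqrt ((real B)\<^sup>2)" by simp
  also have "\<dots> \<le> sqrt (64 * (real n * ln (real n)))" using Bsq by (rule real_sqrt_le_mono)
  also have "\<dots> = 8 * sqrt (real n * ln (real n))" by (simp add: real_sqrt_mult)
  finally show ?thesis .
qed

subsection \<open>Correctness of an augmentation\<close>

definition edges_below :: "(nat \<Rightarrow> nat list) \<Rightarrow> nat \<Rightarrow> vertex set set" where
  "edges_below A N = {{Client u, Server v} | u v. u < N \<and> v \<in> set (A u)}"

definition matched_edges :: "nat \<Rightarrow> (nat \<Rightarrow> nat) \<Rightarrow> vertex set set" where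
  "matched_edges N ma = {{Client u, Server v} | u v. u < N \<and> ma u = Suc v}"

lemma edges_below_iff [simp]:
  "{Client u, Server v} \<in> edges_below A N \<longleftrightarrow> u < N \<and> v \<in> set (A u)"
  "{Server v, Client u} \<in> edges_below A N \<longleftrightarrow> u < N \<and> v \<in> set (A u)"
  by (auto simp: edges_below_def doubleton_eq_iff)

lemma matched_edges_iff [simp]:
  "{Client u, Server v} \<in> matched_edges N ma \<longleftrightarrow> u < N \<and> ma u = Suc v"
  "{Server v, Client u} \<in> matched_edges N ma \<longleftrightarrow> u < N \<and> ma u = Suc v"
  by (auto simp: matched_edges_def doubleton_eq_iff)

lemma edges_below_same_side [simp]:
  "{Client u, Client x} \<notin> edges_below A N" "{Server u, Server x} \<notin> matched_edges N ma"
  by (auto simp: edges_below_def matched_edges_def doubleton_eq_iff)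

lemma unmatched_server_iff:
  assumes "matching_arrays A N ma me"
  shows "unmatched (matched_edges N ma) (Server v) \<longleftrightarrow> me v = 0"
proof
  assume u: "unmatched (matched_edges N ma) (Server v)"
  show "me v = 0"
  proof (cases "me v")
    case (Suc x)
    then have "{Client x, Server v} \<in> matched_edges N ma"
      using matching_arrays_mate[OF assms Suc] by simp
    then show ?thesis using u unfolding unmatched_def by blast
  qed
next
  assume "me v = 0"
  then have "ma x \<noteq> Suc v" for x using matching_arrays_match(1)[OF assms, of x v] by auto
  then show "unmatched (matched_edges N ma) (Server v)"
    unfolding unmatched_def matched_edges_def by auto
qed

lemma unmatched_client_iff:
  "c < N \<Longrightarrow> unmatched (matched_edges N ma) (Client c) \<longleftrightarrow> ma c = 0"
  unfolding unmatched_def matched_edges_def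
  by (auto dest: not0_implies_Suc)

text \<open>Alternation alone does not fix the phase, hence the condition on the first edge.
  Removing a client and the server after it leaves a path of the same kind that starts at the
  partner of this server; each removed pair is one step of the walk, which gives the exact
  length.\<close>

lemma alternating_walk_free_walk:
  assumes m: "matching_arrays A N ma me"
  shows "(\<forall>k. Suc k < length p \<longrightarrow> {p ! k, p ! Suc k} \<in> edges_below A N) \<Longrightarrow>
    alternating (matched_edges N ma) p \<Longrightarrow>
    (2 \<le> length p \<longrightarrow> {p ! 0, p ! 1} \<notin> matched_edges N ma) \<Longrightarrow> p \<noteq> [] \<Longrightarrow>
    hd p = Client u \<Longrightarrow> last p = Server v \<Longrightarrow> me v = 0 \<Longrightarrow>
    \<exists>k. length p = 2 * k + 2 \<and> free_walk A me k u"
proof (induction p arbitrary: u rule: induct_list012)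
  case (3 x y r)
  have x: "x = Client u" using 3 by simp
  have "{x, y} \<in> edges_below A N" using 3(3)[rule_format, of 0] by simp
  then obtain v' where y: "y = Server v'" and v': "v' \<in> set (A u)" using x by (cases y) auto
  show ?case
  proof (cases r)
    case Nil
    then show ?thesis using 3 y v' by (intro exI[of _ 0]) auto
  next
    case (Cons z r')
    have "{y, z} \<in> matched_edges N ma"
      using 3(4)[unfolded alternating_def, rule_format, of 0] 3(5) Cons by simp
    then obtain w where z: "z = Client w" and w: "ma w = Suc v'" using y by (cases z) auto
    have e: "\<forall>k. Suc k < length r \<longrightarrow> {r ! k, r ! Suc k} \<in> edges_below A N"
    proof (intro allI impI)
      fix k assume "Suc k < length r"
      then show "{r ! k, r ! Suc k} \<in> edges_below A N" using 3(3)[rule_format, of "k + 2"] by simp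
    qed
    have a: "alternating (matched_edges N ma) r" unfolding alternating_def
    proof (intro allI impI)
      fix k assume "Suc (Suc k) < length r"
      then show "{r ! k, r ! Suc k} \<in> matched_edges N ma \<longleftrightarrow>
          {r ! Suc k, r ! Suc (Suc k)} \<notin> matched_edges N ma"
        using 3(4)[unfolded alternating_def, rule_format, of "k + 2"] by simp
    qed
    have f: "2 \<le> length r \<longrightarrow> {r ! 0, r ! 1} \<notin> matched_edges N ma"
      using 3(4)[unfolded alternating_def, rule_format, of 1] \<open>{y, z} \<in> matched_edges N ma\<close> Cons
      by (auto simp: Suc_le_eq)
    obtain k where k: "length r = 2 * k + 2" "free_walk A me k w"
      using 3(1)[OF e a f, of w] Cons z 3(8,9) by auto
    have "free_walk A me (Suc k) u"
      using v' matching_arrays_match(1)[OF m w] k(2) by auto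
    then show ?thesis using k(1) by (intro exI[of _ "Suc k"]) auto
  qed
qed auto

lemma augmenting_from_free_walk:
  assumes m: "matching_arrays A N ma me" and c: "c < N"
    and p: "augmenting_from (edges_below A N) (matched_edges N ma) c p"
  shows "\<exists>k. length p = 2 * k + 2 \<and> free_walk A me k c"
proof -
  obtain v where v: "last p = Server v" using p unfolding augmenting_from_def by blast
  have p': "is_path (edges_below A N) p" "2 \<le> length p" "alternating (matched_edges N ma) p"
    "unmatched (matched_edges N ma) (hd p)" "unmatched (matched_edges N ma) (last p)" "hd p = Client c"
    using p unfolding augmenting_from_def augmenting_path_def by auto
  have "{p ! 0, p ! 1} \<notin> matched_edges N ma"
  proof
    assume "{p ! 0, p ! 1} \<in> matched_edges N ma"
    then have "p ! 0 \<in> \<Union> (matched_edges N ma)" by blast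
    then show False using p'(4,2) unfolding unmatched_def by (cases p) auto
  qed
  moreover have "me v = 0" using p'(5) v unmatched_server_iff[OF m] by simp
  ultimately show ?thesis
    using alternating_walk_free_walk[OF m, of p c v] p' v unfolding is_path_def by blast
qed

text \<open>The path is read from \<open>pu k\<close> to the free server, whereas \<open>pu\<close>
  and \<open>pv\<close> count from the other end: positions \<open>2 * j\<close> and
  \<open>Suc (2 * j)\<close> carry index \<open>k - j\<close>.\<close>

definition aug_list :: "nat \<Rightarrow> (nat \<Rightarrow> nat) \<Rightarrow> (nat \<Rightarrow> nat) \<Rightarrow> vertex list" where
  "aug_list k pu pv =
     map (\<lambda>t. if even t then Client (pu (k - t div 2)) else Server (pv (k - t div 2))) [0..<2 * k + 2]"

lemma length_aug_list [simp]: "length (aug_list k pu pv) = 2 * k + 2"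
  by (simp add: aug_list_def)

lemma nth_aug_list:
  "j \<le> k \<Longrightarrow> aug_list k pu pv ! (2 * j) = Client (pu (k - j))"
  "j \<le> k \<Longrightarrow> aug_list k pu pv ! Suc (2 * j) = Server (pv (k - j))"
  unfolding aug_list_def by (simp_all del: upt_Suc)

context
  fixes A N ma me c k pu pv
  assumes m: "matching_arrays A N ma me" and aug: "shortest_aug A ma me c k pu pv" and c: "c < N"
begin

lemma aug_unmatched_edge: "i \<le> k \<Longrightarrow> ma (pu i) \<noteq> Suc (pv i)"
  using aug shortest_aug_inj_server[OF m aug, of "Suc i" i] unfolding shortest_aug_def
  by (cases "i = k") (auto simp: Suc_le_eq)

text \<open>The first set consists of the unmatched edges of the path, the second of the matched
  ones. In this form augmenting means that each \<open>pu i\<close> moves from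
  \<open>pv (Suc i)\<close> to \<open>pv i\<close>.\<close>

lemma path_edges_aug_list:
  "path_edges (aug_list k pu pv) =
     {{Client (pu i), Server (pv i)} | i. i \<le> k} \<union> {{Client (pu i), Server (pv (Suc i))} | i. i < k}"
  (is "?L = ?R1 \<union> ?R2")
proof (intro equalityI subsetI)
  fix e assume "e \<in> ?L"
  then obtain t where t: "Suc t < 2 * k + 2" "e = {aug_list k pu pv ! t, aug_list k pu pv ! Suc t}"
    unfolding path_edges_def by auto
  show "e \<in> ?R1 \<union> ?R2"
  proof (cases "even t")
    case True
    then obtain j where j: "t = 2 * j" by blast
    then have "e = {Client (pu (k - j)), Server (pv (k - j))}" using t by (simp add: nth_aug_list)
    moreover have "k - j \<le> k" by simp
    ultimately show ?thesis by blast
  next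
    case False
    then obtain j where j: "t = 2 * j + 1" using oddE by blast
    then have "j < k" using t by simp
    then have "e = {Server (pv (k - j)), Client (pu (k - Suc j))}"
      using t j nth_aug_list(1)[of "Suc j" k pu pv] by (simp add: nth_aug_list)
    then have "e = {Client (pu (k - Suc j)), Server (pv (Suc (k - Suc j)))}"
      using \<open>j < k\<close> by (simp add: insert_commute Suc_diff_Suc)
    moreover have "k - Suc j < k" using \<open>j < k\<close> by simp
    ultimately show ?thesis by blast
  qed
next
  fix e assume "e \<in> ?R1 \<union> ?R2"
  then show "e \<in> ?L"
  proof
    assume "e \<in> ?R1"
    then obtain i where i: "i \<le> k" "e = {Client (pu i), Server (pv i)}" by blast
    then have "Suc (2 * (k - i)) < 2 * k + 2" by simp
    moreover have "e = {aug_list k pu pv ! (2 * (k - i)), aug_list k pu pv ! Suc (2 * (k - i))}"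
      using i by (simp add: nth_aug_list)
    ultimately show ?thesis unfolding path_edges_def length_aug_list by blast
  next
    assume "e \<in> ?R2"
    then obtain i where i: "i < k" "e = {Client (pu i), Server (pv (Suc i))}" by blast
    have "aug_list k pu pv ! Suc (2 * (k - Suc i)) = Server (pv (Suc i))"
      using i nth_aug_list(2)[of "k - Suc i" k pu pv] by simp
    moreover have "aug_list k pu pv ! Suc (Suc (2 * (k - Suc i))) = Client (pu i)"
    proof -
      have "Suc (Suc (2 * (k - Suc i))) = 2 * (k - i)" using i by simp
      then show ?thesis using i nth_aug_list(1)[of "k - i" k pu pv] by simp
    qed
    ultimately have "e = {aug_list k pu pv ! Suc (2 * (k - Suc i)), aug_list k pu pv ! Suc (Suc (2 * (k - Suc i)))}"
      using i by (simp add: insert_commute)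
    moreover have "Suc (Suc (2 * (k - Suc i))) < 2 * k + 2" using i by simp
    ultimately show ?thesis unfolding path_edges_def length_aug_list by blast
  qed
qed

lemma augmenting_from_aug_list:
  "augmenting_from (edges_below A N) (matched_edges N ma) c (aug_list k pu pv)"
proof -
  let ?p = "aug_list k pu pv"
  have cl: "j \<le> k \<Longrightarrow> pu j < N" for j by (rule shortest_aug_client[OF m aug c])
  have even_edge: "{?p ! (2 * j), ?p ! Suc (2 * j)} \<in> edges_below A N - matched_edges N ma"
    if "j \<le> k" for j
    using that aug cl[of "k - j"] aug_unmatched_edge[of "k - j"]
    by (simp add: nth_aug_list shortest_aug_def)
  have odd_edge: "{?p ! Suc (2 * j), ?p ! Suc (Suc (2 * j))} \<in> edges_below A N \<inter> matched_edges N ma"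
    if "j < k" for j
  proof -
    have "ma (pu (k - Suc j)) = Suc (pv (k - j))"
      using aug that unfolding shortest_aug_def by (metis Suc_diff_Suc diff_less zero_less_Suc less_trans_Suc gr_zeroI not_less0)
    then show ?thesis
      using that matching_arrays_match[OF m, of "pu (k - Suc j)"] nth_aug_list(1)[of "Suc j" k pu pv]
      by (simp add: nth_aug_list)
  qed
  have edge: "{?p ! t, ?p ! Suc t} \<in> edges_below A N \<and> ({?p ! t, ?p ! Suc t} \<in> matched_edges N ma \<longleftrightarrow> odd t)"
    if t: "Suc t < 2 * k + 2" for t
  proof (cases "even t")
    case True
    then obtain j where "t = 2 * j" by blast
    then show ?thesis using even_edge[of j] t by auto
  next
    case False
    then obtain j where "t = 2 * j + 1" using oddE by blast
    then show ?thesis using odd_edge[of j] t by auto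
  qed
  have "distinct ?p" unfolding aug_list_def distinct_map
  proof (intro conjI inj_onI)
    fix t t' assume a: "t \<in> set [0..<2 * k + 2]" "t' \<in> set [0..<2 * k + 2]"
      "(if even t then Client (pu (k - t div 2)) else Server (pv (k - t div 2))) =
       (if even t' then Client (pu (k - t' div 2)) else Server (pv (k - t' div 2)))"
    then have d: "t div 2 \<le> k" "t' div 2 \<le> k" "even t = even t'" by (auto split: if_splits)
    then have "k - t div 2 = k - t' div 2"
      using a(3) shortest_aug_inj[OF m aug, of "k - t div 2" "k - t' div 2"]
        shortest_aug_inj_server[OF m aug, of "k - t div 2" "k - t' div 2"] by (auto split: if_splits)
    then have "t div 2 = t' div 2" using d by linarith
    then show "t = t'" using d(3) by (metis bit_eq_rec)
  qed simp
  moreover have ne: "?p \<noteq> []" using length_aug_list[of k pu pv] by (metis add_is_0 list.size(3) zero_neq_numeral)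
  ultimately have "is_path (edges_below A N) ?p" unfolding is_path_def using edge by simp
  moreover have "alternating (matched_edges N ma) ?p" unfolding alternating_def
  proof (intro allI impI)
    fix t assume "Suc (Suc t) < length ?p"
    then show "{?p ! t, ?p ! Suc t} \<in> matched_edges N ma \<longleftrightarrow> {?p ! Suc t, ?p ! Suc (Suc t)} \<notin> matched_edges N ma"
      using edge[of t] edge[of "Suc t"] by simp
  qed
  moreover have hd: "hd ?p = Client c"
    using ne nth_aug_list(1)[of 0 k pu pv] aug by (simp add: hd_conv_nth shortest_aug_def)
  moreover have last: "last ?p = Server (pv 0)"
    using ne nth_aug_list(2)[of k k pu pv] by (simp add: last_conv_nth)
  moreover have "ma c = 0" "me (pv 0) = 0" using aug by (auto simp: shortest_aug_def)
  ultimately show ?thesis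
    unfolding augmenting_from_def augmenting_path_def
    using unmatched_server_iff[OF m] unmatched_client_iff[OF c] by simp
qed

lemma augment_aug_list:
  assumes fl: "flipped pu pv (Suc k) ma me lab cur ma' me' lab' cur'"
  shows "augment (matched_edges N ma) (aug_list k pu pv) = matched_edges N ma'"
proof -
  let ?P = "path_edges (aug_list k pu pv)"
  have cl: "j \<le> k \<Longrightarrow> pu j < N" for j by (rule shortest_aug_client[OF m aug c])
  have P: "{Client u, Server v} \<in> ?P \<longleftrightarrow>
      (\<exists>i\<le>k. u = pu i \<and> v = pv i) \<or> (\<exists>i<k. u = pu i \<and> v = pv (Suc i))" for u v
    unfolding path_edges_aug_list by (auto simp: doubleton_eq_iff)
  have form: "e \<in> matched_edges N ma \<union> ?P \<union> matched_edges N ma' \<Longrightarrow> \<exists>u v. e = {Client u, Server v}" for e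
    unfolding path_edges_aug_list matched_edges_def by blast
  have "{Client u, Server v} \<in> sym_diff (matched_edges N ma) ?P \<longleftrightarrow> {Client u, Server v} \<in> matched_edges N ma'" for u v
  proof (cases "\<exists>i\<le>k. u = pu i")
    case True
    then obtain i where i: "i \<le> k" "u = pu i" by blast
    have u: "(\<exists>l\<le>k. u = pu l \<and> v = pv l) \<longleftrightarrow> v = pv i"
      "(\<exists>l<k. u = pu l \<and> v = pv (Suc l)) \<longleftrightarrow> i < k \<and> v = pv (Suc i)"
      using i shortest_aug_inj[OF m aug] less_imp_le by metis+
    have ma': "ma' u = Suc (pv i)" using fl i unfolding flipped_def by auto
    have ma: "ma u = (if i < k then Suc (pv (Suc i)) else 0)"
      using i aug unfolding shortest_aug_def by auto
    have "i < k \<Longrightarrow> pv (Suc i) \<noteq> pv i" using shortest_aug_inj_server[OF m aug, of "Suc i" i] by auto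
    then show ?thesis using ma ma' u cl[OF i(1)] i(2) P by auto
  next
    case False
    then have "ma' u = ma u" using fl unfolding flipped_def by auto
    moreover have "{Client u, Server v} \<notin> ?P" using False P less_imp_le by blast
    ultimately show ?thesis by simp
  qed
  then show ?thesis unfolding augment_def using form by (intro set_eqI) blast
qed

end

text \<open>Walks may repeat vertices and augmenting paths may not, but the minima agree: every
  augmenting path yields a walk of corresponding length, and a shortest walk visits no vertex
  twice.\<close>

lemma sap_step_shortest_aug:
  assumes m: "matching_arrays A N ma me" and aug: "shortest_aug A ma me c k pu pv" and c: "c < N"
    and fl: "flipped pu pv (Suc k) ma me lab cur ma' me' lab' cur'"
  shows "sap_step (edges_below A N) (matched_edges N ma) c (matched_edges N ma')"
proof -
  have p: "augmenting_from (edges_below A N) (matched_edges N ma) c (aug_list k pu pv)"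
    by (rule augmenting_from_aug_list[OF m aug c])
  have "length (aug_list k pu pv) \<le> length q"
    if "augmenting_from (edges_below A N) (matched_edges N ma) c q" for q
    using augmenting_from_free_walk[OF m c that] aug unfolding shortest_aug_def by auto
  then have "is_arg_min length (augmenting_from (edges_below A N) (matched_edges N ma) c) (aug_list k pu pv)"
    using p unfolding is_arg_min_def by (auto simp: not_less simp del: length_aug_list)
  then show ?thesis unfolding sap_step_def using p augment_aug_list[OF m aug c fl] by auto
qed

lemma sap_step_no_walk:
  assumes "matching_arrays A N ma me" and "c < N" and "\<And>k. \<not> free_walk A me k c"
  shows "sap_step (edges_below A N) (matched_edges N ma) c (matched_edges N ma)"
  unfolding sap_step_def using augmenting_from_free_walk[OF assms(1,2)] assms(3) by auto

text \<open>A protocol step compares matchings with different numbers of clients; this moves the old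
  one to the new range.\<close>

lemma matched_edges_Suc: "ma c = 0 \<Longrightarrow> matched_edges (Suc c) ma = matched_edges c ma"
  unfolding matched_edges_def by (auto simp: less_Suc_eq)

lemma graph_of_take:
  "i < length Ns \<Longrightarrow> graph_of (take (Suc i) Ns) = edges_below ((!) Ns) (Suc i)"
  unfolding graph_of_def edges_below_def
  by (intro Collect_cong ex_cong1) (auto simp: min_def)

subsection \<open>Depth-first search with distance labels\<close>

primrec lab_chain ::
  "(nat \<Rightarrow> nat list) \<Rightarrow> (nat \<Rightarrow> nat) \<Rightarrow> (nat \<Rightarrow> nat) \<Rightarrow> (nat \<Rightarrow> nat) \<Rightarrow> nat \<Rightarrow> nat \<Rightarrow> nat \<Rightarrow> bool" where
  "lab_chain A ma par lab c 0 u \<longleftrightarrow> u = c"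
| "lab_chain A ma par lab c (Suc k) u \<longleftrightarrow>
     (\<exists>v \<in> set (A (par u)). ma u = Suc v) \<and> lab u < lab (par u) \<and> lab_chain A ma par lab c k (par u)"

lemma lab_chain_par_chain: "lab_chain A ma par lab c k u \<Longrightarrow> par_chain A ma par c k u"
  by (induction k arbitrary: u) auto

lemma lab_chain_lab: "lab_chain A ma par lab c k u \<Longrightarrow> lab u + k \<le> lab c"
  by (induction k arbitrary: u) fastforce+

text \<open>Every client on the chain has at least the label of its end \<open>u\<close>, so a
  client of smaller label is not on it. A client can therefore be relabelled when the search leaves
  it, and be given a parent when the search enters it, without damage to the stack.\<close>

lemma lab_chain_upd_lab:
  "lab_chain A ma par lab c k u \<Longrightarrow> lab w < lab u \<Longrightarrow> lab_chain A ma par (lab(w := y)) c k u"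
  by (induction k arbitrary: u) auto

lemma lab_chain_upd_par:
  "lab_chain A ma par lab c k u \<Longrightarrow> lab w < lab u \<Longrightarrow> lab_chain A ma (par(w := y)) lab c k u"
  by (induction k arbitrary: u) auto

lemma par_chain_le:
  assumes "matching_arrays A (Suc c) ma me" and "par_chain A ma par c k u"
  shows "u \<le> c"
  using assms(2) matching_arrays_match(2)[OF assms(1), of u] by (cases k) auto

text \<open>\<open>k\<close> is the depth of the search stack, which exists only as parent pointers.
  The root points to itself, so retreating from \<open>c\<close> continues the search at
  \<open>c\<close> with a larger label.\<close>

definition dfs_inv ::
  "(nat \<Rightarrow> nat list) \<Rightarrow> nat \<Rightarrow> (nat \<Rightarrow> nat) \<Rightarrow> (nat \<Rightarrow> nat) \<Rightarrow> (nat \<Rightarrow> nat) \<Rightarrow> (nat \<Rightarrow> nat) \<Rightarrow> (nat \<Rightarrow> nat) \<Rightarrow>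
    nat \<Rightarrow> nat \<Rightarrow> nat \<Rightarrow> bool" where
  "dfs_inv A c ma me lab cur par u fnd k \<longleftrightarrow>
     sap_inv A (Suc c) ma me lab cur \<and> ma c = 0 \<and> par c = c \<and> lab_chain A ma par lab c k u \<and>
     (fnd \<noteq> 0 \<longrightarrow> (\<exists>v \<in> set (A u). fnd = Suc v \<and> me v = 0))"

lemma dfs_inv_le: "dfs_inv A c ma me lab cur par u fnd k \<Longrightarrow> u \<le> c"
  unfolding dfs_inv_def sap_inv_def using par_chain_le lab_chain_par_chain by metis

lemma dfs_inv_lab: "dfs_inv A c ma me lab cur par u fnd k \<Longrightarrow> lab u + k \<le> lab c"
  unfolding dfs_inv_def using lab_chain_lab by metis

lemma dfs_inv_start:
  "sap_inv A (Suc c) ma me lab cur \<Longrightarrow> ma c = 0 \<Longrightarrow> par c = c \<Longrightarrow> dfs_inv A c ma me lab cur par c 0 0"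
  unfolding dfs_inv_def by simp

lemma dfs_inv_found:
  "dfs_inv A c ma me lab cur par u fnd k \<Longrightarrow> cur u < length (A u) \<Longrightarrow> me (A u ! cur u) = 0 \<Longrightarrow>
    dfs_inv A c ma me lab cur par u (Suc (A u ! cur u)) k"
  unfolding dfs_inv_def by (auto intro: nth_mem)

lemma dfs_inv_advance:
  assumes inv: "dfs_inv A c ma me lab cur par u 0 k" and "cur u < length (A u)"
    and x: "me (A u ! cur u) = Suc x" "lab x < lab u"
  shows "dfs_inv A c ma me lab cur (par(x := u)) x 0 (Suc k)"
proof -
  have "matching_arrays A (Suc c) ma me" using inv unfolding dfs_inv_def sap_inv_def by blast
  then have "ma x = Suc (A u ! cur u)" using x matching_arrays_mate by blast
  moreover from this have "x \<noteq> c" using inv unfolding dfs_inv_def by auto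
  ultimately show ?thesis
    using assms unfolding dfs_inv_def by (auto intro: lab_chain_upd_par nth_mem)
qed

lemma dfs_inv_next:
  assumes inv: "dfs_inv A c ma me lab cur par u 0 k" and "cur u < length (A u)"
    and x: "me (A u ! cur u) = Suc x" "\<not> lab x < lab u"
  shows "dfs_inv A c ma me lab (cur(u := Suc (cur u))) par u 0 k"
proof -
  have "u \<le> c" using dfs_inv_le[OF inv] .
  then have "sap_inv A (Suc c) ma me lab (cur(u := Suc (cur u)))"
    using assms unfolding dfs_inv_def sap_inv_def by (auto simp: less_Suc_eq)
  then show ?thesis using inv unfolding dfs_inv_def by blast
qed

text \<open>An exhausted arc means that all neighbours of \<open>u\<close> are matched to clients of
  label at least \<open>lab u\<close>, so a walk from \<open>u\<close> is longer than
  \<open>lab u\<close>. At the root the truncated \<open>k - 1\<close> keeps the depth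
  \<open>0\<close>.\<close>

lemma dfs_inv_relabel:
  assumes inv: "dfs_inv A c ma me lab cur par u 0 k" and cur: "\<not> cur u < length (A u)"
  shows "dfs_inv A c ma me (lab(u := Suc (lab u))) (cur(u := 0)) par (par u) 0 (k - 1)"
proof -
  have u: "u \<le> c" using dfs_inv_le[OF inv] .
  have sap: "sap_inv A (Suc c) ma me lab cur" using inv unfolding dfs_inv_def by blast
  have curu: "cur u = length (A u)" using sap cur unfolding sap_inv_def by (metis le_neq_implies_less)
  have all: "\<exists>x. me v = Suc x \<and> lab u \<le> lab x" if "v \<in> set (A u)" for v
    using that sap curu unfolding sap_inv_def in_set_conv_nth by metis
  have "Suc (lab u) \<le> j" if w: "free_walk A me j u" for j
  proof (cases j)
    case 0
    then show ?thesis using w all by fastforce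
  next
    case (Suc i)
    then obtain v x where v: "v \<in> set (A u)" "me v = Suc x" "free_walk A me i x" using w by auto
    have "lab u \<le> lab x" using all[OF v(1)] v(2) by simp
    also have "\<dots> \<le> i" using v(3) sap unfolding sap_inv_def by blast
    finally show ?thesis using Suc by simp
  qed
  then have "sap_inv A (Suc c) ma me (lab(u := Suc (lab u))) (cur(u := 0))"
    using sap u unfolding sap_inv_def by (auto simp: le_Suc_eq) (metis le_SucI)+
  moreover have "lab_chain A ma par (lab(u := Suc (lab u))) c (k - 1) (par u)"
    using inv unfolding dfs_inv_def by (cases k) (auto intro: lab_chain_upd_lab)
  ultimately show ?thesis using inv unfolding dfs_inv_def by blast
qed

text \<open>Labels decrease strictly along the stack, hence \<open>k \<le> lab c\<close>, and
  \<open>lab c\<close> is a lower bound for the distance. The path is optimal although the search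
  compares no lengths.\<close>

lemma dfs_inv_shortest:
  assumes inv: "dfs_inv A c ma me lab cur par u (Suc v) k"
  shows "v \<in> set (A u)" and "me v = 0" and "par_chain A ma par c k u"
    and "free_walk A me j c \<Longrightarrow> k \<le> j"
proof -
  have sap: "sap_inv A (Suc c) ma me lab cur" and ch: "lab_chain A ma par lab c k u"
    using inv unfolding dfs_inv_def by blast+
  show "v \<in> set (A u)" "me v = 0" using inv unfolding dfs_inv_def by auto
  show "par_chain A ma par c k u" by (rule lab_chain_par_chain[OF ch])
  show "free_walk A me j c \<Longrightarrow> k \<le> j"
    using lab_chain_lab[OF ch] sap unfolding sap_inv_def by (meson add_leD2 order_trans)
qed

section \<open>Potentials for scanning and for dead clients\<close>

text \<open>Capped at \<open>K\<close>: only labels below \<open>K\<close> are paid for by scanning an adjacency list, larger ones are set by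
  breadth-first searches.\<close>

definition client_pot :: "(nat \<Rightarrow> nat list) \<Rightarrow> nat \<Rightarrow> (nat \<Rightarrow> nat) \<Rightarrow> (nat \<Rightarrow> nat) \<Rightarrow> nat \<Rightarrow> nat" where
  "client_pot A K lab cur u =
     (if lab u < K then lab u * (length (A u) + 1) + cur u else K * (length (A u) + 1))"

definition scan_pot :: "(nat \<Rightarrow> nat list) \<Rightarrow> nat \<Rightarrow> nat \<Rightarrow> (nat \<Rightarrow> nat) \<Rightarrow> (nat \<Rightarrow> nat) \<Rightarrow> nat" where
  "scan_pot A K N lab cur = (\<Sum>u<N. client_pot A K lab cur u)"

text \<open>Pays for failed breadth-first searches: the clients they visit receive label
  \<open>s\<close> and are never entered again.\<close>

definition dead_pot :: "(nat \<Rightarrow> nat list) \<Rightarrow> nat \<Rightarrow> nat \<Rightarrow> (nat \<Rightarrow> nat) \<Rightarrow> nat" where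
  "dead_pot A s N lab = (\<Sum>u<N. if s \<le> lab u then length (A u) + 1 else 0)"

lemma sum_bump:
  fixes f f' :: "nat \<Rightarrow> nat"
  assumes "u < N" and "\<And>x. x \<noteq> u \<Longrightarrow> f' x = f x" and "f' u = f u + 1"
  shows "(\<Sum>x<N. f' x) = (\<Sum>x<N. f x) + 1"
proof -
  have "(\<Sum>x<N. f' x) = f' u + (\<Sum>x\<in>{..<N} - {u}. f' x)" using assms(1) by (simp add: sum.remove)
  also have "(\<Sum>x\<in>{..<N} - {u}. f' x) = (\<Sum>x\<in>{..<N} - {u}. f x)"
    using assms(2) by (intro sum.cong) auto
  also have "f' u + \<dots> = (\<Sum>x<N. f x) + 1" using assms(1,3) by (simp add: sum.remove)
  finally show ?thesis .
qed

lemma scan_pot_next: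
  "u < N \<Longrightarrow> lab u < K \<Longrightarrow> scan_pot A K N lab (cur(u := Suc (cur u))) = scan_pot A K N lab cur + 1"
  unfolding scan_pot_def by (rule sum_bump) (auto simp: client_pot_def)

text \<open>The weight is the degree plus one in order to count the relabelling itself: a finished
  arc at label \<open>l\<close> and a fresh one at \<open>l + 1\<close> differ by exactly one, also
  where \<open>l + 1\<close> meets the cap.\<close>

lemma scan_pot_relabel:
  "u < N \<Longrightarrow> lab u < K \<Longrightarrow> cur u = length (A u) \<Longrightarrow>
    scan_pot A K N (lab(u := Suc (lab u))) (cur(u := 0)) = scan_pot A K N lab cur + 1"
proof -
  assume a: "u < N" "lab u < K" "cur u = length (A u)"
  have "client_pot A K (lab(u := Suc (lab u))) (cur(u := 0)) u = client_pot A K lab cur u + 1"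
  proof (cases "Suc (lab u) < K")
    case False
    then have "K = Suc (lab u)" using a by simp
    then show ?thesis using a by (simp add: client_pot_def)
  qed (use a in \<open>simp add: client_pot_def\<close>)
  then show ?thesis using a unfolding scan_pot_def
    by (intro sum_bump) (auto simp: client_pot_def)
qed

lemma client_pot_le: "cur u \<le> length (A u) \<Longrightarrow> client_pot A K lab cur u \<le> K * (length (A u) + 1)"
proof -
  assume c: "cur u \<le> length (A u)"
  show ?thesis
  proof (cases "lab u < K")
    case True
    have "lab u * (length (A u) + 1) + cur u \<le> (lab u + 1) * (length (A u) + 1)" using c by simp
    also have "\<dots> \<le> K * (length (A u) + 1)" using True by (intro mult_right_mono) auto
    finally show ?thesis using True by (simp add: client_pot_def)
  qed (simp add: client_pot_def)
qed

lemma scan_pot_bound: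
  "(\<And>u. cur u \<le> length (A u)) \<Longrightarrow> scan_pot A K N lab cur \<le> K * (\<Sum>u<N. length (A u) + 1)"
  unfolding scan_pot_def sum_distrib_left by (intro sum_mono client_pot_le)

lemma scan_pot_mono:
  assumes "\<And>u. cur u \<le> length (A u)" and "\<And>u. lab u \<le> lab' u"
    and "\<And>u. lab' u = lab u \<Longrightarrow> cur' u = cur u"
  shows "scan_pot A K N lab cur \<le> scan_pot A K N lab' cur'"
  unfolding scan_pot_def
proof (rule sum_mono)
  fix u
  show "client_pot A K lab cur u \<le> client_pot A K lab' cur' u"
  proof (cases "lab' u = lab u")
    case True
    then show ?thesis using assms(3) by (simp add: client_pot_def)
  next
    case False
    then have l: "lab u < lab' u" using assms(2)[of u] by simp
    show ?thesis
    proof (cases "lab' u < K")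
      case True
      \<comment> \<open>A raised label may discard the arc position. Capping the old potential at
        the new label shows that the full rounds counted there already cover whatever
        \<open>cur\<close> had reached.\<close>
      have "client_pot A (lab' u) lab cur u \<le> lab' u * (length (A u) + 1)"
        by (rule client_pot_le) (rule assms(1))
      then show ?thesis using l True by (simp add: client_pot_def)
    next
      case False
      then show ?thesis using client_pot_le[of cur u A K lab] assms(1)
        by (simp add: client_pot_def[of A K lab'])
    qed
  qed
qed

lemma dead_pot_mono: "(\<And>u. lab u \<le> lab' u) \<Longrightarrow> dead_pot A s N lab \<le> dead_pot A s N lab'"
  unfolding dead_pot_def by (intro sum_mono) (auto intro: order_trans)

lemma dead_pot_bound: "dead_pot A s N lab \<le> (\<Sum>u<N. length (A u) + 1)"
  unfolding dead_pot_def by (intro sum_mono) auto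

lemma dead_pot_kill:
  assumes "Q \<subseteq> {..<N}" and "\<And>u. u \<in> Q \<Longrightarrow> lab u < s"
  shows "dead_pot A s N lab + (\<Sum>u\<in>Q. length (A u) + 1) = dead_pot A s N (\<lambda>u. if u \<in> Q then s else lab u)"
proof -
  have "(\<Sum>u\<in>Q. length (A u) + 1) = (\<Sum>u<N. if u \<in> Q then length (A u) + 1 else 0)"
    using assms(1) by (subst sum.inter_restrict[symmetric]) (auto simp: Int_absorb1)
  then have "dead_pot A s N lab + (\<Sum>u\<in>Q. length (A u) + 1) =
    (\<Sum>u<N. (if s \<le> lab u then length (A u) + 1 else 0) + (if u \<in> Q then length (A u) + 1 else 0))"
    unfolding dead_pot_def by (simp add: sum.distrib)
  also have "\<dots> = dead_pot A s N (\<lambda>u. if u \<in> Q then s else lab u)"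
    unfolding dead_pot_def using assms(2) by (intro sum.cong) (auto dest: leD)
  finally show ?thesis .
qed

subsection \<open>Breadth-first search\<close>

text \<open>\<open>e\<close> is the distance of the client whose list is being read. A free server
  never counts as scanned, since meeting one ends the search.\<close>

definition scanned ::
  "(nat \<Rightarrow> nat) \<Rightarrow> (nat \<Rightarrow> nat) \<Rightarrow> nat \<Rightarrow> nat set \<Rightarrow> (nat \<Rightarrow> nat) \<Rightarrow> nat \<Rightarrow> nat \<Rightarrow> bool" where
  "scanned me lab s Q d e v \<longleftrightarrow> (\<exists>x. me v = Suc x \<and> (s \<le> lab x \<or> x \<in> Q \<and> d x \<le> e + 1))"

text \<open>\<open>d\<close> is a ghost variable, the distance from the new client \<open>c\<close>; clients with label at least \<open>s\<close> reach no free
  server and are not entered.\<close>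

definition bfs_inv ::
  "(nat \<Rightarrow> nat list) \<Rightarrow> nat \<Rightarrow> nat \<Rightarrow> (nat \<Rightarrow> nat) \<Rightarrow> (nat \<Rightarrow> nat) \<Rightarrow> (nat \<Rightarrow> nat) \<Rightarrow> (nat \<Rightarrow> nat) \<Rightarrow>
    (nat \<Rightarrow> nat) \<Rightarrow> (nat \<Rightarrow> nat) \<Rightarrow> (nat \<Rightarrow> nat) \<Rightarrow> nat \<Rightarrow> nat \<Rightarrow> nat \<Rightarrow> nat \<Rightarrow> nat \<Rightarrow> bool" where
  "bfs_inv A c s ma me lab par q seen d u qh qt p fnd \<longleftrightarrow>
     qh \<le> qt \<and> c \<in> q ` {..<qt} \<and> d c = 0 \<and> inj_on q {..<qt} \<and>
     (\<forall>x. seen x = Suc c \<longleftrightarrow> x \<in> q ` {..<qt}) \<and>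
     (\<forall>y \<in> q ` {..<qt}. y \<le> c \<and> lab y < s \<and>
        (y = c \<or> par y \<in> q ` {..<qt} \<and> d y = Suc (d (par y)) \<and> (\<exists>v \<in> set (A (par y)). ma y = Suc v))) \<and>
     (\<forall>a b. a \<le> b \<longrightarrow> b < qt \<longrightarrow> d (q a) \<le> d (q b)) \<and>
     (\<forall>a<qh. \<forall>v \<in> set (A (q a)). scanned me lab s (q ` {..<qt}) d (d (q a)) v) \<and>
     (qh < qt \<longrightarrow> u = q qh \<and> p \<le> length (A u) \<and> (\<forall>a<qt. d (q a) \<le> d u + 1) \<and>
        (\<forall>i<p. scanned me lab s (q ` {..<qt}) d (d u) (A u ! i))) \<and>
     (fnd \<noteq> 0 \<longrightarrow> qh < qt \<and> (\<exists>v \<in> set (A u). fnd = Suc v \<and> me v = 0))"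

text \<open>\<open>seen\<close> is never cleared. A search stamps clients with \<open>Suc c\<close>,
  and earlier stamps are at most \<open>c\<close>, so starting a search takes constant time.\<close>

lemma bfs_inv_start:
  assumes "\<And>x. seen x \<le> c" and "lab c < s" and "q 0 = c"
  shows "bfs_inv A c s ma me lab par q (seen(c := Suc c)) (\<lambda>_. 0) c 0 1 0 0"
proof -
  have "seen x \<noteq> Suc c" for x using assms(1)[of x] by simp
  then show ?thesis using assms(2,3) unfolding bfs_inv_def by (auto simp: inj_on_def)
qed

lemma bfs_inv_found:
  "bfs_inv A c s ma me lab par q seen d u qh qt p 0 \<Longrightarrow> qh < qt \<Longrightarrow> p < length (A u) \<Longrightarrow>
    me (A u ! p) = 0 \<Longrightarrow> bfs_inv A c s ma me lab par q seen d u qh qt p (Suc (A u ! p))"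
  unfolding bfs_inv_def by (auto intro: nth_mem)

lemma bfs_inv_skip:
  assumes inv: "bfs_inv A c s ma me lab par q seen d u qh qt p 0" and "qh < qt" "p < length (A u)"
    and x: "me (A u ! p) = Suc x" "seen x = Suc c \<or> s \<le> lab x"
  shows "bfs_inv A c s ma me lab par q seen d u qh qt (Suc p) 0"
proof -
  have "scanned me lab s (q ` {..<qt}) d (d u) (A u ! p)"
    using inv \<open>qh < qt\<close> x unfolding bfs_inv_def scanned_def by auto
  then show ?thesis using inv assms(2,3) unfolding bfs_inv_def by (auto simp: less_Suc_eq)
qed

lemma scanned_push:
  "scanned me lab s Q d e v \<Longrightarrow> x \<notin> Q \<Longrightarrow> scanned me lab s (insert x Q) (d(x := y)) e v"
  unfolding scanned_def by (metis fun_upd_other insertI2)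

text \<open>All queued distances are at most \<open>d u + 1\<close>, the distance of the new entry,
  so appending keeps the queue sorted. As \<open>x\<close> is not queued, the updates at
  \<open>x\<close> leave the older entries alone.\<close>

lemma bfs_inv_push:
  assumes inv: "bfs_inv A c s ma me lab par q seen d u qh qt p 0" and qh: "qh < qt" and p: "p < length (A u)"
    and m: "matching_arrays A (Suc c) ma me"
    and x: "me (A u ! p) = Suc x" "seen x \<noteq> Suc c" "lab x < s"
  shows "bfs_inv A c s ma me lab (par(x := u)) (q(qt := x)) (seen(x := Suc c)) (d(x := Suc (d u)))
    u qh (Suc qt) (Suc p) 0"
proof -
  let ?Q = "q ` {..<qt}"
  let ?q = "q(qt := x)"
  let ?d = "d(x := Suc (d u))"
  have xQ: "x \<notin> ?Q" using inv x(2) unfolding bfs_inv_def by blast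
  have ne: "a < qt \<Longrightarrow> q a \<noteq> x" for a using xQ by blast
  have Q': "?q ` {..<Suc qt} = insert x ?Q" by (auto simp: lessThan_Suc)
  have u: "u = q qh" "u \<in> ?Q" using inv qh unfolding bfs_inv_def by auto
  have cQ: "c \<in> ?Q" "c \<noteq> x" using inv xQ unfolding bfs_inv_def by blast+
  have mx: "ma x = Suc (A u ! p)" "x \<le> c" using matching_arrays_mate[OF m x(1)] by auto
  have ud: "?d u = d u" using u ne qh by auto
  have 1: "\<forall>y \<in> insert x ?Q. y \<le> c \<and> lab y < s \<and>
        (y = c \<or> (par(x := u)) y \<in> insert x ?Q \<and> ?d y = Suc (?d ((par(x := u)) y)) \<and>
          (\<exists>v \<in> set (A ((par(x := u)) y)). ma y = Suc v))"
  proof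
    fix y assume "y \<in> insert x ?Q"
    then consider "y = x" | "y \<in> ?Q" "y \<noteq> x" using xQ by blast
    then show "y \<le> c \<and> lab y < s \<and>
        (y = c \<or> (par(x := u)) y \<in> insert x ?Q \<and> ?d y = Suc (?d ((par(x := u)) y)) \<and>
          (\<exists>v \<in> set (A ((par(x := u)) y)). ma y = Suc v))"
    proof cases
      case 1
      then show ?thesis using mx x(3) u ud p by auto
    next
      case 2
      then have "y \<le> c \<and> lab y < s \<and> (y = c \<or> par y \<in> ?Q \<and> d y = Suc (d (par y)) \<and>
          (\<exists>v \<in> set (A (par y)). ma y = Suc v))" using inv unfolding bfs_inv_def by blast
      moreover have "par y \<in> ?Q \<Longrightarrow> par y \<noteq> x" using xQ by metis
      ultimately show ?thesis using 2(2) by auto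
    qed
  qed
  have le: "a < qt \<Longrightarrow> d (q a) \<le> d u + 1" for a using inv qh unfolding bfs_inv_def by blast
  have 2: "?d (?q a) \<le> ?d (?q b)" if "a \<le> b" "b < Suc qt" for a b
  proof (cases "b = qt")
    case True
    then show ?thesis using le[of a] ne[of a] that by (cases "a = qt") auto
  next
    case False
    then show ?thesis using that inv ne[of a] ne[of b] unfolding bfs_inv_def by auto
  qed
  have 3: "scanned me lab s (insert x ?Q) ?d (?d (?q a)) v" if "a < qh" "v \<in> set (A (?q a))" for a v
  proof -
    have "scanned me lab s ?Q d (d (q a)) v" using that inv qh unfolding bfs_inv_def by auto
    from scanned_push[OF this xQ] show ?thesis using ne[of a] that(1) qh by simp
  qed
  have 4: "scanned me lab s (insert x ?Q) ?d (?d u) (A u ! i)" if "i < Suc p" for i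
  proof (cases "i = p")
    case True
    then show ?thesis using x(1) ud unfolding scanned_def by auto
  next
    case False
    then have "scanned me lab s ?Q d (d u) (A u ! i)" using that inv qh unfolding bfs_inv_def by auto
    from scanned_push[OF this xQ] show ?thesis using ud by simp
  qed
  have 5: "inj_on ?q {..<Suc qt}"
  proof -
    have "inj_on ?q {..<qt}" using inv unfolding bfs_inv_def inj_on_def by simp
    then show ?thesis using xQ by (auto simp: lessThan_Suc)
  qed
  have 6: "\<forall>a<Suc qt. ?d (?q a) \<le> ?d u + 1" using ud le ne by (auto simp: less_Suc_eq)
  have 7: "\<forall>y. (seen(x := Suc c)) y = Suc c \<longleftrightarrow> y \<in> insert x ?Q" using inv unfolding bfs_inv_def by auto
  have 8: "d c = 0" "qh \<le> qt" using inv unfolding bfs_inv_def by blast+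
  show ?thesis unfolding bfs_inv_def Q'
    using 1 2 3 4 5 6 7 8 cQ p qh u(1) by (auto simp del: fun_upd_apply) (auto simp: cQ)
qed

lemma bfs_inv_next:
  assumes inv: "bfs_inv A c s ma me lab par q seen d u qh qt p 0" and qh: "qh < qt"
    and p: "\<not> p < length (A u)"
  shows "bfs_inv A c s ma me lab par q seen d (q (Suc qh)) (Suc qh) qt 0 0"
proof -
  have u: "u = q qh" "p = length (A u)" using inv qh p unfolding bfs_inv_def by auto
  have "scanned me lab s (q ` {..<qt}) d (d u) v" if "v \<in> set (A u)" for v
    using that inv qh u(2) unfolding bfs_inv_def in_set_conv_nth by metis
  then have "\<forall>a<Suc qh. \<forall>v \<in> set (A (q a)). scanned me lab s (q ` {..<qt}) d (d (q a)) v"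
    using inv u(1) unfolding bfs_inv_def by (auto simp: less_Suc_eq)
  moreover have "\<forall>a<qt. d (q a) \<le> d (q (Suc qh)) + 1" if "Suc qh < qt"
  proof (intro allI impI)
    fix a assume "a < qt"
    then have "d (q a) \<le> d u + 1" using inv qh unfolding bfs_inv_def by blast
    moreover have "d u \<le> d (q (Suc qh))" using inv that u(1) unfolding bfs_inv_def by auto
    ultimately show "d (q a) \<le> d (q (Suc qh)) + 1" by simp
  qed
  ultimately show ?thesis using inv qh unfolding bfs_inv_def by auto
qed

lemma bfs_inv_par_chain:
  assumes inv: "bfs_inv A c s ma me lab par q seen d u qh qt p fnd"
  shows "y \<in> q ` {..<qt} \<Longrightarrow> par_chain A ma par c (d y) y"
proof (induction "d y" arbitrary: y)
  case 0
  then have "y = c" using inv unfolding bfs_inv_def by (metis nat.distinct(1))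
  then show ?case using inv unfolding bfs_inv_def by simp
next
  case (Suc e)
  then have "y \<noteq> c" using inv unfolding bfs_inv_def by auto
  then have y: "par y \<in> q ` {..<qt}" "d y = Suc (d (par y))" "\<exists>v \<in> set (A (par y)). ma y = Suc v"
    using inv Suc.prems unfolding bfs_inv_def by metis+
  then show ?case using Suc.hyps by auto
qed

lemma dead_no_walk:
  assumes "sap_inv A N ma me lab cur" and "\<And>u. u < N \<Longrightarrow> set (A u) \<subseteq> {..<s}" and "x < N" and "s \<le> lab x"
  shows "\<not> free_walk A me j x"
proof
  assume "free_walk A me j x"
  then obtain i where "i < s" "free_walk A me i x"
    using free_walk_short[of A N ma me s x j] assms unfolding sap_inv_def by blast
  then show False using assms(1,4) unfolding sap_inv_def by (meson leD order_trans)
qed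

text \<open>A walk from a queued client cannot pass through dead clients and leaves the scanned part
  only at a client whose list is not exhausted; in the sorted queue such a client has distance at
  least \<open>d u\<close>. For \<open>y = c\<close> this makes a found server optimal, and it
  excludes every walk once the queue is empty.\<close>

lemma bfs_inv_dist:
  assumes inv: "bfs_inv A c s ma me lab par q seen d u qh qt p fnd"
    and sap: "sap_inv A (Suc c) ma me lab cur" and s: "\<And>u. u < Suc c \<Longrightarrow> set (A u) \<subseteq> {..<s}"
  shows "y \<in> q ` {..<qt} \<Longrightarrow> free_walk A me j y \<Longrightarrow> qh < qt \<and> d u \<le> d y + j"
proof -
  have m: "matching_arrays A (Suc c) ma me" using sap unfolding sap_inv_def by blast
  have unscanned: "qh < qt \<and> d u \<le> d y" if "y \<in> q ` {..<qt}" "v \<in> set (A y)"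
    "\<not> scanned me lab s (q ` {..<qt}) d (d y) v" for y v
  proof -
    obtain a where a: "a < qt" "y = q a" using \<open>y \<in> q ` {..<qt}\<close> by blast
    have "\<not> a < qh" using inv that(2,3) a(2) unfolding bfs_inv_def by blast
    then have "qh < qt" "qh \<le> a" using a by auto
    then show ?thesis using inv a unfolding bfs_inv_def by metis
  qed
  show "y \<in> q ` {..<qt} \<Longrightarrow> free_walk A me j y \<Longrightarrow> qh < qt \<and> d u \<le> d y + j"
  proof (induction j arbitrary: y)
  case 0
  then obtain v where "v \<in> set (A y)" "me v = 0" by auto
  then show ?case using unscanned[OF 0(1), of v] unfolding scanned_def by auto
next
  case (Suc j)
  then obtain v x where v: "v \<in> set (A y)" "me v = Suc x" "free_walk A me j x" by auto
  show ?case
  proof (cases "scanned me lab s (q ` {..<qt}) d (d y) v")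
    case False
    then show ?thesis using unscanned[OF Suc.prems(1) v(1)] by auto
  next
    case True
    have "\<not> s \<le> lab x" using dead_no_walk[OF sap s, of x j] v(3) matching_arrays_mate(2)[OF m v(2)] by blast
    then have "x \<in> q ` {..<qt}" "d x \<le> d y + 1" using True v(2) unfolding scanned_def by auto
    then show ?thesis using Suc.IH[of x] v(3) by auto
  qed
  qed
qed

text \<open>The visited set is closed: a partner of one of its neighbours is visited or dead. With
  the uniform label \<open>s\<close> the current arcs stay valid where they are.\<close>

lemma bfs_inv_fail:
  assumes inv: "bfs_inv A c s ma me lab par q seen d u qh qt p 0" and qh: "\<not> qh < qt"
    and sap: "sap_inv A (Suc c) ma me lab cur" and s: "\<And>u. u < Suc c \<Longrightarrow> set (A u) \<subseteq> {..<s}"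
  shows "sap_inv A (Suc c) ma me (\<lambda>y. if y \<in> q ` {..<qt} then s else lab y) cur"
    and "\<not> free_walk A me j c"
proof -
  let ?Q = "q ` {..<qt}"
  let ?l = "\<lambda>y. if y \<in> ?Q then s else lab y"
  have no: "\<not> free_walk A me j y" if "y \<in> ?Q" for y j
    using bfs_inv_dist[OF inv sap s that] qh by blast
  then show "\<not> free_walk A me j c" using inv unfolding bfs_inv_def by blast
  have Qc: "y \<le> c" "lab y < s" if "y \<in> ?Q" for y using inv that unfolding bfs_inv_def by blast+
  have sc: "scanned me lab s ?Q d (d y) v" if y: "y \<in> ?Q" and v: "v \<in> set (A y)" for y v
  proof -
    obtain a where "a < qt" "y = q a" using y by blast
    then show ?thesis using inv qh v unfolding bfs_inv_def by auto
  qed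
  have cur: "cur y \<le> length (A y)" for y using sap unfolding sap_inv_def by blast
  have old: "\<exists>x. me (A y ! i) = Suc x \<and> lab y \<le> lab x" if "i < cur y" for y i
    using sap that unfolding sap_inv_def by blast
  have "\<exists>x. me (A y ! i) = Suc x \<and> ?l y \<le> ?l x" if i: "i < cur y" for y i
  proof (cases "y \<in> ?Q")
    case True
    have "A y ! i \<in> set (A y)" using i cur[of y] by (intro nth_mem) simp
    from sc[OF True this] show ?thesis using True unfolding scanned_def by auto
  next
    case False
    obtain x where x: "me (A y ! i) = Suc x" "lab y \<le> lab x" using old[OF i] by blast
    then have "?l y \<le> ?l x" using False Qc(2)[of x] by auto
    then show ?thesis using x(1) by blast
  qed
  moreover have "?l y \<le> i" if "free_walk A me i y" for y i
    using no that sap unfolding sap_inv_def by auto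
  moreover have "?l y = 0 \<and> cur y = 0" if "y \<ge> Suc c" for y
  proof -
    have "y \<notin> ?Q" using Qc(1)[of y] that by fastforce
    then show ?thesis using sap that unfolding sap_inv_def by auto
  qed
  moreover have "matching_arrays A (Suc c) ma me" using sap unfolding sap_inv_def by blast
  ultimately show "sap_inv A (Suc c) ma me ?l cur" using cur unfolding sap_inv_def by blast
qed

subsection \<open>Total correctness with running time\<close>

definition fits_word :: "nat \<Rightarrow> state \<Rightarrow> bool" where
  "fits_word w \<sigma> \<longleftrightarrow> (\<forall>x. regs \<sigma> x < 2 ^ w) \<and> (\<forall>a i. arrs \<sigma> a i < 2 ^ w)"

text \<open>The overflow conditions that remain for a memory that fits: those of constants and of the
  operations that can exceed their arguments.\<close>

fun asafe :: "nat \<Rightarrow> aexp \<Rightarrow> state \<Rightarrow> bool" where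
  "asafe w (Const k) \<sigma> \<longleftrightarrow> k < 2 ^ w"
| "asafe w (Reg x) \<sigma> \<longleftrightarrow> True"
| "asafe w (Load a e) \<sigma> \<longleftrightarrow> asafe w e \<sigma>"
| "asafe w (BinOp f e e') \<sigma> \<longleftrightarrow>
     asafe w e \<sigma> \<and> asafe w e' \<sigma> \<and> (f = Add \<or> f = Mul \<longrightarrow> aval (BinOp f e e') \<sigma> < 2 ^ w)"

fun bsafe :: "nat \<Rightarrow> bexp \<Rightarrow> state \<Rightarrow> bool" where
  "bsafe w (Less e e') \<sigma> \<longleftrightarrow> asafe w e \<sigma> \<and> asafe w e' \<sigma>"
| "bsafe w (Equal e e') \<sigma> \<longleftrightarrow> asafe w e \<sigma> \<and> asafe w e' \<sigma>"
| "bsafe w (Neg b) \<sigma> \<longleftrightarrow> bsafe w b \<sigma>"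
| "bsafe w (Conj b b') \<sigma> \<longleftrightarrow> bsafe w b \<sigma> \<and> bsafe w b' \<sigma>"

lemma afits_aval: "afits w e \<sigma> \<Longrightarrow> aval e \<sigma> < 2 ^ w"
  by (cases e) auto

lemma asafe_afits: "fits_word w \<sigma> \<Longrightarrow> asafe w e \<sigma> \<Longrightarrow> afits w e \<sigma>"
proof (induction e)
  case (BinOp f e e')
  then have "aval e \<sigma> < 2 ^ w" using afits_aval by auto
  then show ?case using BinOp
    by (cases f) (auto intro: le_less_trans[OF diff_le_self] le_less_trans[OF div_le_dividend]
        le_less_trans[OF mod_less_eq_dividend])
qed (auto simp: fits_word_def)

lemma bsafe_bfits: "fits_word w \<sigma> \<Longrightarrow> bsafe w b \<sigma> \<Longrightarrow> bfits w b \<sigma>"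
  by (induction b) (auto intro: asafe_afits)

lemma exec_fits_word: "exec w P \<sigma> t \<sigma>' \<Longrightarrow> fits_word w \<sigma> \<Longrightarrow> fits_word w \<sigma>'"
  by (induction rule: exec.induct) (auto simp: fits_word_def dest: afits_aval)

text \<open>Total correctness with the running time as an argument of the postcondition. That the
  memory fits into words is a premise inside, preserved by execution, so loop invariants do not
  carry it.\<close>

definition wp :: "nat \<Rightarrow> com \<Rightarrow> (nat \<Rightarrow> state \<Rightarrow> bool) \<Rightarrow> state \<Rightarrow> bool" where
  "wp w P Q \<sigma> \<longleftrightarrow> (fits_word w \<sigma> \<longrightarrow> (\<exists>t \<sigma>'. exec w P \<sigma> t \<sigma>' \<and> Q t \<sigma>'))"

lemma wp_mono: "wp w P Q \<sigma> \<Longrightarrow> (\<And>t \<sigma>'. Q t \<sigma>' \<Longrightarrow> Q' t \<sigma>') \<Longrightarrow> wp w P Q' \<sigma>"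
  unfolding wp_def by blast

text \<open>Allows the potential to depend on a bound \<open>K\<close> for the register \<open>cap\<close> that is
  only known at the end of the whole run.\<close>

lemma wp_all:
  assumes "\<And>k. wp w P (Q k) \<sigma>"
  shows "wp w P (\<lambda>t \<sigma>'. \<forall>k. Q k t \<sigma>') \<sigma>"
  using assms exec_deterministic unfolding wp_def by metis

lemma wp_Seq: "wp w P (\<lambda>t. wp w R (\<lambda>t'. Q (t + t'))) \<sigma> \<Longrightarrow> wp w (Seq P R) Q \<sigma>"
  unfolding wp_def by (meson exec.Seq exec_fits_word)

text \<open>\<open>I k \<sigma>\<close> is the invariant with accumulated potential \<open>k\<close>; the potential pays for the time and its
  bound \<open>F\<close> gives termination.\<close>

lemma wp_While:
  assumes "I k \<sigma>" and bound: "\<And>k \<sigma>. I k \<sigma> \<Longrightarrow> k \<le> F" and safe: "\<And>k \<sigma>. I k \<sigma> \<Longrightarrow> bsafe w b \<sigma>"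
    and step: "\<And>k \<sigma>. I k \<sigma> \<Longrightarrow> bval b \<sigma> \<Longrightarrow>
      wp w P (\<lambda>t \<sigma>'. \<exists>k'. I k' \<sigma>' \<and> k + t + 1 + bcost b \<le> k') \<sigma>"
  shows "wp w (While b P) (\<lambda>t \<sigma>'. \<exists>k'. I k' \<sigma>' \<and> \<not> bval b \<sigma>' \<and> k + t \<le> k' + 1 + bcost b) \<sigma>"
  using assms(1)
proof (induction "F - k" arbitrary: k \<sigma> rule: less_induct)
  case less
  show ?case
    unfolding wp_def
  proof
    assume f: "fits_word w \<sigma>"
    have bf: "bfits w b \<sigma>" using f safe[OF less.prems] by (rule bsafe_bfits)
    show "\<exists>t \<sigma>'. exec w (While b P) \<sigma> t \<sigma>' \<and>
        (\<exists>k'. I k' \<sigma>' \<and> \<not> bval b \<sigma>' \<and> k + t \<le> k' + 1 + bcost b)"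
    proof (cases "bval b \<sigma>")
      case False
      have "I k \<sigma> \<and> \<not> bval b \<sigma> \<and> k + (1 + bcost b) \<le> k + 1 + bcost b" using less.prems False by simp
      then show ?thesis using exec.WhileFalse[OF bf False, of P] by blast
    next
      case True
      obtain t \<sigma>1 k1 where 1: "exec w P \<sigma> t \<sigma>1" "I k1 \<sigma>1" "k + t + 1 + bcost b \<le> k1"
        using step[OF less.prems True] f unfolding wp_def by blast
      have "F - k1 < F - k" using 1(3) bound[OF 1(2)] by linarith
      from less.hyps[OF this 1(2)] exec_fits_word[OF 1(1) f]
      obtain t' \<sigma>' k' where 2: "exec w (While b P) \<sigma>1 t' \<sigma>'" "I k' \<sigma>'" "\<not> bval b \<sigma>'"
        "k1 + t' \<le> k' + 1 + bcost b" unfolding wp_def by blast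
      have "k + (1 + bcost b + t + t') \<le> k' + 1 + bcost b" using 1(3) 2(4) by linarith
      then show ?thesis using exec.WhileTrue[OF bf True 1(1) 2(1)] 2(2,3) by blast
    qed
  qed
qed

text \<open>A form that simplification can evaluate, costs included, for straight-line code and
  branches; loops remain as \<open>wp\<close> goals.\<close>

fun vc :: "nat \<Rightarrow> com \<Rightarrow> (nat \<Rightarrow> state \<Rightarrow> bool) \<Rightarrow> state \<Rightarrow> bool" where
  "vc w Skip Q \<sigma> \<longleftrightarrow> Q 1 \<sigma>"
| "vc w (Assign x e) Q \<sigma> \<longleftrightarrow>
     asafe w e \<sigma> \<and> Q (1 + acost e) (\<sigma>\<lparr>regs := (regs \<sigma>)(x := aval e \<sigma>)\<rparr>)"
| "vc w (Store a i e) Q \<sigma> \<longleftrightarrow>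
     asafe w i \<sigma> \<and> asafe w e \<sigma> \<and>
     Q (1 + acost i + acost e) (\<sigma>\<lparr>arrs := (arrs \<sigma>)(a := (arrs \<sigma> a)(aval i \<sigma> := aval e \<sigma>))\<rparr>)"
| "vc w (Seq P R) Q \<sigma> \<longleftrightarrow> vc w P (\<lambda>t. vc w R (\<lambda>t'. Q (t + t'))) \<sigma>"
| "vc w (Cond b P R) Q \<sigma> \<longleftrightarrow>
     bsafe w b \<sigma> \<and>
     (if bval b \<sigma> then vc w P (\<lambda>t. Q (1 + bcost b + t)) \<sigma> else vc w R (\<lambda>t. Q (1 + bcost b + t)) \<sigma>)"
| "vc w (While b P) Q \<sigma> \<longleftrightarrow> wp w (While b P) Q \<sigma>"

lemma vc_wp: "vc w P Q \<sigma> \<Longrightarrow> wp w P Q \<sigma>"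
proof (induction P arbitrary: Q \<sigma>)
  case Skip
  then show ?case unfolding wp_def using exec.Skip by (metis vc.simps(1))
next
  case (Assign x e)
  then show ?case unfolding wp_def by (metis vc.simps(2) exec.Assign asafe_afits)
next
  case (Store a i e)
  then show ?case unfolding wp_def by (metis vc.simps(3) exec.Store asafe_afits)
next
  case (Seq P R)
  have "wp w P (\<lambda>t. vc w R (\<lambda>t'. Q (t + t'))) \<sigma>" using Seq.prems by (intro Seq.IH(1)) simp
  then show ?case by (intro wp_Seq) (rule wp_mono, assumption, rule Seq.IH(2))
next
  case (Cond b P R)
  show ?case unfolding wp_def
  proof
    assume f: "fits_word w \<sigma>"
    have bf: "bfits w b \<sigma>" using f Cond.prems by (auto intro: bsafe_bfits)
    show "\<exists>t \<sigma>'. exec w (Cond b P R) \<sigma> t \<sigma>' \<and> Q t \<sigma>'"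
    proof (cases "bval b \<sigma>")
      case True
      then have "wp w P (\<lambda>t. Q (1 + bcost b + t)) \<sigma>" using Cond by simp
      then show ?thesis using f bf True exec.CondTrue unfolding wp_def by blast
    next
      case False
      then have "wp w R (\<lambda>t. Q (1 + bcost b + t)) \<sigma>" using Cond by simp
      then show ?thesis using f bf False exec.CondFalse unfolding wp_def by blast
    qed
  qed
qed simp

lemma wp_SeqI:
  "wp w P Q1 \<sigma> \<Longrightarrow> (\<And>t \<sigma>'. Q1 t \<sigma>' \<Longrightarrow> wp w R (\<lambda>t'. Q (t + t')) \<sigma>') \<Longrightarrow> wp w (Seq P R) Q \<sigma>"
  by (rule wp_Seq) (rule wp_mono)

text \<open>Allows the first two pieces of the program, which have a joint specification, to be
  treated as one command at the same cost.\<close>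

lemma exec_Seq_assoc: "exec w (Seq (Seq P Q) R) \<sigma> t \<sigma>' \<Longrightarrow> exec w (Seq P (Seq Q R)) \<sigma> t \<sigma>'"
proof (elim exec_SeqE)
  fix t1 \<sigma>1 t2 t3 \<sigma>2 t4
  assume "exec w P \<sigma> t3 \<sigma>2" "exec w Q \<sigma>2 t4 \<sigma>1" "exec w R \<sigma>1 t2 \<sigma>'" "t1 = t3 + t4" "t = t1 + t2"
  then show ?thesis using exec.Seq[of w P \<sigma> t3 \<sigma>2 "Seq Q R" "t4 + t2" \<sigma>'] exec.Seq[of w Q \<sigma>2 t4 \<sigma>1 R t2 \<sigma>'] by (simp add: add.assoc)
qed

lemma wp_Seq_assoc: "wp w (Seq (Seq P R) R') Q \<sigma> \<Longrightarrow> wp w (Seq P (Seq R R')) Q \<sigma>"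
  unfolding wp_def using exec_Seq_assoc by blast

subsection \<open>The program\<close>

abbreviation incr :: "string \<Rightarrow> com" where
  "incr x \<equiv> Assign x (BinOp Add (Reg x) (Const 1))"

abbreviation block :: "com list \<Rightarrow> com" where
  "block cs \<equiv> foldr Seq cs Skip"

definition copy_body :: com where
  "copy_body = block
     [Store ''adj'' (Reg ''tot'') (Load ''neighbours'' (Reg ''k'')), incr ''tot'', incr ''k'']"

definition dfs_body :: com where
  "dfs_body =
     Cond (Less (Load ''cur'' (Reg ''u'')) (Load ''deg'' (Reg ''u'')))
       (block
         [Assign ''v'' (Load ''adj'' (BinOp Add (Load ''start'' (Reg ''u'')) (Load ''cur'' (Reg ''u'')))),
          Assign ''x'' (Load ''mate'' (Reg ''v'')),
          Cond (Equal (Reg ''x'') (Const 0))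
            (Assign ''found'' (BinOp Add (Reg ''v'') (Const 1)))
            (block
              [Assign ''x'' (BinOp Sub (Reg ''x'') (Const 1)),
               Cond (Less (Load ''lab'' (Reg ''x'')) (Load ''lab'' (Reg ''u'')))
                 (block [Store ''par'' (Reg ''x'') (Reg ''u''), Assign ''u'' (Reg ''x'')])
                 (Store ''cur'' (Reg ''u'') (BinOp Add (Load ''cur'' (Reg ''u'')) (Const 1)))])])
       (block
         [Store ''lab'' (Reg ''u'') (BinOp Add (Load ''lab'' (Reg ''u'')) (Const 1)),
          Store ''cur'' (Reg ''u'') (Const 0),
          Assign ''u'' (Load ''par'' (Reg ''u''))])"

text \<open>A label equal to \<open>cap\<close> is still processed, so the label of the new client
  can end at \<open>cap + 1\<close>. The last test stops at \<open>s\<close>, where the client is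
  known to be unreachable.\<close>

definition dfs_guard :: bexp where
  "dfs_guard = Conj (Equal (Reg ''found'') (Const 0))
     (Conj (Neg (Less (Reg ''cap'') (Load ''lab'' (Reg ''cnt''))))
       (Less (Load ''lab'' (Reg ''cnt'')) (Reg ''servers'')))"

definition bfs_start :: com where
  "bfs_start = block
     [Store ''queue'' (Const 0) (Reg ''cnt''),
      Store ''seen'' (Reg ''cnt'') (BinOp Add (Reg ''cnt'') (Const 1)),
      Assign ''qh'' (Const 0), Assign ''qt'' (Const 1), Assign ''u'' (Reg ''cnt''), Assign ''p'' (Const 0)]"

definition bfs_body :: com where
  "bfs_body =
     Cond (Less (Reg ''p'') (Load ''deg'' (Reg ''u'')))
       (block
         [Assign ''v'' (Load ''adj'' (BinOp Add (Load ''start'' (Reg ''u'')) (Reg ''p''))),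
          Assign ''x'' (Load ''mate'' (Reg ''v'')),
          Cond (Equal (Reg ''x'') (Const 0))
            (Assign ''found'' (BinOp Add (Reg ''v'') (Const 1)))
            (block
              [Assign ''x'' (BinOp Sub (Reg ''x'') (Const 1)),
               Cond (Conj (Neg (Equal (Load ''seen'' (Reg ''x'')) (BinOp Add (Reg ''cnt'') (Const 1))))
                      (Less (Load ''lab'' (Reg ''x'')) (Reg ''servers'')))
                 (block
                   [Store ''par'' (Reg ''x'') (Reg ''u''),
                    Store ''seen'' (Reg ''x'') (BinOp Add (Reg ''cnt'') (Const 1)),
                    Store ''queue'' (Reg ''qt'') (Reg ''x''),
                    incr ''qt''])
                 Skip,
               incr ''p''])])
       (block
         [incr ''qh'', Assign ''u'' (Load ''queue'' (Reg ''qh'')), Assign ''p'' (Const 0)])"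

definition bfs_guard :: bexp where
  "bfs_guard = Conj (Equal (Reg ''found'') (Const 0)) (Less (Reg ''qh'') (Reg ''qt''))"

definition kill_body :: com where
  "kill_body = block
     [Store ''lab'' (Load ''queue'' (Reg ''k'')) (Reg ''servers''), incr ''k'']"

text \<open>\<open>found\<close> holds the server to be assigned, increased by one, and takes over
  the old partner of \<open>u\<close> for the next round. The new client has no old partner, so
  \<open>found\<close> is \<open>0\<close> exactly after its round. \<open>k\<close> is the distance
  of \<open>u\<close>.\<close>

definition flip_body :: com where
  "flip_body = block
     [Assign ''x'' (Load ''match'' (Reg ''u'')),
      Store ''match'' (Reg ''u'') (Reg ''found''),
      Store ''mate'' (BinOp Sub (Reg ''found'') (Const 1)) (BinOp Add (Reg ''u'') (Const 1)),
      Cond (Less (Load ''lab'' (Reg ''u'')) (Reg ''k''))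
        (block [Store ''lab'' (Reg ''u'') (Reg ''k''), Store ''cur'' (Reg ''u'') (Const 0)])
        Skip,
      incr ''k'',
      Assign ''found'' (Reg ''x''),
      Assign ''u'' (Load ''par'' (Reg ''u''))]"

definition sap_prepare :: com where
  "sap_prepare = block
     [Store ''start'' (Reg ''cnt'') (Reg ''tot''),
      Store ''deg'' (Reg ''cnt'') (Reg ''degree''),
      Store ''par'' (Reg ''cnt'') (Reg ''cnt''),
      Assign ''u'' (Reg ''cnt''), Assign ''found'' (Const 0), Assign ''k'' (Const 0)]"

definition sap_bfs :: com where
  "sap_bfs =
     Cond (Conj (Equal (Reg ''found'') (Const 0)) (Less (Load ''lab'' (Reg ''cnt'')) (Reg ''servers'')))
       (Seq bfs_start (Seq (While bfs_guard bfs_body)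
         (Cond (Equal (Reg ''found'') (Const 0))
           (Seq (Assign ''k'' (Const 0)) (While (Less (Reg ''k'') (Reg ''qt'')) kill_body))
           (incr ''cap''))))
       Skip"

text \<open>\<open>cap\<close> counts the successful breadth-first searches and is at the same time the largest label up to which
  the depth-first search works.\<close>

definition sap_program :: com where
  "sap_program =
     Seq sap_prepare (Seq (While (Less (Reg ''k'') (Reg ''degree'')) copy_body)
       (Seq (While dfs_guard dfs_body) (Seq sap_bfs
         (Seq (Assign ''k'' (Const 0)) (Seq (While (Neg (Equal (Reg ''found'') (Const 0))) flip_body)
           (incr ''cnt''))))))"

subsection \<open>The loops\<close>

text \<open>The adjacency lists lie one after the other in a single array. The arguments are
  components of the memory instead of the memory, so assignments elsewhere leave the invariant
  literally unchanged.\<close>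

definition adj_inv ::
  "(nat \<Rightarrow> nat list) \<Rightarrow> nat \<Rightarrow> nat \<Rightarrow> nat \<Rightarrow> nat \<Rightarrow> (nat \<Rightarrow> nat) \<Rightarrow> (nat \<Rightarrow> nat) \<Rightarrow> (nat \<Rightarrow> nat) \<Rightarrow> bool" where
  "adj_inv A s N sv tot dg st ad \<longleftrightarrow>
     sv = s \<and> tot = (\<Sum>u<N. length (A u)) \<and>
     (\<forall>u<N. dg u = length (A u) \<and> st u + length (A u) \<le> tot \<and> (\<forall>k<length (A u). ad (st u + k) = A u ! k))"

abbreviation adj_state :: "(nat \<Rightarrow> nat list) \<Rightarrow> nat \<Rightarrow> nat \<Rightarrow> state \<Rightarrow> bool" where
  "adj_state A s N \<sigma> \<equiv> adj_inv A s N (regs \<sigma> ''servers'') (regs \<sigma> ''tot'')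
     (arrs \<sigma> ''deg'') (arrs \<sigma> ''start'') (arrs \<sigma> ''adj'')"

locale sap_run =
  fixes A :: "nat \<Rightarrow> nat list" and s n m w :: nat
  assumes servers: "u < n \<Longrightarrow> set (A u) \<subseteq> {..<s}"
    and edges: "(\<Sum>u<n. length (A u)) = m"
    and word: "s + n + m + 2 \<le> 2 ^ w"
begin

lemma sum_length_le: "N \<le> n \<Longrightarrow> (\<Sum>u<N. length (A u)) \<le> m"
  unfolding edges[symmetric] by (intro sum_mono2) auto

lemma length_le: "u < n \<Longrightarrow> length (A u) \<le> m"
  unfolding edges[symmetric] by (intro member_le_sum) auto

lemma one_safe: "Suc 0 < 2 ^ w" using word by linarith

lemma sum_Suc_length_le: "N \<le> n \<Longrightarrow> (\<Sum>u<N. length (A u) + 1) \<le> m + n"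
  using sum_length_le[of N] sum.distrib[of "\<lambda>u. length (A u)" "\<lambda>_. 1" "{..<N}"] by simp

lemma adj_stateD:
  assumes "adj_state A s (Suc c) \<sigma>" and "u < Suc c" and "c < n"
  shows "arrs \<sigma> ''deg'' u = length (A u)" and "arrs \<sigma> ''start'' u + length (A u) \<le> m"
    and "i < length (A u) \<Longrightarrow> arrs \<sigma> ''adj'' (arrs \<sigma> ''start'' u + i) = A u ! i"
  using assms sum_length_le[of "Suc c"] unfolding adj_inv_def by (auto simp del: sum.lessThan_Suc)

text \<open>The potential counts rounds. An advance raises the depth \<open>k\<close>, a skipped arc
  raises the scan potential, and a retreat raises the latter while it may lower \<open>k\<close>;
  the factor 2 leaves a gain of at least one. The last summand pays for the round that finds a
  server. A round with its test costs at most 80.\<close>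

definition dfs_loop_inv ::
  "nat \<Rightarrow> nat \<Rightarrow> nat \<Rightarrow> (nat \<Rightarrow> nat) \<Rightarrow> (nat \<Rightarrow> nat) \<Rightarrow> (nat \<Rightarrow> nat) \<Rightarrow> nat \<Rightarrow> state \<Rightarrow> bool" where
  "dfs_loop_inv K c B ma me lab0 pot \<sigma> \<longleftrightarrow>
     adj_state A s (Suc c) \<sigma> \<and> regs \<sigma> ''cnt'' = c \<and> regs \<sigma> ''cap'' = B \<and>
     arrs \<sigma> ''match'' = ma \<and> arrs \<sigma> ''mate'' = me \<and> (\<forall>x. arrs \<sigma> ''seen'' x \<le> c) \<and>
     arrs \<sigma> ''lab'' c \<le> Suc B \<and> (\<forall>x. lab0 x \<le> arrs \<sigma> ''lab'' x) \<and>
     (\<exists>k. dfs_inv A c ma me (arrs \<sigma> ''lab'') (arrs \<sigma> ''cur'') (arrs \<sigma> ''par'') (regs \<sigma> ''u'') (regs \<sigma> ''found'') k \<and>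
       pot = 80 * (2 * scan_pot A K (Suc c) (arrs \<sigma> ''lab'') (arrs \<sigma> ''cur'') + k +
         (if regs \<sigma> ''found'' = 0 then 0 else 1)))"

lemma dfs_loop_invI:
  assumes "adj_state A s (Suc c) \<sigma>" and "regs \<sigma> ''cnt'' = c" and "regs \<sigma> ''cap'' = B"
    and "arrs \<sigma> ''match'' = ma" and "arrs \<sigma> ''mate'' = me" and "\<forall>x. arrs \<sigma> ''seen'' x \<le> c"
    and "arrs \<sigma> ''lab'' c \<le> Suc B" and "\<forall>x. lab0 x \<le> arrs \<sigma> ''lab'' x"
    and "dfs_inv A c ma me (arrs \<sigma> ''lab'') (arrs \<sigma> ''cur'') (arrs \<sigma> ''par'') (regs \<sigma> ''u'') (regs \<sigma> ''found'') k"
    and "pot = 80 * (2 * scan_pot A K (Suc c) (arrs \<sigma> ''lab'') (arrs \<sigma> ''cur'') + k +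
      (if regs \<sigma> ''found'' = 0 then 0 else 1))"
  shows "dfs_loop_inv K c B ma me lab0 pot \<sigma>"
  using assms unfolding dfs_loop_inv_def by blast

lemma dfs_body_step:
  assumes inv: "dfs_loop_inv K c B ma me lab0 pot \<sigma>" and g: "bval dfs_guard \<sigma>" and c: "c < n" and K: "B < K"
  shows "wp w dfs_body (\<lambda>t \<sigma>'. \<exists>pot'. dfs_loop_inv K c B ma me lab0 pot' \<sigma>' \<and> pot + t + 1 + bcost dfs_guard \<le> pot') \<sigma>"
proof -
  let ?lab = "arrs \<sigma> ''lab''" and ?cur = "arrs \<sigma> ''cur''" and ?par = "arrs \<sigma> ''par''" and ?u = "regs \<sigma> ''u''"
  have st: "adj_state A s (Suc c) \<sigma>" and cnt: "regs \<sigma> ''cnt'' = c" and cap: "regs \<sigma> ''cap'' = B"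
    and ma: "arrs \<sigma> ''match'' = ma" and me: "arrs \<sigma> ''mate'' = me" and seen: "\<forall>x. arrs \<sigma> ''seen'' x \<le> c"
    and lab0: "\<forall>x. lab0 x \<le> ?lab x"
    using inv unfolding dfs_loop_inv_def by blast+
  have guard: "regs \<sigma> ''found'' = 0" "?lab c \<le> B" "?lab c < s"
    using g cnt cap st unfolding dfs_guard_def adj_inv_def by auto
  obtain k where dfs: "dfs_inv A c ma me ?lab ?cur ?par ?u 0 k"
    and pot: "pot = 80 * (2 * scan_pot A K (Suc c) ?lab ?cur + k)"
    using inv guard(1) unfolding dfs_loop_inv_def by auto
  have uc: "?u \<le> c" by (rule dfs_inv_le[OF dfs])
  have un: "?u < n" using uc c by simp
  have labu: "?lab ?u \<le> ?lab c" using dfs_inv_lab[OF dfs] by simp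
  have dg: "arrs \<sigma> ''deg'' ?u = length (A ?u)" and st_le: "arrs \<sigma> ''start'' ?u + length (A ?u) \<le> m"
    and ad: "i < length (A ?u) \<Longrightarrow> arrs \<sigma> ''adj'' (arrs \<sigma> ''start'' ?u + i) = A ?u ! i" for i
    using adj_stateD[OF st _ c] uc by (auto simp: le_imp_less_Suc)
  have cur_le: "?cur ?u \<le> length (A ?u)" using dfs unfolding dfs_inv_def sap_inv_def by blast
  have bc: "bcost dfs_guard \<le> 20" by (simp add: dfs_guard_def)
  have small: "a \<le> m \<Longrightarrow> a < 2 ^ w" "a < s \<Longrightarrow> Suc a < 2 ^ w" "a < m \<Longrightarrow> Suc a < 2 ^ w" for a
    using word by linarith+
  have fin: ?thesis
    if "wp w dfs_body (\<lambda>t \<sigma>'. dfs_loop_inv K c B ma me lab0 P \<sigma>' \<and> t \<le> 55) \<sigma>" "pot + 80 \<le> P" for P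
    by (rule wp_mono[OF that(1)]) (use that(2) bc in \<open>auto intro!: exI[of _ P]\<close>)
  have labc: "?lab c \<le> Suc B" using guard(2) by simp
  note vals = dg ad me cnt cap ma one_safe st seen guard labc lab0
  show ?thesis
  proof (cases "?cur ?u < length (A ?u)")
    case cur: True
    have v: "A ?u ! ?cur ?u < s" using servers[OF un] nth_mem[OF cur] by auto
    have idx: "arrs \<sigma> ''start'' ?u + ?cur ?u < 2 ^ w" using cur st_le by (intro small) simp
    have sv: "Suc (A ?u ! ?cur ?u) < 2 ^ w" using v by (rule small)
    have scur: "Suc (?cur ?u) < 2 ^ w" using cur length_le[OF un] by (intro small) simp
    show ?thesis
    proof (cases "me (A ?u ! ?cur ?u)")
      case 0
      have new: "dfs_inv A c ma me ?lab ?cur ?par ?u (Suc (A ?u ! ?cur ?u)) k"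
        by (rule dfs_inv_found[OF dfs cur 0])
      show ?thesis
        by (rule fin[where P = "pot + 80"], rule vc_wp,
            simp add: dfs_body_def cur vals 0 idx sv, rule dfs_loop_invI[where k = k])
          (use new guard in \<open>simp_all add: vals pot\<close>)
    next
      case (Suc x)
      show ?thesis
      proof (cases "?lab x < ?lab ?u")
        case True
        have new: "dfs_inv A c ma me ?lab ?cur (?par(x := ?u)) x 0 (Suc k)"
          by (rule dfs_inv_advance[OF dfs cur Suc True])
        show ?thesis
          by (rule fin[where P = "pot + 80"], rule vc_wp,
              simp add: dfs_body_def cur vals Suc True idx, rule dfs_loop_invI[where k = "Suc k"])
            (use new guard in \<open>simp_all add: vals pot\<close>)
      next
        case False
        have new: "dfs_inv A c ma me ?lab (?cur(?u := Suc (?cur ?u))) ?par ?u 0 k"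
          by (rule dfs_inv_next[OF dfs cur Suc False])
        have sp: "scan_pot A K (Suc c) ?lab (?cur(?u := Suc (?cur ?u))) = scan_pot A K (Suc c) ?lab ?cur + 1"
          using uc labu guard K by (intro scan_pot_next) auto
        show ?thesis
          by (rule fin[where P = "pot + 160"], rule vc_wp,
              simp add: dfs_body_def cur vals Suc False idx scur, rule dfs_loop_invI[where k = k])
            (use new guard in \<open>simp_all add: vals pot sp\<close>)
      qed
    qed
  next
    case False
    have slab: "Suc (?lab ?u) < 2 ^ w" using labu guard by (intro small) simp
    have new: "dfs_inv A c ma me (?lab(?u := Suc (?lab ?u))) (?cur(?u := 0)) ?par (?par ?u) 0 (k - 1)"
      by (rule dfs_inv_relabel[OF dfs False])
    have sp: "scan_pot A K (Suc c) (?lab(?u := Suc (?lab ?u))) (?cur(?u := 0)) = scan_pot A K (Suc c) ?lab ?cur + 1"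
      using uc labu guard K False cur_le by (intro scan_pot_relabel) auto
    have zero: "(0 :: nat) < 2 ^ w" by simp
    have labB: "?lab ?u \<le> B" using labu guard(2) by simp
    show ?thesis
      by (rule fin[where P = "80 * (2 * scan_pot A K (Suc c) ?lab ?cur + 2 + (k - 1))"], rule vc_wp,
          simp add: dfs_body_def False vals slab zero, rule dfs_loop_invI[where k = "k - 1"])
        (use new labu in \<open>simp_all add: vals labB pot sp le_SucI\<close>)
  qed
qed

lemma wp_dfs:
  assumes "dfs_loop_inv K c B ma me lab0 pot \<sigma>" and c: "c < n" and K: "B < K"
  shows "wp w (While dfs_guard dfs_body)
    (\<lambda>t \<sigma>'. \<exists>pot'. dfs_loop_inv K c B ma me lab0 pot' \<sigma>' \<and> \<not> bval dfs_guard \<sigma>' \<and> pot + t \<le> pot' + 20) \<sigma>"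
proof (rule wp_mono[OF wp_While[where I = "dfs_loop_inv K c B ma me lab0"
      and F = "80 * (2 * (K * (m + n)) + Suc B + 1)"]])
  show "dfs_loop_inv K c B ma me lab0 pot \<sigma>" by fact
next
  fix pot \<sigma> assume inv: "dfs_loop_inv K c B ma me lab0 pot \<sigma>"
  let ?lab = "arrs \<sigma> ''lab''" and ?cur = "arrs \<sigma> ''cur''"
  from inv obtain k where dfs: "dfs_inv A c ma me ?lab ?cur (arrs \<sigma> ''par'') (regs \<sigma> ''u'') (regs \<sigma> ''found'') k"
    and pot: "pot = 80 * (2 * scan_pot A K (Suc c) ?lab ?cur + k + (if regs \<sigma> ''found'' = 0 then 0 else 1))"
    and lab: "?lab c \<le> Suc B" unfolding dfs_loop_inv_def by blast
  have "scan_pot A K (Suc c) ?lab ?cur \<le> K * (\<Sum>u<Suc c. length (A u) + 1)"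
    using dfs unfolding dfs_inv_def sap_inv_def by (intro scan_pot_bound) blast
  also have "\<dots> \<le> K * (m + n)" using sum_Suc_length_le[of "Suc c"] c by (intro mult_left_mono) auto
  finally show "pot \<le> 80 * (2 * (K * (m + n)) + Suc B + 1)"
    using dfs_inv_lab[OF dfs] lab unfolding pot by auto
next
  fix pot \<sigma> assume "dfs_loop_inv K c B ma me lab0 pot \<sigma>"
  show "bsafe w dfs_guard \<sigma>" by (simp add: dfs_guard_def)
next
  fix pot \<sigma> assume "dfs_loop_inv K c B ma me lab0 pot \<sigma>" "bval dfs_guard \<sigma>"
  then show "wp w dfs_body (\<lambda>t \<sigma>'. \<exists>k'. dfs_loop_inv K c B ma me lab0 k' \<sigma>' \<and> pot + t + 1 + bcost dfs_guard \<le> k') \<sigma>"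
    by (rule dfs_body_step[OF _ _ c K])
next
  fix t \<sigma>'
  assume "\<exists>k'. dfs_loop_inv K c B ma me lab0 k' \<sigma>' \<and> \<not> bval dfs_guard \<sigma>' \<and> pot + t \<le> k' + 1 + bcost dfs_guard"
  then show "\<exists>pot'. dfs_loop_inv K c B ma me lab0 pot' \<sigma>' \<and> \<not> bval dfs_guard \<sigma>' \<and> pot + t \<le> pot' + 20"
    by (auto simp: dfs_guard_def)
qed

text \<open>\<open>bfs_inv\<close> does not constrain \<open>p\<close> once the queue is exhausted;
  the clause with \<open>p = 0\<close> bounds the potential in that case.\<close>

definition bfs_loop_inv ::
  "nat \<Rightarrow> nat \<Rightarrow> (nat \<Rightarrow> nat) \<Rightarrow> (nat \<Rightarrow> nat) \<Rightarrow> (nat \<Rightarrow> nat) \<Rightarrow> (nat \<Rightarrow> nat) \<Rightarrow> nat \<Rightarrow> state \<Rightarrow> bool" where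
  "bfs_loop_inv c B ma me lab cur pot \<sigma> \<longleftrightarrow>
     adj_state A s (Suc c) \<sigma> \<and> regs \<sigma> ''cnt'' = c \<and> regs \<sigma> ''cap'' = B \<and>
     arrs \<sigma> ''match'' = ma \<and> arrs \<sigma> ''mate'' = me \<and> arrs \<sigma> ''lab'' = lab \<and> arrs \<sigma> ''cur'' = cur \<and>
     (\<forall>x. arrs \<sigma> ''seen'' x \<le> Suc c) \<and> (regs \<sigma> ''qh'' < regs \<sigma> ''qt'' \<or> regs \<sigma> ''p'' = 0) \<and>
     (\<exists>d. bfs_inv A c s ma me lab (arrs \<sigma> ''par'') (arrs \<sigma> ''queue'') (arrs \<sigma> ''seen'') d
        (regs \<sigma> ''u'') (regs \<sigma> ''qh'') (regs \<sigma> ''qt'') (regs \<sigma> ''p'') (regs \<sigma> ''found'')) \<and>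
     pot = 80 * ((\<Sum>a<regs \<sigma> ''qh''. length (A (arrs \<sigma> ''queue'' a)) + 1) + regs \<sigma> ''p'' +
       (if regs \<sigma> ''found'' = 0 then 0 else 1))"

lemma bfs_loop_invI:
  assumes "adj_state A s (Suc c) \<sigma>" and "regs \<sigma> ''cnt'' = c" and "regs \<sigma> ''cap'' = B"
    and "arrs \<sigma> ''match'' = ma" and "arrs \<sigma> ''mate'' = me" and "arrs \<sigma> ''lab'' = lab" and "arrs \<sigma> ''cur'' = cur"
    and "\<forall>x. arrs \<sigma> ''seen'' x \<le> Suc c" and "regs \<sigma> ''qh'' < regs \<sigma> ''qt'' \<or> regs \<sigma> ''p'' = 0"
    and "bfs_inv A c s ma me lab (arrs \<sigma> ''par'') (arrs \<sigma> ''queue'') (arrs \<sigma> ''seen'') d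
        (regs \<sigma> ''u'') (regs \<sigma> ''qh'') (regs \<sigma> ''qt'') (regs \<sigma> ''p'') (regs \<sigma> ''found'')"
    and "pot = 80 * ((\<Sum>a<regs \<sigma> ''qh''. length (A (arrs \<sigma> ''queue'' a)) + 1) + regs \<sigma> ''p'' +
       (if regs \<sigma> ''found'' = 0 then 0 else 1))"
  shows "bfs_loop_inv c B ma me lab cur pot \<sigma>"
  using assms unfolding bfs_loop_inv_def by blast

lemma bfs_inv_queue:
  assumes "bfs_inv A c s ma me lab par q seen d u qh qt p fnd"
  shows "qt \<le> Suc c"
proof -
  have "card (q ` {..<qt}) = qt" using assms card_image unfolding bfs_inv_def by fastforce
  moreover have "q ` {..<qt} \<subseteq> {..c}" using assms unfolding bfs_inv_def by blast
  then have "card (q ` {..<qt}) \<le> card {..c}" by (intro card_mono) auto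
  ultimately show ?thesis by simp
qed

lemma bfs_body_step:
  assumes inv: "bfs_loop_inv c B ma me lab cur pot \<sigma>" and g: "bval bfs_guard \<sigma>" and c: "c < n"
    and sap: "sap_inv A (Suc c) ma me lab cur"
  shows "wp w bfs_body (\<lambda>t \<sigma>'. \<exists>pot'. bfs_loop_inv c B ma me lab cur pot' \<sigma>' \<and>
    pot + t + 1 + bcost bfs_guard \<le> pot') \<sigma>"
proof -
  let ?par = "arrs \<sigma> ''par''" and ?u = "regs \<sigma> ''u''" and ?q = "arrs \<sigma> ''queue''" and ?seen = "arrs \<sigma> ''seen''"
    and ?qh = "regs \<sigma> ''qh''" and ?qt = "regs \<sigma> ''qt''" and ?p = "regs \<sigma> ''p''"
  have st: "adj_state A s (Suc c) \<sigma>" and cnt: "regs \<sigma> ''cnt'' = c" and cap: "regs \<sigma> ''cap'' = B"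
    and ma: "arrs \<sigma> ''match'' = ma" and me: "arrs \<sigma> ''mate'' = me" and lab: "arrs \<sigma> ''lab'' = lab"
    and cur: "arrs \<sigma> ''cur'' = cur" and seen: "\<forall>x. ?seen x \<le> Suc c"
    using inv unfolding bfs_loop_inv_def by blast+
  have guard: "regs \<sigma> ''found'' = 0" "?qh < ?qt" using g unfolding bfs_guard_def by auto
  obtain d where bfs: "bfs_inv A c s ma me lab ?par ?q ?seen d ?u ?qh ?qt ?p 0"
    and pot: "pot = 80 * ((\<Sum>a<?qh. length (A (?q a)) + 1) + ?p)"
    using inv guard(1) unfolding bfs_loop_inv_def by auto
  have m: "matching_arrays A (Suc c) ma me" using sap unfolding sap_inv_def by blast
  have u: "?u = ?q ?qh" "?u \<le> c" "?p \<le> length (A ?u)" using bfs guard(2) unfolding bfs_inv_def by auto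
  have un: "?u < n" using u(2) c by simp
  have sv: "regs \<sigma> ''servers'' = s" using st unfolding adj_inv_def by blast
  have dg: "arrs \<sigma> ''deg'' ?u = length (A ?u)" and st_le: "arrs \<sigma> ''start'' ?u + length (A ?u) \<le> m"
    and ad: "i < length (A ?u) \<Longrightarrow> arrs \<sigma> ''adj'' (arrs \<sigma> ''start'' ?u + i) = A ?u ! i" for i
    using adj_stateD[OF st _ c] u(2) by (auto simp: le_imp_less_Suc)
  have bc: "bcost bfs_guard \<le> 10" by (simp add: bfs_guard_def)
  have small: "a \<le> m \<Longrightarrow> a < 2 ^ w" "a < s \<Longrightarrow> Suc a < 2 ^ w" "a < m \<Longrightarrow> Suc a < 2 ^ w"
    "a \<le> n \<Longrightarrow> Suc a < 2 ^ w" for a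
    using word by linarith+
  have sqt: "Suc ?qt < 2 ^ w" and sqh: "Suc ?qh < 2 ^ w" and sc: "Suc c < 2 ^ w"
    using bfs_inv_queue[OF bfs] guard(2) c by (auto intro!: small(4))
  have fin: ?thesis
    if "wp w bfs_body (\<lambda>t \<sigma>'. bfs_loop_inv c B ma me lab cur (pot + 80) \<sigma>' \<and> t \<le> 65) \<sigma>"
    by (rule wp_mono[OF that(1)]) (use bc in \<open>auto intro!: exI[of _ "pot + 80"]\<close>)
  note vals = dg ad me cnt cap ma lab cur one_safe st[unfolded sv] seen guard sv sc sqt sqh
  show ?thesis
  proof (cases "?p < length (A ?u)")
    case p: True
    have v: "A ?u ! ?p < s" using servers[OF un] nth_mem[OF p] by auto
    have idx: "arrs \<sigma> ''start'' ?u + ?p < 2 ^ w" using p st_le by (intro small) simp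
    have sv: "Suc (A ?u ! ?p) < 2 ^ w" using v by (rule small)
    have sp: "Suc ?p < 2 ^ w" using p length_le[OF un] by (intro small) simp
    show ?thesis
    proof (cases "me (A ?u ! ?p)")
      case 0
      have new: "bfs_inv A c s ma me lab ?par ?q ?seen d ?u ?qh ?qt ?p (Suc (A ?u ! ?p))"
        by (rule bfs_inv_found[OF bfs guard(2) p 0])
      show ?thesis
        by (rule fin, rule vc_wp,
            simp add: bfs_body_def p vals 0 idx sv, rule bfs_loop_invI[where d = d])
          (use new guard in \<open>simp_all add: vals pot\<close>)
    next
      case (Suc x)
      show ?thesis
      proof (cases "?seen x \<noteq> Suc c \<and> lab x < s")
        case True
        have new: "bfs_inv A c s ma me lab (?par(x := ?u)) (?q(?qt := x)) (?seen(x := Suc c))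
            (d(x := Suc (d ?u))) ?u ?qh (Suc ?qt) (Suc ?p) 0"
          using bfs_inv_push[OF bfs guard(2) p m Suc] True by blast
        have sum: "(\<Sum>a<?qh. Suc (length (A (if a = ?qt then x else ?q a)))) = (\<Sum>a<?qh. Suc (length (A (?q a))))"
          using guard(2) by (intro sum.cong) auto
        show ?thesis
          by (rule fin, rule vc_wp, simp add: bfs_body_def p vals Suc True idx sp,
              rule bfs_loop_invI[where d = "d(x := Suc (d ?u))"])
            (use new guard sum in \<open>simp_all add: vals pot less_SucI\<close>)
      next
        case False
        have new: "bfs_inv A c s ma me lab ?par ?q ?seen d ?u ?qh ?qt (Suc ?p) 0"
          using bfs_inv_skip[OF bfs guard(2) p Suc] False by force
        show ?thesis
        proof (cases "?seen x = Suc c")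
          case True
          show ?thesis
            by (rule fin, rule vc_wp, simp add: bfs_body_def p vals Suc idx sp True,
                rule bfs_loop_invI[where d = d])
              (use new guard in \<open>simp_all add: vals pot\<close>)
        next
          case seen: False
          have dead: "\<not> lab x < s" using False seen by simp
          show ?thesis
            by (rule fin, rule vc_wp, simp add: bfs_body_def p vals Suc idx sp dead,
                rule bfs_loop_invI[where d = d])
              (use new guard in \<open>simp_all add: vals pot\<close>)
        qed
      qed
    qed
  next
    case False
    have new: "bfs_inv A c s ma me lab ?par ?q ?seen d (?q (Suc ?qh)) (Suc ?qh) ?qt 0 0"
      by (rule bfs_inv_next[OF bfs guard(2) False])
    have p: "?p = length (A (?q ?qh))" using False u by simp
    show ?thesis
      by (rule fin, rule vc_wp, simp add: bfs_body_def False vals, rule bfs_loop_invI[where d = d])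
        (use new guard p in \<open>simp_all add: vals pot\<close>)
  qed
qed

text \<open>No client is queued twice, so the work can be charged to the set of queued clients.
  After a failure this is precisely the set that dies.\<close>

lemma bfs_pot_le:
  assumes "bfs_inv A c s ma me lab par q seen d u qh qt p fnd" and "qh < qt \<or> p = 0"
  shows "(\<Sum>a<qh. length (A (q a)) + 1) + p \<le> (\<Sum>y\<in>q ` {..<qt}. length (A y) + 1)"
proof -
  have "(\<Sum>a<qh. length (A (q a)) + 1) + p \<le> (\<Sum>a<qt. length (A (q a)) + 1)"
  proof (cases "qh < qt")
    case True
    have "(\<Sum>a<qh. length (A (q a)) + 1) + p \<le> (\<Sum>a<Suc qh. length (A (q a)) + 1)"
      using assms(1) True unfolding bfs_inv_def by auto
    also have "\<dots> \<le> (\<Sum>a<qt. length (A (q a)) + 1)" using True by (intro sum_mono2) auto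
    finally show ?thesis .
  next
    case False
    then have "qh = qt" "p = 0" using assms unfolding bfs_inv_def by auto
    then show ?thesis by simp
  qed
  also have "\<dots> = (\<Sum>y\<in>q ` {..<qt}. length (A y) + 1)"
    using assms(1) unfolding bfs_inv_def by (subst sum.reindex) auto
  finally show ?thesis .
qed

lemma bfs_queue_weight:
  assumes "bfs_inv A c s ma me lab par q seen d u qh qt p fnd" and "c < n"
  shows "(\<Sum>y\<in>q ` {..<qt}. length (A y) + 1) \<le> m + n"
proof -
  have "q ` {..<qt} \<subseteq> {..<Suc c}" using assms(1) unfolding bfs_inv_def by (metis le_imp_less_Suc lessThan_iff subsetI)
  then have "(\<Sum>y\<in>q ` {..<qt}. length (A y) + 1) \<le> (\<Sum>u<Suc c. length (A u) + 1)" by (intro sum_mono2) auto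
  also have "\<dots> \<le> m + n" using assms(2) by (intro sum_Suc_length_le) simp
  finally show ?thesis .
qed

lemma wp_bfs:
  assumes "bfs_loop_inv c B ma me lab cur 0 \<sigma>" and c: "c < n" and sap: "sap_inv A (Suc c) ma me lab cur"
  shows "wp w (While bfs_guard bfs_body)
    (\<lambda>t \<sigma>'. \<exists>pot. bfs_loop_inv c B ma me lab cur pot \<sigma>' \<and> \<not> bval bfs_guard \<sigma>' \<and> t \<le> pot + 10) \<sigma>"
proof (rule wp_mono[OF wp_While[where I = "bfs_loop_inv c B ma me lab cur" and F = "80 * (m + n + 1)"]])
  show "bfs_loop_inv c B ma me lab cur 0 \<sigma>" by fact
next
  fix pot \<sigma> assume inv: "bfs_loop_inv c B ma me lab cur pot \<sigma>"
  then obtain d where bfs: "bfs_inv A c s ma me lab (arrs \<sigma> ''par'') (arrs \<sigma> ''queue'') (arrs \<sigma> ''seen'') d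
        (regs \<sigma> ''u'') (regs \<sigma> ''qh'') (regs \<sigma> ''qt'') (regs \<sigma> ''p'') (regs \<sigma> ''found'')"
    and p: "regs \<sigma> ''qh'' < regs \<sigma> ''qt'' \<or> regs \<sigma> ''p'' = 0"
    and pot: "pot = 80 * ((\<Sum>a<regs \<sigma> ''qh''. length (A (arrs \<sigma> ''queue'' a)) + 1) + regs \<sigma> ''p'' +
       (if regs \<sigma> ''found'' = 0 then 0 else 1))"
    unfolding bfs_loop_inv_def by blast
  show "pot \<le> 80 * (m + n + 1)" using bfs_pot_le[OF bfs p] bfs_queue_weight[OF bfs c] unfolding pot by auto
next
  fix pot \<sigma> assume "bfs_loop_inv c B ma me lab cur pot \<sigma>"
  show "bsafe w bfs_guard \<sigma>" by (simp add: bfs_guard_def)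
next
  fix pot \<sigma> assume "bfs_loop_inv c B ma me lab cur pot \<sigma>" "bval bfs_guard \<sigma>"
  then show "wp w bfs_body (\<lambda>t \<sigma>'. \<exists>k'. bfs_loop_inv c B ma me lab cur k' \<sigma>' \<and> pot + t + 1 + bcost bfs_guard \<le> k') \<sigma>"
    by (rule bfs_body_step[OF _ _ c sap])
next
  fix t \<sigma>'
  assume "\<exists>k'. bfs_loop_inv c B ma me lab cur k' \<sigma>' \<and> \<not> bval bfs_guard \<sigma>' \<and> 0 + t \<le> k' + 1 + bcost bfs_guard"
  then show "\<exists>pot. bfs_loop_inv c B ma me lab cur pot \<sigma>' \<and> \<not> bval bfs_guard \<sigma>' \<and> t \<le> pot + 10"
    by (auto simp: bfs_guard_def)
qed

section \<open>Loops with a known number of rounds\<close>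

lemma wp_counted_loop:
  assumes "I 0 \<sigma>" and "\<And>i \<sigma>. I i \<sigma> \<Longrightarrow> i \<le> F \<and> bsafe w b \<sigma> \<and> (bval b \<sigma> \<longleftrightarrow> i < F)"
    and "bcost b \<le> 10"
    and "\<And>i \<sigma>. I i \<sigma> \<Longrightarrow> i < F \<Longrightarrow> wp w P (\<lambda>t \<sigma>'. I (Suc i) \<sigma>' \<and> t \<le> 65) \<sigma>"
  shows "wp w (While b P) (\<lambda>t \<sigma>'. I F \<sigma>' \<and> t \<le> 80 * F + 11) \<sigma>"
proof (rule wp_mono[OF wp_While[where I = "\<lambda>pot \<sigma>. \<exists>i. pot = 80 * i \<and> I i \<sigma>" and F = "80 * F" and k = 0]])
  show "\<exists>i. 0 = 80 * i \<and> I i \<sigma>" using assms(1) by (intro exI[of _ 0]) auto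
next
  fix pot \<sigma> assume "\<exists>i. pot = 80 * i \<and> I i \<sigma>"
  then show "pot \<le> 80 * F" "bsafe w b \<sigma>" using assms(2) by auto
next
  fix pot \<sigma> assume "\<exists>i. pot = 80 * i \<and> I i \<sigma>" and b: "bval b \<sigma>"
  then obtain i where i: "pot = 80 * i" "I i \<sigma>" by blast
  then have "i < F" using b assms(2) by blast
  show "wp w P (\<lambda>t \<sigma>'. \<exists>k'. (\<exists>i. k' = 80 * i \<and> I i \<sigma>') \<and> pot + t + 1 + bcost b \<le> k') \<sigma>"
  proof (rule wp_mono[OF assms(4)[OF i(2) \<open>i < F\<close>]])
    fix t :: nat and \<sigma>' assume "I (Suc i) \<sigma>' \<and> t \<le> 65"
    then show "\<exists>k'. (\<exists>i. k' = 80 * i \<and> I i \<sigma>') \<and> pot + t + 1 + bcost b \<le> k'"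
      using i(1) assms(3) by (intro exI[of _ "80 * Suc i"] conjI exI[of _ "Suc i"]) auto
  qed
next
  fix t \<sigma>' assume "\<exists>k'. (\<exists>i. k' = 80 * i \<and> I i \<sigma>') \<and> \<not> bval b \<sigma>' \<and> 0 + t \<le> k' + 1 + bcost b"
  then obtain i where i: "I i \<sigma>'" "\<not> bval b \<sigma>'" "t \<le> 80 * i + 1 + bcost b" by auto
  then have "i = F" using assms(2)[OF i(1)] by auto
  then show "I F \<sigma>' \<and> t \<le> 80 * F + 11" using i assms(3) by auto
qed

lemma wp_kill:
  assumes "regs \<sigma> ''k'' = 0" and qt: "regs \<sigma> ''qt'' = qt" "qt \<le> n" and sv: "regs \<sigma> ''servers'' = s"
  shows "wp w (While (Less (Reg ''k'') (Reg ''qt'')) kill_body)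
    (\<lambda>t \<sigma>'. (\<forall>x. x \<noteq> ''k'' \<longrightarrow> regs \<sigma>' x = regs \<sigma> x) \<and>
      arrs \<sigma>' = (arrs \<sigma>)(''lab'' := \<lambda>y. if y \<in> arrs \<sigma> ''queue'' ` {..<qt} then s else arrs \<sigma> ''lab'' y) \<and>
      t \<le> 80 * qt + 11) \<sigma>"
proof -
  define I where "I i \<sigma>' \<longleftrightarrow> regs \<sigma>' ''k'' = i \<and> i \<le> qt \<and> (\<forall>x. x \<noteq> ''k'' \<longrightarrow> regs \<sigma>' x = regs \<sigma> x) \<and>
      arrs \<sigma>' = (arrs \<sigma>)(''lab'' := \<lambda>y. if y \<in> arrs \<sigma> ''queue'' ` {..<i} then s else arrs \<sigma> ''lab'' y)" for i and \<sigma>' :: state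
  have "wp w (While (Less (Reg ''k'') (Reg ''qt'')) kill_body) (\<lambda>t \<sigma>'. I qt \<sigma>' \<and> t \<le> 80 * qt + 11) \<sigma>"
  proof (rule wp_counted_loop)
    show "I 0 \<sigma>" using assms unfolding I_def by auto
  next
    fix i \<sigma>' assume "I i \<sigma>'"
    then show "i \<le> qt \<and> bsafe w (Less (Reg ''k'') (Reg ''qt'')) \<sigma>' \<and> (bval (Less (Reg ''k'') (Reg ''qt'')) \<sigma>' \<longleftrightarrow> i < qt)"
      using qt unfolding I_def by auto
  next
    fix i \<sigma>' assume I: "I i \<sigma>'" and i: "i < qt"
    have "Suc i < 2 ^ w" using i qt word by linarith
    then show "wp w kill_body (\<lambda>t \<sigma>'. I (Suc i) \<sigma>' \<and> t \<le> 65) \<sigma>'"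
      using I i sv one_safe
      by (intro vc_wp) (auto simp: kill_body_def I_def fun_eq_iff lessThan_Suc)
  qed simp
  then show ?thesis by (rule wp_mono) (simp add: I_def)
qed

lemma wp_copy:
  assumes "regs \<sigma> ''k'' = 0" and tot: "regs \<sigma> ''tot'' = T" and dg: "regs \<sigma> ''degree'' = length N"
    and nb: "\<And>k. k < length N \<Longrightarrow> arrs \<sigma> ''neighbours'' k = N ! k" and T: "T + length N \<le> m"
  shows "wp w (While (Less (Reg ''k'') (Reg ''degree'')) copy_body)
    (\<lambda>t \<sigma>'. (\<forall>x. x \<noteq> ''k'' \<longrightarrow> x \<noteq> ''tot'' \<longrightarrow> regs \<sigma>' x = regs \<sigma> x) \<and> regs \<sigma>' ''tot'' = T + length N \<and>
      (\<forall>a. a \<noteq> ''adj'' \<longrightarrow> arrs \<sigma>' a = arrs \<sigma> a) \<and>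
      (\<forall>j<T. arrs \<sigma>' ''adj'' j = arrs \<sigma> ''adj'' j) \<and> (\<forall>j<length N. arrs \<sigma>' ''adj'' (T + j) = N ! j) \<and>
      t \<le> 80 * length N + 11) \<sigma>"
proof -
  define I where "I i \<sigma>' \<longleftrightarrow> regs \<sigma>' ''k'' = i \<and> i \<le> length N \<and>
      (\<forall>x. x \<noteq> ''k'' \<longrightarrow> x \<noteq> ''tot'' \<longrightarrow> regs \<sigma>' x = regs \<sigma> x) \<and> regs \<sigma>' ''tot'' = T + i \<and>
      (\<forall>a. a \<noteq> ''adj'' \<longrightarrow> arrs \<sigma>' a = arrs \<sigma> a) \<and>
      (\<forall>j<T. arrs \<sigma>' ''adj'' j = arrs \<sigma> ''adj'' j) \<and> (\<forall>j<i. arrs \<sigma>' ''adj'' (T + j) = N ! j)" for i and \<sigma>' :: state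
  have "wp w (While (Less (Reg ''k'') (Reg ''degree'')) copy_body) (\<lambda>t \<sigma>'. I (length N) \<sigma>' \<and> t \<le> 80 * length N + 11) \<sigma>"
  proof (rule wp_counted_loop)
    show "I 0 \<sigma>" using assms unfolding I_def by auto
  next
    fix i \<sigma>' assume "I i \<sigma>'"
    then show "i \<le> length N \<and> bsafe w (Less (Reg ''k'') (Reg ''degree'')) \<sigma>' \<and>
        (bval (Less (Reg ''k'') (Reg ''degree'')) \<sigma>' \<longleftrightarrow> i < length N)"
      using dg unfolding I_def by auto
  next
    fix i \<sigma>' assume I: "I i \<sigma>'" and i: "i < length N"
    have "Suc i < 2 ^ w" "Suc (T + i) < 2 ^ w" using i T word by linarith+
    then show "wp w copy_body (\<lambda>t \<sigma>'. I (Suc i) \<sigma>' \<and> t \<le> 65) \<sigma>'"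
      using I i nb one_safe
      by (intro vc_wp) (auto simp: copy_body_def I_def less_Suc_eq)
  qed simp
  then show ?thesis by (rule wp_mono) (simp add: I_def)
qed

lemma wp_flip:
  assumes k0: "regs \<sigma> ''k'' = 0" and u0: "regs \<sigma> ''u'' = pu 0" and f0: "regs \<sigma> ''found'' = Suc (pv 0)"
    and par: "\<And>j. j < k \<Longrightarrow> arrs \<sigma> ''par'' (pu j) = pu (Suc j)"
    and m: "matching_arrays A (Suc c) ma me" and aug: "shortest_aug A ma me c k pu pv"
    and lab: "\<And>j. j \<le> k \<Longrightarrow> lab (pu j) \<le> j" and c: "c < n" and k: "k \<le> s"
    and arr: "arrs \<sigma> ''match'' = ma" "arrs \<sigma> ''mate'' = me" "arrs \<sigma> ''lab'' = lab" "arrs \<sigma> ''cur'' = cur"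
  shows "wp w (While (Neg (Equal (Reg ''found'') (Const 0))) flip_body)
    (\<lambda>t \<sigma>'. (\<forall>x. x \<notin> {''k'', ''u'', ''x'', ''found''} \<longrightarrow> regs \<sigma>' x = regs \<sigma> x) \<and>
      (\<forall>a. a \<notin> {''match'', ''mate'', ''lab'', ''cur''} \<longrightarrow> arrs \<sigma>' a = arrs \<sigma> a) \<and>
      flipped pu pv (Suc k) ma me lab cur (arrs \<sigma>' ''match'') (arrs \<sigma>' ''mate'') (arrs \<sigma>' ''lab'') (arrs \<sigma>' ''cur'') \<and>
      t \<le> 80 * Suc k + 11) \<sigma>"
proof -
  define I where "I i \<sigma>' \<longleftrightarrow> regs \<sigma>' ''k'' = i \<and> i \<le> Suc k \<and>
      (\<forall>x. x \<notin> {''k'', ''u'', ''x'', ''found''} \<longrightarrow> regs \<sigma>' x = regs \<sigma> x) \<and>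
      (\<forall>a. a \<notin> {''match'', ''mate'', ''lab'', ''cur''} \<longrightarrow> arrs \<sigma>' a = arrs \<sigma> a) \<and>
      (i \<le> k \<longrightarrow> regs \<sigma>' ''u'' = pu i) \<and> regs \<sigma>' ''found'' = (if i \<le> k then Suc (pv i) else 0) \<and>
      flipped pu pv i ma me lab cur (arrs \<sigma>' ''match'') (arrs \<sigma>' ''mate'') (arrs \<sigma>' ''lab'') (arrs \<sigma>' ''cur'')" for i and \<sigma>' :: state
  have "wp w (While (Neg (Equal (Reg ''found'') (Const 0))) flip_body) (\<lambda>t \<sigma>'. I (Suc k) \<sigma>' \<and> t \<le> 80 * Suc k + 11) \<sigma>"
  proof (rule wp_counted_loop)
    show "I 0 \<sigma>" using k0 u0 f0 arr flipped_0 unfolding I_def by auto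
  next
    fix i \<sigma>' assume "I i \<sigma>'"
    then show "i \<le> Suc k \<and> bsafe w (Neg (Equal (Reg ''found'') (Const 0))) \<sigma>' \<and>
        (bval (Neg (Equal (Reg ''found'') (Const 0))) \<sigma>' \<longleftrightarrow> i < Suc k)"
      unfolding I_def by auto
  next
    fix i \<sigma>' assume I: "I i \<sigma>'" and "i < Suc k"
    then have i: "i \<le> k" by simp
    let ?ma = "arrs \<sigma>' ''match''" and ?me = "arrs \<sigma>' ''mate''" and ?lab = "arrs \<sigma>' ''lab''" and ?cur = "arrs \<sigma>' ''cur''"
    have fl: "flipped pu pv i ma me lab cur ?ma ?me ?lab ?cur" using I unfolding I_def by blast
    have ne: "pu j \<noteq> pu i" "pv j \<noteq> pv i" if "j < i" for j
      using that i shortest_aug_inj[OF m aug, of j i] shortest_aug_inj_server[OF m aug, of j i] by auto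
    have fl': "flipped pu pv (Suc i) ma me lab cur (?ma(pu i := Suc (pv i))) (?me(pv i := Suc (pu i)))
        (if ?lab (pu i) < i then ?lab(pu i := i) else ?lab) (if ?lab (pu i) < i then ?cur(pu i := 0) else ?cur)"
      by (rule flipped_Suc[OF fl ne lab[OF i]])
    have "?ma (pu i) = ma (pu i)" using fl ne(1) unfolding flipped_def by metis
    then have x: "?ma (pu i) = (if Suc i \<le> k then Suc (pv (Suc i)) else 0)"
      using aug i unfolding shortest_aug_def by (auto simp: Suc_le_eq)
    have si: "Suc i < 2 ^ w" "Suc (pu i) < 2 ^ w"
      using i k shortest_aug_client[OF m aug _ i] c word by auto
    have pu': "arrs \<sigma>' ''par'' (pu i) = pu (Suc i)" if "Suc i \<le> k"
      using I par[of i] that unfolding I_def by auto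
    have reg: "regs \<sigma>' ''u'' = pu i" "regs \<sigma>' ''found'' = Suc (pv i)" "regs \<sigma>' ''k'' = i"
      and frame: "\<forall>x. x \<notin> {''k'', ''u'', ''x'', ''found''} \<longrightarrow> regs \<sigma>' x = regs \<sigma> x"
        "\<forall>a. a \<notin> {''match'', ''mate'', ''lab'', ''cur''} \<longrightarrow> arrs \<sigma>' a = arrs \<sigma> a"
      using I i unfolding I_def by auto
    have zero: "(0::nat) < 2 ^ w" by simp
    show "wp w flip_body (\<lambda>t \<sigma>'. I (Suc i) \<sigma>' \<and> t \<le> 65) \<sigma>'"
    proof (cases "?lab (pu i) < i")
      case True
      then have fl'': "flipped pu pv (Suc i) ma me lab cur (?ma(pu i := Suc (pv i))) (?me(pv i := Suc (pu i)))
        (?lab(pu i := i)) (?cur(pu i := 0))" using fl' by simp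
      show ?thesis
        by (rule vc_wp, simp add: flip_body_def reg True si one_safe zero, simp add: I_def)
          (use fl'' frame i x pu' in auto)
    next
      case False
      then have fl'': "flipped pu pv (Suc i) ma me lab cur (?ma(pu i := Suc (pv i))) (?me(pv i := Suc (pu i)))
        ?lab ?cur" using fl' by simp
      show ?thesis
        by (rule vc_wp, simp add: flip_body_def reg False si one_safe zero, simp add: I_def)
          (use fl'' frame i x pu' in auto)
    qed
  qed simp
  then show ?thesis by (rule wp_mono) (simp add: I_def)
qed

subsection \<open>One insertion\<close>

definition run_inv :: "nat \<Rightarrow> state \<Rightarrow> bool" where
  "run_inv i \<sigma> \<longleftrightarrow> adj_state A s i \<sigma> \<and> regs \<sigma> ''cnt'' = i \<and>
     sap_inv A i (arrs \<sigma> ''match'') (arrs \<sigma> ''mate'') (arrs \<sigma> ''lab'') (arrs \<sigma> ''cur'') \<and>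
     (\<forall>x. arrs \<sigma> ''seen'' x \<le> i) \<and> hall_inv A n (arrs \<sigma> ''match'') (regs \<sigma> ''cap'')"

text \<open>The summands pay for depth-first searches, failed breadth-first searches and successful
  ones. In the second, one half of the factor 2 is for searching and the other for relabelling the
  queue; in the third, the other half is for flipping a path whose length is bounded only by
  \<open>n\<close>.\<close>

definition run_pot :: "nat \<Rightarrow> nat \<Rightarrow> state \<Rightarrow> nat" where
  "run_pot K i \<sigma> = 2 * scan_pot A K i (arrs \<sigma> ''lab'') (arrs \<sigma> ''cur'') + 2 * dead_pot A s i (arrs \<sigma> ''lab'') +
     2 * (m + n + 1) * regs \<sigma> ''cap''"

lemma wp_prepare:
  assumes inv: "run_inv c \<sigma>" and c: "c < n" and K: "regs \<sigma> ''cap'' < K"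
  shows "wp w (Seq sap_prepare (While (Less (Reg ''k'') (Reg ''degree'')) copy_body))
    (\<lambda>t \<sigma>'. dfs_loop_inv K c (regs \<sigma> ''cap'') (arrs \<sigma> ''match'') (arrs \<sigma> ''mate'') (arrs \<sigma> ''lab'')
        (160 * scan_pot A K c (arrs \<sigma> ''lab'') (arrs \<sigma> ''cur'')) \<sigma>' \<and>
      t \<le> 80 * length (A c) + 60) (arrival (A c) \<sigma>)"
proof -
  let ?T = "regs \<sigma> ''tot''"
  let ?ma = "arrs \<sigma> ''match''" and ?me = "arrs \<sigma> ''mate''" and ?lab = "arrs \<sigma> ''lab''" and ?cur = "arrs \<sigma> ''cur''"
  have st: "adj_state A s c \<sigma>" and cnt: "regs \<sigma> ''cnt'' = c" and sap: "sap_inv A c ?ma ?me ?lab ?cur"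
    and seen: "\<forall>x. arrs \<sigma> ''seen'' x \<le> c" using inv unfolding run_inv_def by blast+
  have T: "?T = (\<Sum>u<c. length (A u))" using st unfolding adj_inv_def by blast
  have Tm: "?T + length (A c) \<le> m" using sum_length_le[of "Suc c"] c T by simp
  have mac: "?ma c = 0" using sap matching_arrays_match(2)[of A c ?ma ?me c] unfolding sap_inv_def
    by (cases "?ma c") auto
  have labc: "?lab c = 0" "?cur c = 0" using sap unfolding sap_inv_def by auto
  have sp: "scan_pot A K (Suc c) ?lab ?cur = scan_pot A K c ?lab ?cur"
    using labc K by (simp add: scan_pot_def client_pot_def)
  define \<sigma>0 where "\<sigma>0 = arrival (A c) \<sigma>"
  have r0: "regs \<sigma>0 = (regs \<sigma>)(''degree'' := length (A c))"
    and a0: "a \<noteq> ''neighbours'' \<Longrightarrow> arrs \<sigma>0 a = arrs \<sigma> a"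
    and nb0: "k < length (A c) \<Longrightarrow> arrs \<sigma>0 ''neighbours'' k = A c ! k" for a k
    unfolding \<sigma>0_def arrival_def by auto
  show ?thesis unfolding \<sigma>0_def[symmetric]
  proof (rule wp_SeqI)
    show "wp w sap_prepare (\<lambda>t \<sigma>1. t \<le> 40 \<and>
      (\<forall>x. x \<notin> {''k'', ''u'', ''found''} \<longrightarrow> regs \<sigma>1 x = regs \<sigma>0 x) \<and>
      regs \<sigma>1 ''k'' = 0 \<and> regs \<sigma>1 ''u'' = c \<and> regs \<sigma>1 ''found'' = 0 \<and>
      (\<forall>a. a \<notin> {''start'', ''deg'', ''par''} \<longrightarrow> arrs \<sigma>1 a = arrs \<sigma>0 a) \<and>
      arrs \<sigma>1 ''start'' = (arrs \<sigma> ''start'')(c := ?T) \<and>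
      arrs \<sigma>1 ''deg'' = (arrs \<sigma> ''deg'')(c := length (A c)) \<and>
      arrs \<sigma>1 ''par'' = (arrs \<sigma> ''par'')(c := c)) \<sigma>0"
      by (rule vc_wp) (simp add: sap_prepare_def r0 a0 cnt)
  next
    fix t :: nat and \<sigma>1 :: state assume 1: "t \<le> 40 \<and>
      (\<forall>x. x \<notin> {''k'', ''u'', ''found''} \<longrightarrow> regs \<sigma>1 x = regs \<sigma>0 x) \<and>
      regs \<sigma>1 ''k'' = 0 \<and> regs \<sigma>1 ''u'' = c \<and> regs \<sigma>1 ''found'' = 0 \<and>
      (\<forall>a. a \<notin> {''start'', ''deg'', ''par''} \<longrightarrow> arrs \<sigma>1 a = arrs \<sigma>0 a) \<and>
      arrs \<sigma>1 ''start'' = (arrs \<sigma> ''start'')(c := ?T) \<and>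
      arrs \<sigma>1 ''deg'' = (arrs \<sigma> ''deg'')(c := length (A c)) \<and>
      arrs \<sigma>1 ''par'' = (arrs \<sigma> ''par'')(c := c)"
    have "wp w (While (Less (Reg ''k'') (Reg ''degree'')) copy_body)
    (\<lambda>t \<sigma>'. (\<forall>x. x \<noteq> ''k'' \<longrightarrow> x \<noteq> ''tot'' \<longrightarrow> regs \<sigma>' x = regs \<sigma>1 x) \<and> regs \<sigma>' ''tot'' = ?T + length (A c) \<and>
      (\<forall>a. a \<noteq> ''adj'' \<longrightarrow> arrs \<sigma>' a = arrs \<sigma>1 a) \<and>
      (\<forall>j<?T. arrs \<sigma>' ''adj'' j = arrs \<sigma>1 ''adj'' j) \<and> (\<forall>j<length (A c). arrs \<sigma>' ''adj'' (?T + j) = A c ! j) \<and>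
      t \<le> 80 * length (A c) + 11) \<sigma>1"
      using 1 Tm nb0 by (intro wp_copy) (auto simp: r0)
    then show "wp w (While (Less (Reg ''k'') (Reg ''degree'')) copy_body)
      (\<lambda>t' \<sigma>'. dfs_loop_inv K c (regs \<sigma> ''cap'') ?ma ?me ?lab (160 * scan_pot A K c ?lab ?cur) \<sigma>' \<and>
        t + t' \<le> 80 * length (A c) + 60) \<sigma>1"
    proof (rule wp_mono)
      fix t' :: nat and \<sigma>' :: state assume 2: "(\<forall>x. x \<noteq> ''k'' \<longrightarrow> x \<noteq> ''tot'' \<longrightarrow> regs \<sigma>' x = regs \<sigma>1 x) \<and> regs \<sigma>' ''tot'' = ?T + length (A c) \<and>
      (\<forall>a. a \<noteq> ''adj'' \<longrightarrow> arrs \<sigma>' a = arrs \<sigma>1 a) \<and>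
      (\<forall>j<?T. arrs \<sigma>' ''adj'' j = arrs \<sigma>1 ''adj'' j) \<and> (\<forall>j<length (A c). arrs \<sigma>' ''adj'' (?T + j) = A c ! j) \<and>
      t' \<le> 80 * length (A c) + 11"
      have regs': "regs \<sigma>' ''servers'' = regs \<sigma> ''servers''" "regs \<sigma>' ''cnt'' = c" "regs \<sigma>' ''cap'' = regs \<sigma> ''cap''"
        "regs \<sigma>' ''u'' = c" "regs \<sigma>' ''found'' = 0" "regs \<sigma>' ''tot'' = ?T + length (A c)"
        using 1 2 by (simp_all add: r0 cnt)
      have arrs': "arrs \<sigma>' ''match'' = ?ma" "arrs \<sigma>' ''mate'' = ?me" "arrs \<sigma>' ''lab'' = ?lab" "arrs \<sigma>' ''cur'' = ?cur"
        "arrs \<sigma>' ''seen'' = arrs \<sigma> ''seen''" "arrs \<sigma>' ''start'' = (arrs \<sigma> ''start'')(c := ?T)"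
        "arrs \<sigma>' ''deg'' = (arrs \<sigma> ''deg'')(c := length (A c))" "arrs \<sigma>' ''par'' = (arrs \<sigma> ''par'')(c := c)"
        using 1 2 by (simp_all add: a0)
      have adj': "\<forall>j<?T. arrs \<sigma>' ''adj'' j = arrs \<sigma> ''adj'' j" "\<forall>j<length (A c). arrs \<sigma>' ''adj'' (?T + j) = A c ! j"
        using 1 2 by (simp_all add: a0)
      have "adj_state A s (Suc c) \<sigma>'"
        using st adj' unfolding adj_inv_def regs' arrs' by (auto simp: less_Suc_eq T)
      moreover have "dfs_inv A c ?ma ?me ?lab ?cur (arrs \<sigma>' ''par'') c 0 0"
        using sap_inv_Suc[OF sap] mac by (intro dfs_inv_start) (auto simp: arrs')
      ultimately have "dfs_loop_inv K c (regs \<sigma> ''cap'') ?ma ?me ?lab (160 * scan_pot A K c ?lab ?cur) \<sigma>'"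
        using seen by (intro dfs_loop_invI[where k = 0]) (simp_all add: regs' arrs' labc sp)
      then show "dfs_loop_inv K c (regs \<sigma> ''cap'') ?ma ?me ?lab (160 * scan_pot A K c ?lab ?cur) \<sigma>' \<and>
        t + t' \<le> 80 * length (A c) + 60" using 1 2 by simp
    qed
  qed
qed

text \<open>The interface between searching and flipping. Its final disjunction says why the flip is
  affordable: either the distance is at most \<open>B + 1\<close>, or \<open>cap\<close> has been
  increased, and then the distance bound required by \<open>hall_inv\<close> is at hand.\<close>

definition aug_ready ::
  "nat \<Rightarrow> nat \<Rightarrow> (nat \<Rightarrow> nat) \<Rightarrow> (nat \<Rightarrow> nat) \<Rightarrow> (nat \<Rightarrow> nat) \<Rightarrow> (nat \<Rightarrow> nat) \<Rightarrow> nat \<Rightarrow> state \<Rightarrow> bool" where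
  "aug_ready c B ma me lab cur B' \<sigma> \<longleftrightarrow>
     adj_state A s (Suc c) \<sigma> \<and> regs \<sigma> ''cnt'' = c \<and> regs \<sigma> ''cap'' = B' \<and>
     arrs \<sigma> ''match'' = ma \<and> arrs \<sigma> ''mate'' = me \<and> arrs \<sigma> ''lab'' = lab \<and> arrs \<sigma> ''cur'' = cur \<and>
     sap_inv A (Suc c) ma me lab cur \<and> ma c = 0 \<and> (\<forall>x. arrs \<sigma> ''seen'' x \<le> Suc c) \<and>
     (regs \<sigma> ''found'' = 0 \<and> B' = B \<and> (\<forall>j. \<not> free_walk A me j c) \<or>
      (\<exists>k pu pv. shortest_aug A ma me c k pu pv \<and> regs \<sigma> ''found'' = Suc (pv 0) \<and> regs \<sigma> ''u'' = pu 0 \<and>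
         (\<forall>j<k. arrs \<sigma> ''par'' (pu j) = pu (Suc j)) \<and>
         (B' = B \<and> k \<le> Suc B \<or> B' = Suc B \<and> (\<forall>j. free_walk A me j c \<longrightarrow> Suc B \<le> j))))"

lemma par_chain_aug_ready:
  assumes "par_chain A ma par c k u" and "ma c = 0" and "v \<in> set (A u)" and "me v = 0"
    and "\<forall>j. free_walk A me j c \<longrightarrow> k \<le> j"
  shows "\<exists>pu pv. shortest_aug A ma me c k pu pv \<and> pv 0 = v \<and> pu 0 = u \<and> (\<forall>j<k. par (pu j) = pu (Suc j))"
  by (rule exI, rule exI, rule conjI[OF par_chain_shortest_aug[OF assms]]) auto

lemma wp_sap_bfs:
  assumes inv: "dfs_loop_inv K c B ma me lab0 pot \<sigma>" and g: "\<not> bval dfs_guard \<sigma>" and c: "c < n"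
  shows "wp w sap_bfs (\<lambda>t \<sigma>'. \<exists>lab' B'. aug_ready c B ma me lab' (arrs \<sigma> ''cur'') B' \<sigma>' \<and>
      (\<forall>x. arrs \<sigma> ''lab'' x \<le> lab' x) \<and>
      t + 160 * dead_pot A s (Suc c) (arrs \<sigma> ''lab'') + 80 * (m + n + 1) * B \<le>
        160 * dead_pot A s (Suc c) lab' + 80 * (m + n + 1) * B' + 80) \<sigma>"
    (is "wp w sap_bfs ?Q \<sigma>")
proof -
  let ?lab = "arrs \<sigma> ''lab''" and ?cur = "arrs \<sigma> ''cur''"
  have st: "adj_state A s (Suc c) \<sigma>" and cnt: "regs \<sigma> ''cnt'' = c" and cap: "regs \<sigma> ''cap'' = B"
    and ma: "arrs \<sigma> ''match'' = ma" and me: "arrs \<sigma> ''mate'' = me" and seen: "\<forall>x. arrs \<sigma> ''seen'' x \<le> c"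
    and labB: "?lab c \<le> Suc B" using inv unfolding dfs_loop_inv_def by blast+
  obtain k where dfs: "dfs_inv A c ma me ?lab ?cur (arrs \<sigma> ''par'') (regs \<sigma> ''u'') (regs \<sigma> ''found'') k"
    using inv unfolding dfs_loop_inv_def by blast
  have sap: "sap_inv A (Suc c) ma me ?lab ?cur" and mac: "ma c = 0" using dfs unfolding dfs_inv_def by auto
  have sv: "regs \<sigma> ''servers'' = s" using st unfolding adj_inv_def by blast
  have ss: "\<And>u. u < Suc c \<Longrightarrow> set (A u) \<subseteq> {..<s}" using servers c by simp
  have zero: "(0::nat) < 2 ^ w" by simp
  show ?thesis
  proof (cases "regs \<sigma> ''found'' = 0 \<and> ?lab c < s")
    case False
    have "aug_ready c B ma me ?lab ?cur B \<sigma>"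
    proof (cases "regs \<sigma> ''found''")
      case 0
      then have "s \<le> ?lab c" using False by simp
      then have "\<not> free_walk A me j c" for j using dead_no_walk[OF sap ss, of c j] by simp
      then show ?thesis using st cnt cap ma me seen sap mac 0
        unfolding aug_ready_def by (auto intro: le_SucI)
    next
      case (Suc v)
      note d = dfs_inv_shortest[OF dfs[unfolded Suc]]
      have k: "k \<le> Suc B" using dfs_inv_lab[OF dfs] labB by simp
      obtain pu pv where p: "shortest_aug A ma me c k pu pv" "pv 0 = v" "pu 0 = regs \<sigma> ''u''"
        "\<forall>j<k. arrs \<sigma> ''par'' (pu j) = pu (Suc j)"
        using par_chain_aug_ready[where v = v and me = me, OF d(3) mac d(1,2)] d(4) by blast
      then have "\<exists>k pu pv. shortest_aug A ma me c k pu pv \<and> regs \<sigma> ''found'' = Suc (pv 0) \<and> regs \<sigma> ''u'' = pu 0 \<and>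
         (\<forall>j<k. arrs \<sigma> ''par'' (pu j) = pu (Suc j)) \<and>
         (B = B \<and> k \<le> Suc B \<or> B = Suc B \<and> (\<forall>j. free_walk A me j c \<longrightarrow> Suc B \<le> j))"
        using k Suc by (intro exI[of _ k] exI[of _ pu] exI[of _ pv]) auto
      then show ?thesis using st cnt cap ma me seen sap mac
        unfolding aug_ready_def by (auto intro: le_SucI)
    qed
    moreover have "\<not> (regs \<sigma> ''found'' = 0 \<and> ?lab (regs \<sigma> ''cnt'') < regs \<sigma> ''servers'')"
      using False cnt sv by simp
    ultimately show ?thesis
      by (intro vc_wp) (auto simp: sap_bfs_def zero intro!: exI[of _ ?lab] exI[of _ B])
  next
    case True
    \<comment> \<open>With nothing found and a label below \<open>s\<close>, the depth-first search
      can only have stopped because the label passed \<open>cap\<close>. It equals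
      \<open>B + 1\<close> and thereby bounds the distance from below.\<close>
    have labc: "?lab c = Suc B" "Suc B < s" using True labB g cnt cap sv unfolding dfs_guard_def by auto
    have far: "Suc B \<le> j" if "free_walk A me j c" for j
      using sap that labc unfolding sap_inv_def by metis
    have sc: "Suc c < 2 ^ w" and sB: "Suc B < 2 ^ w" using c labc word by linarith+
    let ?rest = "Cond (Equal (Reg ''found'') (Const 0))
           (Seq (Assign ''k'' (Const 0)) (While (Less (Reg ''k'') (Reg ''qt'')) kill_body))
           (incr ''cap'')"
    \<comment> \<open>The 9 is the cost of the conditional and its test. The branch is treated apart
      because \<open>vc\<close> would unfold the sequence instead of accepting a \<open>wp\<close>
      for it.\<close>
    have main: "wp w (Seq bfs_start (Seq (While bfs_guard bfs_body) ?rest)) (\<lambda>t. ?Q (9 + t)) \<sigma>"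
    proof (rule wp_SeqI)
      show "wp w bfs_start (\<lambda>t \<sigma>1. bfs_loop_inv c B ma me ?lab ?cur 0 \<sigma>1 \<and> t \<le> 30) \<sigma>"
      proof -
        have b: "bfs_inv A c s ma me ?lab (arrs \<sigma> ''par'') ((arrs \<sigma> ''queue'')(0 := c))
          ((arrs \<sigma> ''seen'')(c := Suc c)) (\<lambda>_. 0) c 0 1 0 0"
          using seen True by (intro bfs_inv_start) auto
        show ?thesis
          by (rule vc_wp, simp add: bfs_start_def cnt sc one_safe zero, rule bfs_loop_invI[where d = "\<lambda>_. 0"])
            (use st cap ma me seen b True in \<open>simp_all add: cnt le_SucI\<close>)
      qed
    next
      fix t1 :: nat and \<sigma>1 :: state assume 1: "bfs_loop_inv c B ma me ?lab ?cur 0 \<sigma>1 \<and> t1 \<le> 30"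
      show "wp w (Seq (While bfs_guard bfs_body) ?rest) (\<lambda>t. ?Q (9 + (t1 + t))) \<sigma>1"
      proof (rule wp_SeqI[OF wp_bfs[OF conjunct1[OF 1] c sap]])
        fix t2 :: nat and \<sigma>2 :: state
        assume 2: "\<exists>pot. bfs_loop_inv c B ma me ?lab ?cur pot \<sigma>2 \<and> \<not> bval bfs_guard \<sigma>2 \<and> t2 \<le> pot + 10"
        let ?q = "arrs \<sigma>2 ''queue''" and ?qt = "regs \<sigma>2 ''qt''" and ?qh = "regs \<sigma>2 ''qh''" and ?u = "regs \<sigma>2 ''u''"
        from 2 obtain d pot where st2: "adj_state A s (Suc c) \<sigma>2" and cnt2: "regs \<sigma>2 ''cnt'' = c" and cap2: "regs \<sigma>2 ''cap'' = B"
          and arr2: "arrs \<sigma>2 ''match'' = ma" "arrs \<sigma>2 ''mate'' = me" "arrs \<sigma>2 ''lab'' = ?lab" "arrs \<sigma>2 ''cur'' = ?cur"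
          and seen2: "\<forall>x. arrs \<sigma>2 ''seen'' x \<le> Suc c" and p2: "?qh < ?qt \<or> regs \<sigma>2 ''p'' = 0"
          and bfs: "bfs_inv A c s ma me ?lab (arrs \<sigma>2 ''par'') ?q (arrs \<sigma>2 ''seen'') d
            ?u ?qh ?qt (regs \<sigma>2 ''p'') (regs \<sigma>2 ''found'')"
          and pot: "pot = 80 * ((\<Sum>a<?qh. length (A (?q a)) + 1) + regs \<sigma>2 ''p'' +
            (if regs \<sigma>2 ''found'' = 0 then 0 else 1))"
          and t2: "t2 \<le> pot + 10" and g2: "regs \<sigma>2 ''found'' = 0 \<longrightarrow> \<not> ?qh < ?qt"
          unfolding bfs_loop_inv_def bfs_guard_def by auto
        have sv2: "regs \<sigma>2 ''servers'' = s" using st2 unfolding adj_inv_def by blast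
        let ?W = "\<Sum>y\<in>?q ` {..<?qt}. length (A y) + 1"
        have W: "(\<Sum>a<?qh. length (A (?q a)) + 1) + regs \<sigma>2 ''p'' \<le> ?W" by (rule bfs_pot_le[OF bfs p2])
        have Wm: "?W \<le> m + n" by (rule bfs_queue_weight[OF bfs c])
        show "wp w ?rest (\<lambda>t. ?Q (9 + (t1 + (t2 + t)))) \<sigma>2"
        proof (cases "regs \<sigma>2 ''found''")
          case (Suc v)
          have v: "v \<in> set (A ?u)" "me v = 0" and qh: "?qh < ?qt" using bfs Suc unfolding bfs_inv_def by auto
          have u: "?u \<in> ?q ` {..<?qt}" using bfs qh unfolding bfs_inv_def by auto
          have cQ: "c \<in> ?q ` {..<?qt}" "d c = 0" using bfs unfolding bfs_inv_def by blast+
          have min: "d ?u \<le> j" if "free_walk A me j c" for j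
            using bfs_inv_dist[OF bfs sap ss cQ(1) that] cQ(2) by simp
          obtain pu pv where p: "shortest_aug A ma me c (d ?u) pu pv" "pv 0 = v" "pu 0 = ?u"
            "\<forall>j<d ?u. arrs \<sigma>2 ''par'' (pu j) = pu (Suc j)"
            using par_chain_aug_ready[where v = v and me = me, OF bfs_inv_par_chain[OF bfs u] mac v] min by blast
          then have ex: "\<exists>k pu pv. shortest_aug A ma me c k pu pv \<and> Suc v = Suc (pv 0) \<and> ?u = pu 0 \<and>
             (\<forall>j<k. arrs \<sigma>2 ''par'' (pu j) = pu (Suc j)) \<and>
             (Suc B = B \<and> k \<le> Suc B \<or> Suc B = Suc B \<and> (\<forall>j. free_walk A me j c \<longrightarrow> Suc B \<le> j))"
            using far by (intro exI[of _ "d ?u"] exI[of _ pu] exI[of _ pv]) auto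
          have rdy: "aug_ready c B ma me ?lab ?cur (Suc B) (\<sigma>2\<lparr>regs := (regs \<sigma>2)(''cap'' := Suc B)\<rparr>)"
            using st2 cnt2 arr2 seen2 sap mac ex Suc unfolding aug_ready_def by simp
          have "t2 \<le> 80 * (m + n + 1) + 10" using t2 pot W Wm by (simp split: if_splits)
          then show ?thesis using 1 rdy Suc
            by (intro vc_wp) (auto simp: cap2 sB one_safe zero intro!: exI[of _ ?lab] exI[of _ "Suc B"])
        next
          case 0
          then have qh: "\<not> ?qh < ?qt" using g2 by simp
          let ?l = "\<lambda>y. if y \<in> ?q ` {..<?qt} then s else ?lab y"
          note f = bfs_inv_fail[OF bfs[unfolded 0] qh sap ss]
          have Qs: "?q ` {..<?qt} \<subseteq> {..<Suc c}" "\<And>y. y \<in> ?q ` {..<?qt} \<Longrightarrow> ?lab y < s"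
            using bfs unfolding bfs_inv_def by (auto simp: less_Suc_eq_le)
          have dead: "dead_pot A s (Suc c) ?lab + ?W = dead_pot A s (Suc c) ?l"
            by (rule dead_pot_kill[OF Qs])
          have mono: "\<forall>x. ?lab x \<le> ?l x" using Qs(2) by (auto simp: less_imp_le)
          \<comment> \<open>Every queued client has weight at least one, so relabelling the queue
            costs no more than searching did, and together they cost about twice the weight that
            dies.\<close>
          have "card (?q ` {..<?qt}) = ?qt" using bfs card_image unfolding bfs_inv_def by fastforce
          moreover have "card (?q ` {..<?qt}) \<le> ?W" unfolding card_eq_sum by (intro sum_mono) simp
          ultimately have qtW: "?qt \<le> ?W" by simp
          have t2': "t2 \<le> 80 * ?W + 10" using t2 pot W 0 by simp
          have qtn: "?qt \<le> n" using bfs_inv_queue[OF bfs] c by simp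
          have kl: "wp w (While (Less (Reg ''k'') (Reg ''qt'')) kill_body)
            (\<lambda>t. ?Q (9 + (t1 + (t2 + (4 + (2 + t)))))) (\<sigma>2\<lparr>regs := (regs \<sigma>2)(''k'' := 0)\<rparr>)" (is "wp w _ _ ?\<sigma>3")
          proof (rule wp_mono[OF wp_kill[where qt = ?qt]])
            fix t :: nat and \<sigma>4 :: state assume 4: "(\<forall>x. x \<noteq> ''k'' \<longrightarrow> regs \<sigma>4 x = regs ?\<sigma>3 x) \<and>
              arrs \<sigma>4 = (arrs ?\<sigma>3)(''lab'' := \<lambda>y. if y \<in> arrs ?\<sigma>3 ''queue'' ` {..<?qt} then s else arrs ?\<sigma>3 ''lab'' y) \<and>
              t \<le> 80 * ?qt + 11"
            have a3: "arrs ?\<sigma>3 = arrs \<sigma>2" by simp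
            have "arrs \<sigma>4 = (arrs \<sigma>2)(''lab'' := ?l)" using 4 unfolding a3 arr2(3) by blast
            then have "aug_ready c B ma me ?l ?cur B \<sigma>4"
              using st2 cnt2 cap2 arr2 seen2 f mac 0 4 unfolding aug_ready_def by simp
            moreover have "9 + (t1 + (t2 + (4 + (2 + t)))) \<le> 160 * ?W + 80"
              using 1 4 t2' qtW by linarith
            ultimately show "?Q (9 + (t1 + (t2 + (4 + (2 + t))))) \<sigma>4"
              using mono dead by (intro exI[of _ ?l] exI[of _ B]) auto
          qed (use qtn sv2 in auto)
          show ?thesis
            by (rule vc_wp) (use 0 kl zero in \<open>simp add: numeral_eq_Suc\<close>)
        qed
      qed
    qed
    have guard: "bval (Conj (Equal (Reg ''found'') (Const 0)) (Less (Load ''lab'' (Reg ''cnt'')) (Reg ''servers''))) \<sigma>"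
      using True cnt sv by simp
    show ?thesis unfolding wp_def
    proof
      assume f: "fits_word w \<sigma>"
      then obtain t \<sigma>' where e: "exec w (Seq bfs_start (Seq (While bfs_guard bfs_body) ?rest)) \<sigma> t \<sigma>'" "?Q (9 + t) \<sigma>'"
        using main unfolding wp_def by blast
      have "bfits w (Conj (Equal (Reg ''found'') (Const 0)) (Less (Load ''lab'' (Reg ''cnt'')) (Reg ''servers''))) \<sigma>"
        using f by (intro bsafe_bfits) auto
      from exec.CondTrue[OF this guard e(1), of Skip] have "exec w sap_bfs \<sigma> (9 + t) \<sigma>'"
        unfolding sap_bfs_def by (simp add: numeral_eq_Suc)
      then show "\<exists>t \<sigma>'. exec w sap_bfs \<sigma> t \<sigma>' \<and> ?Q t \<sigma>'" using e(2) by blast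
    qed
  qed
qed

lemma wp_sap_flip:
  assumes rdy: "aug_ready c B ma me lab cur B' \<sigma>" and c: "c < n" and hall: "hall_inv A n ma B"
  shows "wp w (Seq (Assign ''k'' (Const 0)) (Seq (While (Neg (Equal (Reg ''found'') (Const 0))) flip_body) (incr ''cnt'')))
    (\<lambda>t \<sigma>'. run_inv (Suc c) \<sigma>' \<and> regs \<sigma>' ''cap'' = B' \<and>
      sap_step (edges_below A (Suc c)) (matched_edges c ma) c (matched_edges (Suc c) (arrs \<sigma>' ''match'')) \<and>
      scan_pot A K (Suc c) lab cur \<le> scan_pot A K (Suc c) (arrs \<sigma>' ''lab'') (arrs \<sigma>' ''cur'') \<and>
      dead_pot A s (Suc c) lab \<le> dead_pot A s (Suc c) (arrs \<sigma>' ''lab'') \<and> B \<le> B' \<and>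
      t + 80 * n * B \<le> 80 * n * B' + 80 * (B + 3)) \<sigma>"
    (is "wp w _ ?Q \<sigma>")
proof -
  have st: "adj_state A s (Suc c) \<sigma>" and cnt: "regs \<sigma> ''cnt'' = c" and cap: "regs \<sigma> ''cap'' = B'"
    and arr: "arrs \<sigma> ''match'' = ma" "arrs \<sigma> ''mate'' = me" "arrs \<sigma> ''lab'' = lab" "arrs \<sigma> ''cur'' = cur"
    and sap: "sap_inv A (Suc c) ma me lab cur" and mac: "ma c = 0" and seen: "\<forall>x. arrs \<sigma> ''seen'' x \<le> Suc c"
    and alt: "regs \<sigma> ''found'' = 0 \<and> B' = B \<and> (\<forall>j. \<not> free_walk A me j c) \<or>
      (\<exists>k pu pv. shortest_aug A ma me c k pu pv \<and> regs \<sigma> ''found'' = Suc (pv 0) \<and> regs \<sigma> ''u'' = pu 0 \<and>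
         (\<forall>j<k. arrs \<sigma> ''par'' (pu j) = pu (Suc j)) \<and>
         (B' = B \<and> k \<le> Suc B \<or> B' = Suc B \<and> (\<forall>j. free_walk A me j c \<longrightarrow> Suc B \<le> j)))"
    using rdy unfolding aug_ready_def by blast+
  have m: "matching_arrays A (Suc c) ma me" using sap unfolding sap_inv_def by blast
  have sc: "Suc c < 2 ^ w" using c word by linarith
  define \<sigma>0 where "\<sigma>0 = \<sigma>\<lparr>regs := (regs \<sigma>)(''k'' := 0)\<rparr>"
  have r0: "x \<noteq> ''k'' \<Longrightarrow> regs \<sigma>0 x = regs \<sigma> x" "regs \<sigma>0 ''k'' = 0" "arrs \<sigma>0 = arrs \<sigma>" for x
    unfolding \<sigma>0_def by auto
  let ?loop = "While (Neg (Equal (Reg ''found'') (Const 0))) flip_body"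
  have seq: ?thesis
    if loop: "wp w ?loop (\<lambda>t \<sigma>'. (\<forall>x. x \<notin> {''k'', ''u'', ''x'', ''found''} \<longrightarrow> regs \<sigma>' x = regs \<sigma> x) \<and> R (arrs \<sigma>') \<and> t \<le> L) \<sigma>0"
      and R: "\<And>t \<sigma>'. (\<forall>x. x \<notin> {''k'', ''u'', ''x'', ''found''} \<longrightarrow> regs \<sigma>' x = regs \<sigma> x) \<Longrightarrow> R (arrs \<sigma>') \<Longrightarrow> t \<le> L + 10 \<Longrightarrow>
        ?Q t (\<sigma>'\<lparr>regs := (regs \<sigma>')(''cnt'' := Suc c)\<rparr>)" for R L
  proof (rule wp_SeqI[where ?Q1.0 = "\<lambda>t \<sigma>'. t = 2 \<and> \<sigma>' = \<sigma>0"])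
    show "wp w (Assign ''k'' (Const 0)) (\<lambda>t \<sigma>'. t = 2 \<and> \<sigma>' = \<sigma>0) \<sigma>"
      by (rule vc_wp) (simp add: \<sigma>0_def)
    fix t1 :: nat and \<sigma>1 assume "t1 = 2 \<and> \<sigma>1 = \<sigma>0"
    then have t1: "t1 = 2" "\<sigma>1 = \<sigma>0" by auto
    show "wp w (Seq ?loop (incr ''cnt'')) (\<lambda>t. ?Q (t1 + t)) \<sigma>1" unfolding t1
    proof (rule wp_SeqI[OF loop])
      fix t :: nat and \<sigma>' :: state assume 3: "(\<forall>x. x \<notin> {''k'', ''u'', ''x'', ''found''} \<longrightarrow> regs \<sigma>' x = regs \<sigma> x) \<and> R (arrs \<sigma>') \<and> t \<le> L"
      then have c': "regs \<sigma>' ''cnt'' = c" using cnt by simp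
      have "?Q (2 + (t + 4)) (\<sigma>'\<lparr>regs := (regs \<sigma>')(''cnt'' := Suc c)\<rparr>)" using 3 by (intro R) auto
      then show "wp w (incr ''cnt'') (\<lambda>t'. ?Q (2 + (t + t'))) \<sigma>'"
        by (intro vc_wp) (simp add: c' sc one_safe)
    qed
  qed
  from alt show ?thesis
  proof
    assume none: "regs \<sigma> ''found'' = 0 \<and> B' = B \<and> (\<forall>j. \<not> free_walk A me j c)"
    have "wp w ?loop (\<lambda>t \<sigma>'. (0 = (0 :: nat) \<and> \<sigma>' = \<sigma>0) \<and> t \<le> 80 * 0 + 11) \<sigma>0"
      using none by (intro wp_counted_loop[where I = "\<lambda>i \<sigma>'. i = 0 \<and> \<sigma>' = \<sigma>0"]) (auto simp: r0)
    then have loop: "wp w ?loop (\<lambda>t \<sigma>'. (\<forall>x. x \<notin> {''k'', ''u'', ''x'', ''found''} \<longrightarrow> regs \<sigma>' x = regs \<sigma> x) \<and> arrs \<sigma>' = arrs \<sigma> \<and> t \<le> 11) \<sigma>0"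
      by (rule wp_mono) (auto simp: r0)
    have sstep: "sap_step (edges_below A (Suc c)) (matched_edges c ma) c (matched_edges (Suc c) ma)"
      using sap_step_no_walk[OF m, of c] none by (simp add: matched_edges_Suc[of ma c, OF mac])
    show ?thesis
    proof (rule seq[where R = "\<lambda>a. a = arrs \<sigma>", OF loop])
      fix t :: nat and \<sigma>' :: state assume r: "\<forall>x. x \<notin> {''k'', ''u'', ''x'', ''found''} \<longrightarrow> regs \<sigma>' x = regs \<sigma> x"
        and a: "arrs \<sigma>' = arrs \<sigma>" and t: "t \<le> 11 + (10::nat)"
      show "?Q t (\<sigma>'\<lparr>regs := (regs \<sigma>')(''cnt'' := Suc c)\<rparr>)"
        using r a t st cap arr sap seen hall sstep none unfolding run_inv_def by simp
    qed
  next
    assume "\<exists>k pu pv. shortest_aug A ma me c k pu pv \<and> regs \<sigma> ''found'' = Suc (pv 0) \<and> regs \<sigma> ''u'' = pu 0 \<and>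
         (\<forall>j<k. arrs \<sigma> ''par'' (pu j) = pu (Suc j)) \<and>
         (B' = B \<and> k \<le> Suc B \<or> B' = Suc B \<and> (\<forall>j. free_walk A me j c \<longrightarrow> Suc B \<le> j))"
    then obtain k pu pv where aug: "shortest_aug A ma me c k pu pv" and f: "regs \<sigma> ''found'' = Suc (pv 0)"
      and u: "regs \<sigma> ''u'' = pu 0" and par: "\<forall>j<k. arrs \<sigma> ''par'' (pu j) = pu (Suc j)"
      and B': "B' = B \<and> k \<le> Suc B \<or> B' = Suc B \<and> (\<forall>j. free_walk A me j c \<longrightarrow> Suc B \<le> j)" by blast
    have ss: "\<And>u. u < Suc c \<Longrightarrow> set (A u) \<subseteq> {..<s}" using servers c by simp
    have "free_walk A me k c" using shortest_aug_walk[OF m aug, of k] aug unfolding shortest_aug_def by simp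
    then obtain j where "j < s" "free_walk A me j c" using free_walk_short[OF m ss, of c k] by auto
    then have ks: "k \<le> s" using aug unfolding shortest_aug_def by (meson less_imp_le order_trans)
    have "inj_on pu {..k}" using shortest_aug_inj[OF m aug] by (intro inj_onI) auto
    then have "card {..k} \<le> card {..<Suc c}"
      by (rule card_inj_on_le) (use shortest_aug_client[OF m aug] in auto)
    then have kn: "Suc k \<le> n" using c by simp
    have lab: "lab (pu j) \<le> j" if "j \<le> k" for j
      using shortest_aug_walk[OF m aug that] sap unfolding sap_inv_def by blast
    let ?R = "\<lambda>a. (\<forall>b. b \<notin> {''match'', ''mate'', ''lab'', ''cur''} \<longrightarrow> a b = arrs \<sigma> b) \<and>
      flipped pu pv (Suc k) ma me lab cur (a ''match'') (a ''mate'') (a ''lab'') (a ''cur'')"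
    have "wp w ?loop (\<lambda>t \<sigma>'. (\<forall>x. x \<notin> {''k'', ''u'', ''x'', ''found''} \<longrightarrow> regs \<sigma>' x = regs \<sigma>0 x) \<and>
      (\<forall>a. a \<notin> {''match'', ''mate'', ''lab'', ''cur''} \<longrightarrow> arrs \<sigma>' a = arrs \<sigma>0 a) \<and>
      flipped pu pv (Suc k) ma me lab cur (arrs \<sigma>' ''match'') (arrs \<sigma>' ''mate'') (arrs \<sigma>' ''lab'') (arrs \<sigma>' ''cur'') \<and>
      t \<le> 80 * Suc k + 11) \<sigma>0"
      using u f par arr by (intro wp_flip[OF _ _ _ _ m aug lab c ks]) (auto simp: r0)
    then have loop: "wp w ?loop (\<lambda>t \<sigma>'. (\<forall>x. x \<notin> {''k'', ''u'', ''x'', ''found''} \<longrightarrow> regs \<sigma>' x = regs \<sigma> x) \<and>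
      ?R (arrs \<sigma>') \<and> t \<le> 80 * Suc k + 11) \<sigma>0"
      by (rule wp_mono) (simp add: r0)
    show ?thesis
    proof (rule seq[where R = ?R, OF loop])
      fix t :: nat and \<sigma>' :: state assume r: "\<forall>x. x \<notin> {''k'', ''u'', ''x'', ''found''} \<longrightarrow> regs \<sigma>' x = regs \<sigma> x"
        and a: "?R (arrs \<sigma>')" and t: "t \<le> 80 * Suc k + 11 + 10"
      let ?ma = "arrs \<sigma>' ''match''" and ?me = "arrs \<sigma>' ''mate''" and ?lab = "arrs \<sigma>' ''lab''" and ?cur = "arrs \<sigma>' ''cur''"
      have fl: "flipped pu pv (Suc k) ma me lab cur ?ma ?me ?lab ?cur" using a by blast
      have sap': "sap_inv A (Suc c) ?ma ?me ?lab ?cur" by (rule flipped_sap_inv[OF sap aug _ fl]) simp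
      have mono: "\<And>x. lab x \<le> ?lab x" by (rule flipped_lab_mono[OF sap aug fl])
      have sstep: "sap_step (edges_below A (Suc c)) (matched_edges c ma) c (matched_edges (Suc c) ?ma)"
        using sap_step_shortest_aug[OF m aug _ fl] by (simp add: matched_edges_Suc[of ma c, OF mac])
      have "?ma (pu k) = Suc (pv k)" using fl unfolding flipped_def by simp
      then have cm: "?ma c \<noteq> 0" using aug unfolding shortest_aug_def by simp
      have "ma x \<noteq> 0 \<Longrightarrow> ?ma x \<noteq> 0" for x
        using fl unfolding flipped_def by (cases "\<exists>j<Suc k. x = pu j") auto
      then have sub: "insert c {x. ma x \<noteq> 0} \<subseteq> {x. ?ma x \<noteq> 0}" using cm by auto
      have hall': "hall_inv A n ?ma B'"
      proof (cases "B' = B")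
        case True
        then show ?thesis using hall_inv_mono[OF hall, of ?ma] sub by simp
      next
        case False
        then have "B' = Suc B" "\<And>j. free_walk A me j c \<Longrightarrow> Suc B \<le> j" using B' by auto
        then show ?thesis using hall_inv_Suc[OF hall m mac _ _ _ sub] c by simp
      qed
      have sp: "scan_pot A K (Suc c) lab cur \<le> scan_pot A K (Suc c) ?lab ?cur"
        using sap mono fl unfolding sap_inv_def flipped_def by (intro scan_pot_mono) auto
      have dp: "dead_pot A s (Suc c) lab \<le> dead_pot A s (Suc c) ?lab" using mono by (rule dead_pot_mono)
      have time: "t + 80 * n * B \<le> 80 * n * B' + 80 * (B + 3)" using B' t kn by auto
      have cap': "regs \<sigma>' ''cap'' = B'" using r cap by simp
      have BB': "B \<le> B'" using B' by auto
      have "run_inv (Suc c) (\<sigma>'\<lparr>regs := (regs \<sigma>')(''cnt'' := Suc c)\<rparr>)"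
        using r a st cap seen sap' hall' unfolding run_inv_def by simp
      then show "?Q t (\<sigma>'\<lparr>regs := (regs \<sigma>')(''cnt'' := Suc c)\<rparr>)"
        using sstep sp dp time cap' BB' by (intro conjI) simp_all
    qed
  qed
qed

text \<open>Not covered by the potential are the reading of the new list, the depth of the stack
  when the search ends, at most \<open>K\<close>, and the flip of a path of distance at most
  \<open>cap + 1\<close>, another \<open>K\<close>.\<close>

lemma wp_sap_program:
  assumes inv: "run_inv c \<sigma>" and c: "c < n" and K: "regs \<sigma> ''cap'' < K"
  shows "wp w sap_program
    (\<lambda>t \<sigma>'. run_inv (Suc c) \<sigma>' \<and> regs \<sigma> ''cap'' \<le> regs \<sigma>' ''cap'' \<and>
      sap_step (edges_below A (Suc c)) (matched_edges c (arrs \<sigma> ''match'')) c (matched_edges (Suc c) (arrs \<sigma>' ''match'')) \<and>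
      t + 80 * run_pot K c \<sigma> \<le> 80 * (run_pot K (Suc c) \<sigma>' + length (A c) + 2 * K + 8)) (arrival (A c) \<sigma>)"
    (is "wp w _ ?Q _")
proof -
  let ?B = "regs \<sigma> ''cap''" and ?ma = "arrs \<sigma> ''match''" and ?me = "arrs \<sigma> ''mate''" and ?lab = "arrs \<sigma> ''lab''"
    and ?cur = "arrs \<sigma> ''cur''"
  let ?copy = "While (Less (Reg ''k'') (Reg ''degree'')) copy_body"
  let ?dfs = "While dfs_guard dfs_body"
  let ?flip = "Seq (Assign ''k'' (Const 0)) (Seq (While (Neg (Equal (Reg ''found'') (Const 0))) flip_body) (incr ''cnt''))"
  have hall: "hall_inv A n ?ma ?B" using inv unfolding run_inv_def by blast
  have "wp w (Seq (Seq sap_prepare ?copy) (Seq ?dfs (Seq sap_bfs ?flip))) ?Q (arrival (A c) \<sigma>)"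
  proof (rule wp_SeqI[OF wp_prepare[OF inv c K]])
    fix t1 \<sigma>1 assume "dfs_loop_inv K c ?B ?ma ?me ?lab (160 * scan_pot A K c ?lab ?cur) \<sigma>1 \<and> t1 \<le> 80 * length (A c) + 60"
    then have 1: "dfs_loop_inv K c ?B ?ma ?me ?lab (160 * scan_pot A K c ?lab ?cur) \<sigma>1" "t1 \<le> 80 * length (A c) + 60" by auto
    show "wp w (Seq ?dfs (Seq sap_bfs ?flip)) (\<lambda>t. ?Q (t1 + t)) \<sigma>1"
    proof (rule wp_SeqI[OF wp_dfs[OF 1(1) c K]])
      fix t2 \<sigma>2 assume "\<exists>pot'. dfs_loop_inv K c ?B ?ma ?me ?lab pot' \<sigma>2 \<and> \<not> bval dfs_guard \<sigma>2 \<and>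
        160 * scan_pot A K c ?lab ?cur + t2 \<le> pot' + 20"
      then obtain pot' where 2: "dfs_loop_inv K c ?B ?ma ?me ?lab pot' \<sigma>2" "\<not> bval dfs_guard \<sigma>2"
        "160 * scan_pot A K c ?lab ?cur + t2 \<le> pot' + 20" by blast
      let ?lab2 = "arrs \<sigma>2 ''lab''" and ?cur2 = "arrs \<sigma>2 ''cur''"
      from 2(1) obtain k where dfs: "dfs_inv A c ?ma ?me ?lab2 ?cur2 (arrs \<sigma>2 ''par'') (regs \<sigma>2 ''u'') (regs \<sigma>2 ''found'') k"
        and pot': "pot' = 80 * (2 * scan_pot A K (Suc c) ?lab2 ?cur2 + k + (if regs \<sigma>2 ''found'' = 0 then 0 else 1))"
        and labB: "?lab2 c \<le> Suc ?B" and mono2: "\<forall>x. ?lab x \<le> ?lab2 x" unfolding dfs_loop_inv_def by blast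
      have kK: "k \<le> K" using dfs_inv_lab[OF dfs] labB K by linarith
      have t2: "160 * scan_pot A K c ?lab ?cur + t2 \<le> 160 * scan_pot A K (Suc c) ?lab2 ?cur2 + 80 * K + 100"
        using 2(3) pot' kK by (simp split: if_splits)
      have d2: "dead_pot A s c ?lab \<le> dead_pot A s (Suc c) ?lab2"
        using dead_pot_mono[of ?lab ?lab2 A s c] mono2 unfolding dead_pot_def by (simp add: trans_le_add1)
      show "wp w (Seq sap_bfs ?flip) (\<lambda>t. ?Q (t1 + (t2 + t))) \<sigma>2"
      proof (rule wp_SeqI[OF wp_sap_bfs[OF 2(1,2) c]])
        fix t3 \<sigma>3 assume "\<exists>lab' B'. aug_ready c ?B ?ma ?me lab' ?cur2 B' \<sigma>3 \<and> (\<forall>x. ?lab2 x \<le> lab' x) \<and>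
          t3 + 160 * dead_pot A s (Suc c) ?lab2 + 80 * (m + n + 1) * ?B \<le>
            160 * dead_pot A s (Suc c) lab' + 80 * (m + n + 1) * B' + 80"
        then obtain lab' B' where 3: "aug_ready c ?B ?ma ?me lab' ?cur2 B' \<sigma>3" "\<forall>x. ?lab2 x \<le> lab' x"
          "t3 + 160 * dead_pot A s (Suc c) ?lab2 + 80 * (m + n + 1) * ?B \<le>
            160 * dead_pot A s (Suc c) lab' + 80 * (m + n + 1) * B' + 80" by blast
        have cur2: "?cur2 u \<le> length (A u)" for u using dfs unfolding dfs_inv_def sap_inv_def by blast
        have s3: "scan_pot A K (Suc c) ?lab2 ?cur2 \<le> scan_pot A K (Suc c) lab' ?cur2"
          using 3(2) cur2 by (intro scan_pot_mono) auto
        show "wp w ?flip (\<lambda>t. ?Q (t1 + (t2 + (t3 + t)))) \<sigma>3"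
        proof (rule wp_mono[OF wp_sap_flip[OF 3(1) c hall, of K]])
          fix t4 \<sigma>4 assume 4: "run_inv (Suc c) \<sigma>4 \<and> regs \<sigma>4 ''cap'' = B' \<and>
            sap_step (edges_below A (Suc c)) (matched_edges c ?ma) c (matched_edges (Suc c) (arrs \<sigma>4 ''match'')) \<and>
            scan_pot A K (Suc c) lab' ?cur2 \<le> scan_pot A K (Suc c) (arrs \<sigma>4 ''lab'') (arrs \<sigma>4 ''cur'') \<and>
            dead_pot A s (Suc c) lab' \<le> dead_pot A s (Suc c) (arrs \<sigma>4 ''lab'') \<and> ?B \<le> B' \<and>
            t4 + 80 * n * ?B \<le> 80 * n * B' + 80 * (?B + 3)"
          have sum_up: "t + (160 * a + 160 * b + 160 * x) \<le> 80 * l + 160 * a2 + 80 * k + 160 * d + 160 * x' + 80 * y + 480 \<Longrightarrow>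
            a2 \<le> a3 \<Longrightarrow> y < k \<Longrightarrow> a3 \<le> a4 \<Longrightarrow> d \<le> d4 \<Longrightarrow>
            t + 80 * (2 * a + 2 * b + 2 * x) \<le> 80 * (2 * a4 + 2 * d4 + 2 * x' + l + 2 * k + 8)"
            for t a b x l a2 k d x' y a3 a4 d4 :: nat by auto
          \<comment> \<open>Hiding the product keeps the accounting linear.\<close>
          define X where "X b = (m + n + 1) * b" for b
          have X3: "t3 + 160 * dead_pot A s (Suc c) ?lab2 + 80 * X ?B \<le> 160 * dead_pot A s (Suc c) lab' + 80 * X B' + 80"
            using 3(3) unfolding X_def by (simp only: mult.assoc)
          have X4: "t4 + 80 * X ?B \<le> 80 * X B' + 80 * ?B + 240"
          proof -
            have "(m + 1) * ?B \<le> (m + 1) * B'" using 4 by (intro mult_le_mono2) blast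
            moreover have "t4 + 80 * (n * ?B) \<le> 80 * (n * B') + 80 * ?B + 240" using 4 by (simp add: algebra_simps)
            ultimately show ?thesis unfolding X_def by (simp add: algebra_simps)
          qed
          have p: "run_pot K c \<sigma> = 2 * scan_pot A K c ?lab ?cur + 2 * dead_pot A s c ?lab + 2 * X ?B"
            unfolding run_pot_def X_def by (simp add: algebra_simps)
          have p': "run_pot K (Suc c) \<sigma>4 = 2 * scan_pot A K (Suc c) (arrs \<sigma>4 ''lab'') (arrs \<sigma>4 ''cur'') +
              2 * dead_pot A s (Suc c) (arrs \<sigma>4 ''lab'') + 2 * X B'"
            using 4 unfolding run_pot_def X_def by (simp add: algebra_simps)
          have "t1 + (t2 + (t3 + t4)) + (160 * scan_pot A K c ?lab ?cur + 160 * dead_pot A s c ?lab + 160 * X ?B) \<le>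
            80 * length (A c) + 160 * scan_pot A K (Suc c) ?lab2 ?cur2 + 80 * K +
            160 * dead_pot A s (Suc c) lab' + 160 * X B' + 80 * ?B + 480"
            using 1(2) t2 d2 X3 X4 by linarith
          then have "t1 + (t2 + (t3 + t4)) + 80 * run_pot K c \<sigma> \<le>
            80 * (run_pot K (Suc c) \<sigma>4 + length (A c) + 2 * K + 8)"
            unfolding p p' using s3 K
              4[THEN conjunct2, THEN conjunct2, THEN conjunct2, THEN conjunct1]
              4[THEN conjunct2, THEN conjunct2, THEN conjunct2, THEN conjunct2, THEN conjunct1] by (rule sum_up)
          then show "?Q (t1 + (t2 + (t3 + t4))) \<sigma>4" using 4 by simp
        qed
      qed
    qed
  qed
  then show ?thesis unfolding sap_program_def by (rule wp_Seq_assoc)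
qed

subsection \<open>The whole run\<close>

lemma run_inv_initial: "run_inv 0 (initial_state s)"
  unfolding run_inv_def initial_state_def
  by (simp add: adj_inv_def sap_inv_def matching_arrays_def hall_inv_0)

lemma fits_word_initial: "fits_word w (initial_state s)"
  using word unfolding fits_word_def initial_state_def by simp

lemma fits_word_arrival: "i < n \<Longrightarrow> fits_word w \<sigma> \<Longrightarrow> fits_word w (arrival (A i) \<sigma>)"
proof -
  assume i: "i < n" and f: "fits_word w \<sigma>"
  have "length (A i) < 2 ^ w" using length_le[OF i] word by linarith
  moreover have "A i ! k < 2 ^ w" if "k < length (A i)" for k
    using servers[OF i] nth_mem[OF that] word by fastforce
  ultimately show ?thesis using f unfolding fits_word_def arrival_def by auto
qed

text \<open>The run is built before its final \<open>cap\<close> is known, so the time bound is kept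
  for every \<open>K\<close> above the current \<open>cap\<close>. As \<open>cap\<close> never
  decreases, a \<open>K\<close> admissible at the end was admissible at every earlier step.\<close>

lemma sap_run_exists:
  "i \<le> n \<Longrightarrow> \<exists>\<sigma> \<tau>. \<sigma> 0 = initial_state s \<and>
     (\<forall>j<i. exec w sap_program (arrival (A j) (\<sigma> j)) (\<tau> j) (\<sigma> (Suc j)) \<and>
        sap_step (edges_below A (Suc j)) (matched_edges j (arrs (\<sigma> j) ''match'')) j
          (matched_edges (Suc j) (arrs (\<sigma> (Suc j)) ''match''))) \<and>
     run_inv i (\<sigma> i) \<and> fits_word w (\<sigma> i) \<and>
     (\<forall>K > regs (\<sigma> i) ''cap''. (\<Sum>j<i. \<tau> j) \<le> 80 * (run_pot K i (\<sigma> i) + (\<Sum>j<i. length (A j) + 2 * K + 8)))"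
proof (induction i)
  case 0
  show ?case
    by (intro exI[of _ "\<lambda>_. initial_state s"] exI[of _ "\<lambda>_. 0"])
      (simp add: run_inv_initial fits_word_initial)
next
  case (Suc i)
  then obtain \<sigma> \<tau> where s0: "\<sigma> 0 = initial_state s"
    and ex: "\<And>j. j < i \<Longrightarrow> exec w sap_program (arrival (A j) (\<sigma> j)) (\<tau> j) (\<sigma> (Suc j)) \<and>
        sap_step (edges_below A (Suc j)) (matched_edges j (arrs (\<sigma> j) ''match'')) j
          (matched_edges (Suc j) (arrs (\<sigma> (Suc j)) ''match''))"
    and inv: "run_inv i (\<sigma> i)" and f: "fits_word w (\<sigma> i)"
    and time: "\<And>K. K > regs (\<sigma> i) ''cap'' \<Longrightarrow>
      (\<Sum>j<i. \<tau> j) \<le> 80 * (run_pot K i (\<sigma> i) + (\<Sum>j<i. length (A j) + 2 * K + 8))"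
    by auto
  let ?B = "regs (\<sigma> i) ''cap''"
  have i: "i < n" using Suc.prems by simp
  let ?R = "\<lambda>K t \<sigma>'. run_inv (Suc i) \<sigma>' \<and> ?B \<le> regs \<sigma>' ''cap'' \<and>
      sap_step (edges_below A (Suc i)) (matched_edges i (arrs (\<sigma> i) ''match'')) i (matched_edges (Suc i) (arrs \<sigma>' ''match'')) \<and>
      t + 80 * run_pot K i (\<sigma> i) \<le> 80 * (run_pot K (Suc i) \<sigma>' + length (A i) + 2 * K + 8)"
  \<comment> \<open>\<open>Suc (?B + k)\<close> runs through all admissible \<open>K\<close>, and a
    single execution serves them all.\<close>
  have "wp w sap_program (\<lambda>t \<sigma>'. \<forall>k. ?R (Suc (?B + k)) t \<sigma>') (arrival (A i) (\<sigma> i))"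
    by (rule wp_all, rule wp_sap_program[OF inv i]) simp
  then obtain t \<sigma>' where t: "exec w sap_program (arrival (A i) (\<sigma> i)) t \<sigma>'" "\<forall>k. ?R (Suc (?B + k)) t \<sigma>'"
    using fits_word_arrival[OF i f] unfolding wp_def by blast
  have R: "?R K t \<sigma>'" if "?B < K" for K
    using t(2)[rule_format, of "K - Suc ?B"] that by simp
  have f': "fits_word w \<sigma>'" using exec_fits_word[OF t(1) fits_word_arrival[OF i f]] .
  let ?s = "\<sigma>(Suc i := \<sigma>')" and ?t = "\<tau>(i := t)"
  have "exec w sap_program (arrival (A j) (?s j)) (?t j) (?s (Suc j)) \<and>
        sap_step (edges_below A (Suc j)) (matched_edges j (arrs (?s j) ''match'')) j
          (matched_edges (Suc j) (arrs (?s (Suc j)) ''match''))" if "j < Suc i" for j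
    using ex[of j] t(1) R[of "Suc ?B"] that by (cases "j = i") auto
  moreover have "(\<Sum>j<Suc i. ?t j) \<le> 80 * (run_pot K (Suc i) \<sigma>' + (\<Sum>j<Suc i. length (A j) + 2 * K + 8))"
    if K: "K > regs \<sigma>' ''cap''" for K
  proof -
    have KB: "?B < K" using R[of "Suc ?B"] K by simp
    have "(\<Sum>j<i. ?t j) = (\<Sum>j<i. \<tau> j)" by (intro sum.cong) auto
    then show ?thesis using R[OF KB] time[OF KB] by (simp add: algebra_simps)
  qed
  moreover have "?s 0 = initial_state s" using s0 by simp
  moreover have "run_inv (Suc i) \<sigma>'" using R[of "Suc ?B"] by simp
  ultimately show ?case using f' by (intro exI[of _ ?s] exI[of _ ?t]) auto
qed

lemma run_time_bound:
  assumes inv: "run_inv n \<sigma>" and n: "2 \<le> n" "n \<le> m"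
    and T: "T \<le> 80 * (run_pot K n \<sigma> + (\<Sum>j<n. length (A j) + 2 * K + 8))"
    and K: "K = Suc (regs \<sigma> ''cap'')"
  shows "real T \<le> 18000 * (real m * sqrt (real n) * sqrt (ln (real n)))"
proof -
  let ?lab = "arrs \<sigma> ''lab''" and ?cur = "arrs \<sigma> ''cur''" and ?ma = "arrs \<sigma> ''match''"
  have sap: "sap_inv A n ?ma (arrs \<sigma> ''mate'') ?lab ?cur" using inv unfolding run_inv_def by blast
  have mn: "(\<Sum>u<n. length (A u) + 1) \<le> m + n" by (rule sum_Suc_length_le) simp
  have "scan_pot A K n ?lab ?cur \<le> K * (\<Sum>u<n. length (A u) + 1)"
    using sap unfolding sap_inv_def by (intro scan_pot_bound) blast
  also have "\<dots> \<le> K * (2 * m)" using mn n by (intro mult_left_mono) auto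
  finally have 1: "scan_pot A K n ?lab ?cur \<le> 2 * (K * m)" by simp
  have mK: "m \<le> K * m" using K by simp
  have 2: "dead_pot A s n ?lab \<le> 2 * (K * m)" using dead_pot_bound[of A s n ?lab] mn n mK by linarith
  have "2 * (m + n + 1) * regs \<sigma> ''cap'' \<le> 2 * (3 * m) * K" using n K by (intro mult_mono) auto
  then have 3: "2 * (m + n + 1) * regs \<sigma> ''cap'' \<le> 6 * (K * m)" by (simp add: algebra_simps)
  have "n * (2 * K + 8) \<le> m * (10 * K)" using n K by (intro mult_mono) auto
  then have "(\<Sum>j<n. length (A j) + 2 * K + 8) \<le> m + m * (10 * K)"
    using edges by (simp add: sum.distrib algebra_simps)
  moreover have "m * (10 * K) = 10 * (K * m)" by simp
  ultimately have 4: "(\<Sum>j<n. length (A j) + 2 * K + 8) \<le> 11 * (K * m)" using mK by linarith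
  \<comment> \<open>The coefficients add up to 25, and 25 * 80 = 2000.\<close>
  have "run_pot K n \<sigma> + (\<Sum>j<n. length (A j) + 2 * K + 8) \<le>
      2 * (2 * (K * m)) + 2 * (2 * (K * m)) + 6 * (K * m) + 11 * (K * m)"
    unfolding run_pot_def using 1 2 3 4 by (intro add_mono mult_left_mono) auto
  then have "T \<le> 2000 * (K * m)" using T by simp
  then have "real T \<le> 2000 * (real K * real m)" by (simp flip: of_nat_mult)
  have ln: "1 / 2 \<le> ln (real n)"
  proof -
    have "exp (1 / 2 :: real) \<le> 2" using exp_bound_half[of "1/2 :: real"] by simp
    then have "1 / 2 \<le> ln (2 :: real)" by (subst ln_ge_iff) auto
    also have "\<dots> \<le> ln (real n)" using n by simp
    finally show ?thesis .
  qed
  have "1 \<le> real n * ln (real n)" using mult_mono[of 2 "real n" "1 / 2" "ln (real n)"] n ln by simp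
  then have one: "1 \<le> sqrt (real n * ln (real n))" by simp
  have "real (regs \<sigma> ''cap'') \<le> 8 * sqrt (real n * ln (real n))"
    using hall_inv_bound[of A n ?ma] inv n(1) sap unfolding run_inv_def sap_inv_def by blast
  \<comment> \<open>The successor in \<open>K\<close> is absorbed since \<open>n * ln n\<close> is
    at least 1; hence 9 in place of 8, and 9 * 2000 = 18000.\<close>
  then have "real K \<le> 9 * sqrt (real n * ln (real n))" using one unfolding K by linarith
  then have "2000 * (real K * real m) \<le> 2000 * ((9 * sqrt (real n * ln (real n))) * real m)"
    by (intro mult_left_mono mult_right_mono) auto
  also have "\<dots> = 18000 * (real m * sqrt (real n) * sqrt (ln (real n)))"
    by (simp add: real_sqrt_mult)
  finally show ?thesis using \<open>real T \<le> 2000 * (real K * real m)\<close> by linarith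
qed

end

text \<open>Links the edges of the theorem to the list entries counted in the locale: lists have no
  repetitions, and tagged endpoints determine the pair.\<close>

lemma card_graph_of:
  assumes "online_instance s Ns"
  shows "card (graph_of Ns) = (\<Sum>u<length Ns. length (Ns ! u))"
proof -
  let ?f = "\<lambda>(u, v). {Client u, Server v}"
  have "graph_of Ns = ?f ` (SIGMA u:{..<length Ns}. set (Ns ! u))"
    unfolding graph_of_def by auto
  moreover have "inj_on ?f (SIGMA u:{..<length Ns}. set (Ns ! u))"
    by (auto simp: inj_on_def doubleton_eq_iff)
  ultimately have "card (graph_of Ns) = (\<Sum>u<length Ns. card (set (Ns ! u)))"
    by (simp add: card_image)
  also have "\<dots> = (\<Sum>u<length Ns. length (Ns ! u))"
    using assms unfolding online_instance_def by (intro sum.cong) (auto simp: distinct_card)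
  finally show ?thesis .
qed

text \<open>The side conditions of the time bound belong to its formula: with a single client the
  logarithm vanishes, and clients without edges take time that \<open>m\<close> does not
  count.\<close>

theorem theorem2:
  shows "\<exists>(P :: com) (C :: real) (D :: nat).
    \<forall>(s :: nat) (Ns :: nat list list) (w :: nat) (n :: nat) (m :: nat).
      online_instance s Ns \<longrightarrow> n = length Ns \<longrightarrow> m = card (graph_of Ns) \<longrightarrow>
      (s + n + m + 2) ^ D \<le> 2 ^ w \<longrightarrow>
      (\<exists>\<sigma> \<tau>. online_run w P s Ns \<sigma> \<tau> \<and> follows_sap Ns \<sigma> \<and>
        (2 \<le> n \<longrightarrow> n \<le> m \<longrightarrow>
          real (\<Sum>i<n. \<tau> i) \<le> C * (real m * sqrt (real n) * sqrt (ln (real n)))))"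
\<comment> \<open>Exponent 1 suffices, since the memory holds only indices, labels up to
  \<open>s\<close> and counters.\<close>
proof (intro exI[of _ sap_program] exI[of _ "18000 :: real"] exI[of _ "1 :: nat"] allI impI)
  fix s Ns w n m
  assume inst: "online_instance s Ns" and n: "n = length Ns" and m: "m = card (graph_of Ns)"
    and w: "(s + n + m + 2) ^ 1 \<le> (2 :: nat) ^ w"
  interpret sap_run "(!) Ns" s n m w
    using inst n m w card_graph_of[OF inst] by unfold_locales (auto simp: online_instance_def)
  obtain \<sigma> \<tau> where s0: "\<sigma> 0 = initial_state s"
    and ex: "\<And>j. j < n \<Longrightarrow> exec w sap_program (arrival (Ns ! j) (\<sigma> j)) (\<tau> j) (\<sigma> (Suc j)) \<and>
        sap_step (edges_below ((!) Ns) (Suc j)) (matched_edges j (arrs (\<sigma> j) ''match'')) j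
          (matched_edges (Suc j) (arrs (\<sigma> (Suc j)) ''match''))"
    and inv: "run_inv n (\<sigma> n)"
    and time: "\<And>K. K > regs (\<sigma> n) ''cap'' \<Longrightarrow>
      (\<Sum>j<n. \<tau> j) \<le> 80 * (run_pot K n (\<sigma> n) + (\<Sum>j<n. length (Ns ! j) + 2 * K + 8))"
    using sap_run_exists[of n] by auto
  have "online_run w sap_program s Ns \<sigma> \<tau>" unfolding online_run_def using s0 ex n by simp
  moreover have "follows_sap Ns \<sigma>"
    unfolding follows_sap_def matching_of_def matched_edges_def[symmetric]
    using ex n by (simp add: graph_of_take)
  moreover have "real (\<Sum>i<n. \<tau> i) \<le> 18000 * (real m * sqrt (real n) * sqrt (ln (real n)))"
    if "2 \<le> n" "n \<le> m"
    using run_time_bound[OF inv that time[OF lessI] refl] .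
  ultimately show "\<exists>\<sigma> \<tau>. online_run w sap_program s Ns \<sigma> \<tau> \<and> follows_sap Ns \<sigma> \<and>
        (2 \<le> n \<longrightarrow> n \<le> m \<longrightarrow>
          real (\<Sum>i<n. \<tau> i) \<le> 18000 * (real m * sqrt (real n) * sqrt (ln (real n))))" by blast
qed

end
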